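(* Let $(S_i)_{i\in\mathbb N_0}$ and $(S_i')_{i\in\mathbb N_0}$ be two independent copies of the renewal process and let $\mathsf E^{\otimes2}_{n,h,\omega}$ denote the expectation under the product law of their quenched Gibbs measures in the same environment $\omega\in\Omega$. Then for any closed set $H\subset\mathbb R$ with $H\subset(h_c,+\infty)$ there exist $C>0$ and $\lambda>0$ such that for all $n\in\mathbb N$ $$\mathbb E\Bigg[\sup_{h\in H}\mathsf E^{\otimes2}_{n,h,\cdot}\bigg[\prod_{k=1}^{n-1}(1-X_kX_k')\bigg]\Bigg]\le Ce^{-\lambda n}.$$
   Context: Notation: $\mathbb N=\{1,2,\ldots\}$, $\mathbb N_0=\{0\}\cup\mathbb N$. Renewal process: under a law $\mathsf P$ (expectation $\mathsf E$), $T_1,T_2,\ldots$ are i.i.d. $\mathbb N$-valued random variables with $p(t):=\mathsf P[T_1=t]=\ell(t)/t^{\alpha+1}>0$ for all $t\in\mathbb N$, where $\alpha\ge0$ and $\ell:[1,+\infty)\to[0,+\infty)$ is slowly varying at infinity. Set $S_0=0$, $S_i=T_1+\cdots+T_i$, $S=(S_i)_{i\in\mathbb N_0}$, and $X_a=\mathbf 1_{\{a\in S\}}$ for $a\in\mathbb N_0$. For the second copy $S'$, $X_a'=\mathbf 1_{\{a\in S'\}}$. Disorder: $\Omega=\mathbb R^{\mathbb N_0}$ with its Borel $\sigma$-field carries a probability measure $\mathbb P$ (expectation $\mathbb E$) under which the coordinates of $\omega=(\omega_a)_{a\in\mathbb N_0}$ form a centered stationary Gaussian sequence with covariance function $\gamma(a)=\int_\Omega\omega_0\omega_a\,\mathbb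 P[d\omega]$, $a\in\mathbb N_0$, satisfying $\bar\gamma:=\sum_{a\in\mathbb N_0}|\gamma(a)|<+\infty$. Pinning model: for $n\in\mathbb N$, $h\in\mathbb R$, $\omega\in\Omega$, the quenched Gibbs measure $\mathsf P_{n,h,\omega}$ is defined by $\frac{d\mathsf P_{n,h,\omega}}{d\mathsf P}=\frac{1}{Z_{n,h}(\omega)}e^{\sum_{a=1}^n(h+\omega_a)X_a}X_n$ with $Z_{n,h}(\omega)=\mathsf E\big[e^{\sum_{a=1}^n(h+\omega_a)X_a}X_n\big]$. A dot in place of $\omega$ indicates the corresponding function of $\omega\in\Omega$. Free energy and critical point: $f(h)=\lim_{n\uparrow\infty}\mathbb E[\frac1n\log Z_{n,h}]$, which exists and is finite and non-negative for all $h\in\mathbb R$; $h_c=\inf\{h\in\mathbb R:f(h)>0\}$, and $-\infty<h_c\le0$. *)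

theory Defs
  imports "HOL-Probability.Probability"
begin

definition slowly_varying :: "(real \<Rightarrow> real) \<Rightarrow> bool" where
  "slowly_varying l \<longleftrightarrow>
     l \<in> borel_measurable (restrict_space borel {1..}) \<and>
     (\<forall>x\<ge>1. 0 \<le> l x) \<and>
     (\<forall>c>0. ((\<lambda>x. l (c * x) / l x) \<longlongrightarrow> 1) at_top)"

text \<open>The inter-arrival times are \<open>T 1, T 2, \<dots>\<close>; the value \<open>T 0\<close> plays no role.\<close>

definition renewal_increments ::
    "'a measure \<Rightarrow> (nat \<Rightarrow> 'a \<Rightarrow> nat) \<Rightarrow> real \<Rightarrow> (real \<Rightarrow> real) \<Rightarrow> bool" where
  "renewal_increments M T \<alpha> l \<longleftrightarrow>
     prob_space M \<and>
     prob_space.indep_vars M (\<lambda>_. count_space UNIV) T {1..} \<and>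
     (\<forall>i\<ge>1. distr M (count_space UNIV) (T i) = distr M (count_space UNIV) (T 1)) \<and>
     (\<forall>i\<ge>1. \<forall>x\<in>space M. 1 \<le> T i x) \<and>
     (\<forall>t\<ge>1. measure M {x \<in> space M. T 1 x = t} = l (real t) / real t powr (\<alpha> + 1) \<and>
            0 < measure M {x \<in> space M. T 1 x = t})"

definition renewal_time :: "(nat \<Rightarrow> 'a \<Rightarrow> nat) \<Rightarrow> nat \<Rightarrow> 'a \<Rightarrow> nat" where
  "renewal_time T i x = (\<Sum>j=1..i. T j x)"

definition contact :: "(nat \<Rightarrow> 'a \<Rightarrow> nat) \<Rightarrow> nat \<Rightarrow> 'a \<Rightarrow> real" where
  "contact T a x = of_bool (a \<in> range (\<lambda>i. renewal_time T i x))"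

text \<open>Normal law with mean \<open>\<mu>\<close> and standard deviation \<open>\<sigma> \<ge> 0\<close>, with the usual convention
  that the degenerate case \<open>\<sigma> = 0\<close> is a point mass.\<close>

definition normal_law :: "real \<Rightarrow> real \<Rightarrow> real measure" where
  "normal_law \<mu> \<sigma> =
     (if \<sigma> = 0 then return borel \<mu> else density lborel (\<lambda>x. ennreal (normal_density \<mu> \<sigma> x)))"

definition gaussian_sequence :: "(nat \<Rightarrow> real) measure \<Rightarrow> bool" where
  "gaussian_sequence P \<longleftrightarrow>
     (\<forall>(N::nat) (c::nat \<Rightarrow> real). \<exists>\<mu> \<sigma>. 0 \<le> \<sigma> \<and>
        distr P borel (\<lambda>\<omega>. \<Sum>a<N. c a * \<omega> a) = normal_law \<mu> \<sigma>)"

text \<open>The Borel \<open>\<sigma>\<close>-algebra below is that of the product topology on \<^typ>\<open>nat \<Rightarrow> real\<close>.\<close>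

definition centered_stationary_gaussian :: "(nat \<Rightarrow> real) measure \<Rightarrow> bool" where
  "centered_stationary_gaussian P \<longleftrightarrow>
     prob_space P \<and> sets P = sets borel \<and>
     gaussian_sequence P \<and>
     (\<forall>a. (\<integral>\<omega>. \<omega> a \<partial>P) = 0) \<and>
     distr P borel (\<lambda>\<omega> a. \<omega> (Suc a)) = P"

definition autocovariance :: "(nat \<Rightarrow> real) measure \<Rightarrow> nat \<Rightarrow> real" where
  "autocovariance P a = (\<integral>\<omega>. \<omega> 0 * \<omega> a \<partial>P)"

definition boltzmann_weight ::
    "(nat \<Rightarrow> 'a \<Rightarrow> nat) \<Rightarrow> nat \<Rightarrow> real \<Rightarrow> (nat \<Rightarrow> real) \<Rightarrow> 'a \<Rightarrow> real" where
  "boltzmann_weight T n h \<omega> x = exp (\<Sum>a=1..n. (h + \<omega> a) * contact T a x) * contact T n x"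

definition partition_function ::
    "'a measure \<Rightarrow> (nat \<Rightarrow> 'a \<Rightarrow> nat) \<Rightarrow> nat \<Rightarrow> real \<Rightarrow> (nat \<Rightarrow> real) \<Rightarrow> real" where
  "partition_function M T n h \<omega> = (\<integral>x. boltzmann_weight T n h \<omega> x \<partial>M)"

definition quenched_gibbs ::
    "'a measure \<Rightarrow> (nat \<Rightarrow> 'a \<Rightarrow> nat) \<Rightarrow> nat \<Rightarrow> real \<Rightarrow> (nat \<Rightarrow> real) \<Rightarrow> 'a measure" where
  "quenched_gibbs M T n h \<omega> =
     density M (\<lambda>x. ennreal (boltzmann_weight T n h \<omega> x / partition_function M T n h \<omega>))"

definition free_energy ::
    "'a measure \<Rightarrow> (nat \<Rightarrow> 'a \<Rightarrow> nat) \<Rightarrow> (nat \<Rightarrow> real) measure \<Rightarrow> real \<Rightarrow> real" where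
  "free_energy M T P h =
     lim (\<lambda>n. \<integral>\<omega>. 1 / real n * ln (partition_function M T n h \<omega>) \<partial>P)"

definition critical_point ::
    "'a measure \<Rightarrow> (nat \<Rightarrow> 'a \<Rightarrow> nat) \<Rightarrow> (nat \<Rightarrow> real) measure \<Rightarrow> real" where
  "critical_point M T P = Inf {h. 0 < free_energy M T P h}"

text \<open>Expectation under two replicas in the same environment: the copies \<open>S\<close> and \<open>S'\<close> are read
  off the two coordinates of the product space.\<close>

definition replica_expectation ::
    "'a measure \<Rightarrow> (nat \<Rightarrow> 'a \<Rightarrow> nat) \<Rightarrow> nat \<Rightarrow> real \<Rightarrow> (nat \<Rightarrow> real) \<Rightarrow> ('a \<times> 'a \<Rightarrow> real) \<Rightarrow> real"
  where
  "replica_expectation M T n h \<omega> F =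
     (\<integral>z. F z \<partial>(quenched_gibbs M T n h \<omega> \<Otimes>\<^sub>M quenched_gibbs M T n h \<omega>))"

end

(* The replica expectation is a sum over pairs of finite contact sets, weighted by products over
   gaps.  If two contact sets A and A' do not meet but A has k points in short gaps of A' where the
   disorder is not too negative, adding any subset of these points to A' costs a bounded factor c
   per point and the pair (A, A') can be read off the result, so such pairs have Gibbs weight at
   most (1 + c)^(-k).  When h > h_c, k is of order n outside an event of exponentially small
   expectation, because long gaps cover only a small fraction of [0, n]: a family J of gaps has
   quenched probability at most the product over J of 1 / Z_gap, and log Z of these gaps has mean
   at least mu |J| and concentrates at scale sqrt |J|, the covariance being summable.  All bounds
   are monotone in h, so that only the smallest h matters. *)

theory Submission
  imports Defs
begin

section \<open>Contact sets and their gaps\<close>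

text \<open>Three obstacles shape the proof. (1) The two paths play different roles. If the gaps
  longer than L cover at most half of [0, n], then A has about n/(2L) points; the length L' beyond
  which a gap of A' counts as long is fixed only afterwards, so that such gaps swallow at most
  n/(4L) of them. (2) The bound by the product of 1 / Z_gap cannot be averaged directly: in an
  exponential moment of order s the gain is s mu |J|, but the Gaussian error grows like s^2 |J|. A
  probability is also at most 1, hence at most the s-th power of that product for 0 <= s <= 1, and s
  is taken small against mu and the covariance sum. The sum over families J is paid for by a large
  L. (3) The disorder variables are dependent and their covariance may be degenerate. Concentration
  therefore comes from rotating two independent copies of the environment into each other, with
  subgradients of the convex function log Z in place of derivatives. The Gaussian input is reduced
  to characteristic functions and exponential moments of linear forms, and to row sums of the
  covariance.\<close>

definition gaps :: "nat set \<Rightarrow> (nat \<times> nat) set" where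
  "gaps A = {(a, b). a \<in> A \<and> b \<in> A \<and> a < b \<and> A \<inter> {a<..<b} = {}}"

definition paths :: "nat \<Rightarrow> nat \<Rightarrow> nat set set" where
  "paths a b = {A. {a, b} \<subseteq> A \<and> A \<subseteq> {a..b}}"

definition gap_weight :: "(nat \<Rightarrow> real) \<Rightarrow> (nat \<times> nat) set \<Rightarrow> real" where
  "gap_weight p J = (\<Prod>(a, b)\<in>J. p (b - a))"

text \<open>The weights \<open>v\<close> at the two endpoints are left out. Paths can then be joined
  or refined without counting a site twice, and \<open>path_sum p v a b\<close> depends on
  \<open>v\<close> only inside the open interval: the log partition functions of disjoint gaps are
  functions of disjoint blocks of the disorder.\<close>

definition path_weight :: "(nat \<Rightarrow> real) \<Rightarrow> (nat \<Rightarrow> real) \<Rightarrow> nat \<Rightarrow> nat \<Rightarrow> nat set \<Rightarrow> real" where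
  "path_weight p v a b A = gap_weight p (gaps A) * exp (\<Sum>x\<in>A - {a, b}. v x)"

definition path_sum :: "(nat \<Rightarrow> real) \<Rightarrow> (nat \<Rightarrow> real) \<Rightarrow> nat \<Rightarrow> nat \<Rightarrow> real" where
  "path_sum p v a b = (\<Sum>A\<in>paths a b. path_weight p v a b A)"

lemma finite_paths [simp]: "finite (paths a b)"
  by (rule finite_subset[of _ "Pow {a..b}"]) (auto simp: paths_def)

lemma finite_path: "A \<in> paths a b \<Longrightarrow> finite A"
  unfolding paths_def using finite_subset by blast

lemma finite_gaps [simp]: "finite A \<Longrightarrow> finite (gaps A)"
  by (rule finite_subset[of _ "A \<times> A"]) (auto simp: gaps_def)

lemma gaps_pair: "a < b \<Longrightarrow> gaps {a, b} = {(a, b)}"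
  by (auto simp: gaps_def)

lemma gap_in_path_bounds:
  "A \<in> paths a b \<Longrightarrow> (c, d) \<in> gaps A \<Longrightarrow> a \<le> c \<and> c < d \<and> d \<le> b"
  by (auto simp: gaps_def paths_def)

lemma gaps_disjoint:
  assumes "(a, b) \<in> gaps A" "(c, d) \<in> gaps A" "(a, b) \<noteq> (c, d)"
  shows "{a<..<b} \<inter> {c<..<d} = {}"
proof (rule ccontr)
  assume "{a<..<b} \<inter> {c<..<d} \<noteq> {}"
  then obtain x where x: "a < x" "x < b" "c < x" "x < d" by auto
  have "\<not> (a < c \<and> c < b)" "\<not> (a < d \<and> d < b)" "\<not> (c < a \<and> a < d)" "\<not> (c < b \<and> b < d)"
    using assms by (auto simp: gaps_def)
  then show False using x assms(3) by auto
qed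

text \<open>\<open>A\<close> has no point strictly between \<open>a\<close> and \<open>b\<close>,
  and \<open>D\<close> has none outside \<open>{a..b}\<close>, so neighbours in the union are
  neighbours in one of the two sets; only the gap \<open>(a, b)\<close> gets refined. Disjointness
  is what splits a product over gaps into two products.\<close>

lemma gaps_splice:
  assumes ab: "(a, b) \<in> gaps A" and D: "D \<in> paths a b"
  shows "gaps (A \<union> D) = (gaps A - {(a, b)}) \<union> gaps D"
    and "(gaps A - {(a, b)}) \<inter> gaps D = {}"
proof -
  have aA: "a \<in> A" "b \<in> A" "a < b" and A: "\<And>z. z \<in> A \<Longrightarrow> z \<le> a \<or> b \<le> z"
    using ab by (auto simp: gaps_def)
  have aD: "a \<in> D" "b \<in> D" and DD: "\<And>z. z \<in> D \<Longrightarrow> a \<le> z \<and> z \<le> b"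
    using D by (auto simp: paths_def)
  have "(x, y) \<in> (gaps A - {(a, b)}) \<union> gaps D" if xy: "(x, y) \<in> gaps (A \<union> D)" for x y
  proof -
    have 1: "x \<in> A \<union> D" "y \<in> A \<union> D" "x < y" and 2: "\<And>z. z \<in> A \<union> D \<Longrightarrow> z \<le> x \<or> y \<le> z"
      using xy by (auto simp: gaps_def)
    have gA: "(x, y) \<in> gaps A" if "x \<in> A" "y \<in> A"
      using xy that by (auto simp: gaps_def)
    have gD: "(x, y) \<in> gaps D" if "x \<in> D" "y \<in> D"
      using xy that by (auto simp: gaps_def)
    consider "x < a" | "b \<le> x" | "a \<le> x" "x < b" by linarith
    then show ?thesis
    proof cases
      case 1
      then have "y \<le> a" using 2[of a] aA by auto
      then have "x \<in> A" "y \<in> A" using 1 DD[of x] DD[of y] aA \<open>x \<in> A \<union> D\<close> \<open>y \<in> A \<union> D\<close>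
        by (auto dest: le_antisym)
      with gA 1 show ?thesis by auto
    next
      case 2
      then have "x \<in> A" "y \<in> A"
        using DD[of x] DD[of y] aA \<open>x \<in> A \<union> D\<close> \<open>y \<in> A \<union> D\<close> \<open>x < y\<close>
        by (auto dest: le_antisym)
      with gA 2 aA show ?thesis by auto
    next
      case 3
      then have "y \<le> b" using 2[of b] aA by auto
      then have "x \<in> D" "y \<in> D"
        using A[of x] A[of y] aD 3 \<open>x \<in> A \<union> D\<close> \<open>y \<in> A \<union> D\<close> \<open>x < y\<close>
        by (auto dest: le_antisym)
      with gD show ?thesis by auto
    qed
  qed
  moreover have "(x, y) \<in> gaps (A \<union> D)" if xy: "(x, y) \<in> gaps A - {(a, b)}" for x y
  proof -
    have "x \<in> A" "y \<in> A" "x < y" "\<And>z. z \<in> A \<Longrightarrow> z \<le> x \<or> y \<le> z" "(x, y) \<noteq> (a, b)"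
      using xy by (auto simp: gaps_def)
    then have "y \<le> a \<or> b \<le> x" using A[of x] A[of y] aA by (metis le_antisym le_trans not_le)
    then have "z \<le> x \<or> y \<le> z" if "z \<in> D" for z using DD[OF that] by auto
    with xy show ?thesis by (fastforce simp: gaps_def)
  qed
  moreover have "(x, y) \<in> gaps (A \<union> D)" if xy: "(x, y) \<in> gaps D" for x y
  proof -
    have "x \<in> D" "y \<in> D" using xy by (auto simp: gaps_def)
    then have "z \<le> x \<or> y \<le> z" if "z \<in> A" for z using A[OF that] DD by (meson le_trans)
    with xy show ?thesis by (fastforce simp: gaps_def)
  qed
  ultimately show "gaps (A \<union> D) = (gaps A - {(a, b)}) \<union> gaps D" by auto
  have False if "(x, y) \<in> gaps A - {(a, b)}" "(x, y) \<in> gaps D" for x y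
  proof -
    have "x \<in> {a..b}" "y \<in> {a..b}" "x \<in> A" "y \<in> A" "x < y" "(x, y) \<noteq> (a, b)"
      using that DD by (auto simp: gaps_def)
    then show False using A[of x] A[of y] by auto
  qed
  then show "(gaps A - {(a, b)}) \<inter> gaps D = {}" by auto
qed

lemma path_union:
  assumes "(a, b) \<in> gaps A" "D \<in> paths a b" "A \<in> paths m n"
  shows "A \<union> D \<in> paths m n"
  using assms by (fastforce simp: gaps_def paths_def)

text \<open>The gap \<open>(a, b)\<close> is exchanged for the gaps of \<open>D\<close>, and the
  inner points of \<open>D\<close> are new. The factor \<open>p (b - a)\<close> stands on the left
  so that the identity involves no division.\<close>

lemma path_weight_splice:
  assumes ab: "(a, b) \<in> gaps A" and D: "D \<in> paths a b" and A: "A \<in> paths m n"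
  shows "path_weight p v m n (A \<union> D) * p (b - a) = path_weight p v m n A * path_weight p v a b D"
proof -
  have fin: "finite A" "finite D" using finite_path A D by auto
  have "gap_weight p (gaps (A \<union> D)) = gap_weight p (gaps A - {(a, b)}) * gap_weight p (gaps D)"
    unfolding gap_weight_def gaps_splice(1)[OF ab D]
    by (intro prod.union_disjoint gaps_splice(2)[OF ab D]) (use fin in auto)
  moreover have "gap_weight p (gaps A) = p (b - a) * gap_weight p (gaps A - {(a, b)})"
    unfolding gap_weight_def using fin ab by (subst prod.remove[of _ "(a, b)"]) auto
  moreover have "A \<union> D - {m, n} = (A - {m, n}) \<union> (D - {a, b})" "(A - {m, n}) \<inter> (D - {a, b}) = {}"
  proof -
    have "a \<in> A" "b \<in> A" "\<And>z. z \<in> A \<Longrightarrow> z \<le> a \<or> b \<le> z" "m \<le> a" "b \<le> n"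
      using ab A by (auto simp: gaps_def paths_def)
    moreover have "\<And>z. z \<in> D \<Longrightarrow> a \<le> z \<and> z \<le> b" "a \<in> D" "b \<in> D" using D by (auto simp: paths_def)
    ultimately show "A \<union> D - {m, n} = (A - {m, n}) \<union> (D - {a, b})" "(A - {m, n}) \<inter> (D - {a, b}) = {}"
      by (auto, (metis le_antisym le_trans)+)
  qed
  then have "sum v (A \<union> D - {m, n}) = sum v (A - {m, n}) + sum v (D - {a, b})"
    using fin by (simp add: sum.union_disjoint)
  ultimately show ?thesis
    by (simp add: path_weight_def exp_add)
qed

section \<open>Weights of paths through prescribed gaps\<close>

locale positive_kernel =
  fixes p :: "nat \<Rightarrow> real"
  assumes p_pos: "\<And>t. 1 \<le> t \<Longrightarrow> 0 < p t" and p_le_1: "\<And>t. p t \<le> 1"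
begin

lemma p_diff_pos [simp]: "a < b \<Longrightarrow> 0 < p (b - a)"
  by (rule p_pos) simp

lemma p_diff_nonneg [simp]: "a < b \<Longrightarrow> 0 \<le> p (b - a)"
  by (rule less_imp_le) simp

lemma gap_weight_pos: "J \<subseteq> gaps A \<Longrightarrow> 0 < gap_weight p J"
  unfolding gap_weight_def by (intro prod_pos) (auto simp: gaps_def intro!: p_pos)

lemma path_weight_pos: "0 < path_weight p v a b A"
  unfolding path_weight_def using gap_weight_pos[OF order_refl, of A] by simp

lemma path_weight_nonneg [simp]: "0 \<le> path_weight p v a b A"
  using path_weight_pos[of v a b A] by simp

lemma path_sum_ge_p:
  assumes "a < b" shows "p (b - a) \<le> path_sum p v a b"
proof -
  have "path_weight p v a b {a, b} \<le> path_sum p v a b"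
    unfolding path_sum_def using assms
    by (intro member_le_sum) (auto simp: paths_def)
  moreover have "path_weight p v a b {a, b} = p (b - a)"
    using assms by (simp add: path_weight_def gap_weight_def gaps_pair)
  ultimately show ?thesis by simp
qed

lemma path_sum_pos: "a < b \<Longrightarrow> 0 < path_sum p v a b"
  using path_sum_ge_p[of a b v] p_diff_pos[of a b] by linarith

lemma path_sum_mono:
  assumes "\<And>x. v x \<le> v' x" shows "path_sum p v a b \<le> path_sum p v' a b"
  unfolding path_sum_def path_weight_def
  using gap_weight_pos[OF order_refl]
  by (intro sum_mono mult_left_mono) (auto intro: sum_mono assms simp: less_imp_le)

text \<open>A path \<open>A\<close> with gap \<open>(a, b)\<close> and an arbitrary path
  \<open>D\<close> from \<open>a\<close> to \<open>b\<close> merge without loss of information: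
  deleting the open interval gives back \<open>A\<close>, restricting to the closed one gives back
  \<open>D\<close>. In Gibbs terms, requiring one further gap costs a factor of at most
  \<open>p (b - a) / path_sum p v a b\<close>.\<close>

lemma gap_sum_step:
  assumes ab: "a < b" "(a, b) \<notin> J"
  shows "(\<Sum>A | A \<in> paths m n \<and> insert (a, b) J \<subseteq> gaps A. path_weight p v m n A) * path_sum p v a b
     \<le> p (b - a) * (\<Sum>A | A \<in> paths m n \<and> J \<subseteq> gaps A. path_weight p v m n A)"
proof -
  let ?S = "{A \<in> paths m n. insert (a, b) J \<subseteq> gaps A}" and ?T = "{A \<in> paths m n. J \<subseteq> gaps A}"
  have inj: "inj_on (\<lambda>(A, D). A \<union> D) (?S \<times> paths a b)"
  proof (rule inj_on_inverseI[where g = "\<lambda>E. (E - {a<..<b}, E \<inter> {a..b})"])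
    fix x assume "x \<in> ?S \<times> paths a b"
    then obtain A D where x: "x = (A, D)" and *: "D \<in> paths a b" "insert (a, b) J \<subseteq> gaps A" by auto
    then have ab': "a \<in> A" "b \<in> A" "a \<in> D" "b \<in> D"
      and A: "\<And>z. z \<in> A \<Longrightarrow> z \<le> a \<or> b \<le> z" and D: "\<And>z. z \<in> D \<Longrightarrow> a \<le> z \<and> z \<le> b"
      by (auto simp: gaps_def paths_def)
    have 1: "z \<in> A \<longleftrightarrow> z \<in> A \<union> D - {a<..<b}" for z
      using A[of z] D[of z] ab' ab by (cases "z = a"; cases "z = b") auto
    have 2: "z \<in> D \<longleftrightarrow> z \<in> (A \<union> D) \<inter> {a..b}" for z
      using A[of z] D[of z] ab' ab by (cases "z = a"; cases "z = b") auto
    have "A \<union> D - {a<..<b} = A" "(A \<union> D) \<inter> {a..b} = D"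
      using 1 2 by blast+
    then show "((case x of (A, D) \<Rightarrow> A \<union> D) - {a<..<b}, (case x of (A, D) \<Rightarrow> A \<union> D) \<inter> {a..b}) = x"
      by (simp add: x)
  qed
  \<comment> \<open>Splicing destroys only the gap \<open>(a, b)\<close>, which does not belong to
    \<open>J\<close>.\<close>
  have sub: "(\<lambda>(A, D). A \<union> D) ` (?S \<times> paths a b) \<subseteq> ?T"
  proof clarify
    fix A D assume *: "A \<in> paths m n" "insert (a, b) J \<subseteq> gaps A" "D \<in> paths a b"
    then have "gaps (A \<union> D) = (gaps A - {(a, b)}) \<union> gaps D" by (intro gaps_splice) auto
    then show "A \<union> D \<in> paths m n \<and> J \<subseteq> gaps (A \<union> D)"
      using * path_union[of a b A D m n] ab(2) by auto
  qed
  have "(\<Sum>A\<in>?S. path_weight p v m n A) * path_sum p v a b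
      = (\<Sum>(A, D)\<in>?S \<times> paths a b. path_weight p v m n A * path_weight p v a b D)"
    unfolding path_sum_def by (simp add: sum_product sum.cartesian_product)
  also have "\<dots> = (\<Sum>(A, D)\<in>?S \<times> paths a b. path_weight p v m n (A \<union> D) * p (b - a))"
    by (intro sum.cong refl) (auto simp: path_weight_splice)
  also have "\<dots> = (\<Sum>E\<in>(\<lambda>(A, D). A \<union> D) ` (?S \<times> paths a b). path_weight p v m n E * p (b - a))"
    by (subst sum.reindex[OF inj]) (auto intro!: sum.cong)
  also have "\<dots> \<le> (\<Sum>E\<in>?T. path_weight p v m n E * p (b - a))"
    using ab by (intro sum_mono2 sub) auto
  finally show ?thesis by (simp add: sum_distrib_left mult.commute)
qed

lemma gap_sum_le:
  assumes "finite J" "\<And>a b. (a, b) \<in> J \<Longrightarrow> a < b"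
  shows "(\<Sum>A | A \<in> paths m n \<and> J \<subseteq> gaps A. path_weight p v m n A)
     \<le> (\<Prod>(a, b)\<in>J. p (b - a) / path_sum p v a b) * path_sum p v m n"
  using assms
proof (induction J)
  case empty
  then show ?case by (simp add: path_sum_def)
next
  case (insert e J)
  obtain a b where e: "e = (a, b)" by (cases e)
  have ab: "a < b" using insert.prems e by auto
  let ?q = "p (b - a) / path_sum p v a b"
  have pos: "0 < path_sum p v a b" using path_sum_pos ab by auto
  have "(\<Sum>A | A \<in> paths m n \<and> insert e J \<subseteq> gaps A. path_weight p v m n A)
     \<le> ?q * (\<Sum>A | A \<in> paths m n \<and> J \<subseteq> gaps A. path_weight p v m n A)"
    using gap_sum_step[where a=a and b=b and J=J and m=m and n=n and v=v] ab insert.hyps pos e by (simp add: field_simps)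
  also have "\<dots> \<le> ?q * ((\<Prod>(a, b)\<in>J. p (b - a) / path_sum p v a b) * path_sum p v m n)"
    using insert.IH insert.prems pos p_diff_pos[of a b] ab by (intro mult_left_mono) (simp_all add: less_imp_le)
  also have "\<dots> = (\<Prod>(a, b)\<in>insert e J. p (b - a) / path_sum p v a b) * path_sum p v m n"
    using insert.hyps e by simp
  finally show ?case .
qed

text \<open>This is the two-gap case of \<open>gap_sum_le\<close>: the path that visits only
  \<open>b\<close> in between has weight \<open>p (b - a) * p (c - b) * exp (v b)\<close>, and both
  factors of \<open>p\<close> cancel against those in the bound.\<close>

lemma path_sum_superadd:
  assumes "a < b" "b < c"
  shows "path_sum p v a b * exp (v b) * path_sum p v b c \<le> path_sum p v a c"
proof -
  let ?A = "{a, b, c}"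
  have g: "gaps ?A = {(a, b), (b, c)}" using assms by (auto simp: gaps_def)
  have w: "path_weight p v a c ?A = p (b - a) * p (c - b) * exp (v b)"
  proof -
    have "?A - {a, c} = {b}" using assms by auto
    then show ?thesis using assms by (simp add: path_weight_def gap_weight_def g)
  qed
  have "path_weight p v a c ?A \<le> (\<Sum>A | A \<in> paths a c \<and> {(a, b), (b, c)} \<subseteq> gaps A. path_weight p v a c A)"
    using assms g by (intro member_le_sum) (auto simp: paths_def)
  also have "\<dots> \<le> (\<Prod>(a, b)\<in>{(a, b), (b, c)}. p (b - a) / path_sum p v a b) * path_sum p v a c"
    using assms by (intro gap_sum_le) auto
  also have "\<dots> = p (b - a) * p (c - b) / (path_sum p v a b * path_sum p v b c) * path_sum p v a c"
    using assms by simp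
  finally have "p (b - a) * p (c - b) * exp (v b)
     \<le> p (b - a) * p (c - b) / (path_sum p v a b * path_sum p v b c) * path_sum p v a c"
    by (simp add: w)
  then show ?thesis
    using assms p_diff_pos[of a b] p_diff_pos[of b c] path_sum_pos[of a b v] path_sum_pos[of b c v]
    by (simp add: field_simps)
qed

lemma path_sum_shift:
  assumes "a < b"
  shows "path_sum p v (a + k) (b + k) = path_sum p (\<lambda>x. v (x + k)) a b"
proof -
  let ?f = "\<lambda>A. (\<lambda>x. x + k) ` A"
  have inj: "inj_on ?f (paths a b)" by (intro inj_onI) (simp add: inj_image_eq_iff inj_def)
  have img: "?f ` paths a b = paths (a + k) (b + k)"
  proof (intro equalityI subsetI)
    fix B assume "B \<in> paths (a + k) (b + k)"
    then have B: "a + k \<in> B" "b + k \<in> B" "\<And>x. x \<in> B \<Longrightarrow> a + k \<le> x \<and> x \<le> b + k"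
      by (auto simp: paths_def)
    have "?f ((\<lambda>x. x - k) ` B) = B" using B by (force simp: image_image image_iff)
    moreover have "(\<lambda>x. x - k) ` B \<in> paths a b" using B by (force simp: paths_def)
    ultimately show "B \<in> ?f ` paths a b" by (metis image_eqI)
  qed (auto simp: paths_def)
  have w: "path_weight p v (a + k) (b + k) (?f A) = path_weight p (\<lambda>x. v (x + k)) a b A" for A
  proof -
    have "gaps (?f A) = (\<lambda>(x, y). (x + k, y + k)) ` gaps A"
    proof -
      have "?f A \<inter> {x + k<..<y + k} = ?f (A \<inter> {x<..<y})" for x y by auto
      then show ?thesis by (force simp: gaps_def image_iff)
    qed
    moreover have "inj_on (\<lambda>(x, y). (x + k, y + k)) (gaps A)" by (auto simp: inj_on_def)
    ultimately have "gap_weight p (gaps (?f A)) = gap_weight p (gaps A)"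
      by (simp add: gap_weight_def prod.reindex case_prod_beta')
    moreover have "?f A - {a + k, b + k} = ?f (A - {a, b})" by auto
    then have "sum v (?f A - {a + k, b + k}) = (\<Sum>x\<in>A - {a, b}. v (x + k))"
      by (simp add: sum.reindex)
    ultimately show ?thesis by (simp add: path_weight_def)
  qed
  show ?thesis
    unfolding path_sum_def img[symmetric] sum.reindex[OF inj] by (simp add: w)
qed

end

section \<open>Long gaps, short gaps and free contacts\<close>

lemma gap_around:
  assumes E: "finite E" "a \<in> E" "b \<in> E" and x: "a < x" "x < b" "x \<notin> E"
  obtains c d where "(c, d) \<in> gaps E" "a \<le> c" "c < x" "x < d" "d \<le> b"
proof -
  define c where "c = Max (E \<inter> {..<x})"
  define d where "d = Min (E \<inter> {x<..})"
  have c: "c \<in> E \<inter> {..<x}" "\<And>z. z \<in> E \<inter> {..<x} \<Longrightarrow> z \<le> c"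
    unfolding c_def using E x by (intro Max_in Max_ge; auto)+
  have d: "d \<in> E \<inter> {x<..}" "\<And>z. z \<in> E \<inter> {x<..} \<Longrightarrow> d \<le> z"
    unfolding d_def using E x by (intro Min_in Min_le; auto)+
  have "(c, d) \<in> gaps E"
  proof -
    have False if z: "z \<in> E" "c < z" "z < d" for z
      using c(2)[of z] d(2)[of z] z x(3) by (cases "z < x"; cases "z = x") auto
    then show ?thesis using c(1) d(1) by (auto simp: gaps_def)
  qed
  moreover have "a \<le> c" "d \<le> b" using c(2)[of a] d(2)[of b] E x by auto
  ultimately show thesis using that c(1) d(1) by auto
qed

definition long_gaps :: "nat \<Rightarrow> nat set \<Rightarrow> (nat \<times> nat) set" where
  "long_gaps L A = {(a, b) \<in> gaps A. L < b - a}"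

lemma long_gaps_subset: "long_gaps L A \<subseteq> gaps A"
  by (auto simp: long_gaps_def)

lemma finite_long_gaps [simp]: "finite A \<Longrightarrow> finite (long_gaps L A)"
  using finite_subset[OF long_gaps_subset finite_gaps] .

definition total_length :: "(nat \<times> nat) set \<Rightarrow> nat" where
  "total_length J = (\<Sum>(a, b)\<in>J. b - a)"

text \<open>These are the points of \<open>A\<close> that can be added to \<open>A'\<close> at
  bounded cost: the bound \<open>L\<close> keeps the kernel away from zero, and \<open>G\<close>
  will be the set of sites where the disorder is not too negative.\<close>

definition free_contacts :: "nat \<Rightarrow> nat set \<Rightarrow> nat set \<Rightarrow> nat set \<Rightarrow> nat set" where
  "free_contacts L G A A' = {x \<in> A \<inter> G. \<exists>(a, b)\<in>gaps A'. a < x \<and> x < b \<and> b - a \<le> L}"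

text \<open>The intervals \<open>{a<..b}\<close> over the gaps cover \<open>{0<..n}\<close>: a point
  outside \<open>A\<close> lies inside a gap, and a positive point of \<open>A\<close> is the right
  end of one.\<close>

lemma length_le_total_gap_length:
  assumes A: "A \<in> paths 0 n" shows "n \<le> total_length (gaps A)"
proof -
  have fin: "finite A" by (rule finite_path[OF A])
  have mem: "0 \<in> A" "n \<in> A" using A by (auto simp: paths_def)
  have "{0<..n} \<subseteq> (\<Union>(a, b)\<in>gaps A. {a<..b})"
  proof
    fix x assume x: "x \<in> {0<..n}"
    have "\<exists>(a, b)\<in>gaps A. a < x \<and> x \<le> b"
    proof (cases "x \<in> A")
      case False
      have "x < n" using x mem False by (metis greaterThanAtMost_iff le_neq_implies_less)
      then show ?thesis using gap_around[OF fin mem, of x] x False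
        by (metis (no_types, lifting) case_prodI greaterThanAtMost_iff less_imp_le)
    next
      case True
      define c where "c = Max (A \<inter> {..<x})"
      have c: "c \<in> A \<inter> {..<x}" "\<And>z. z \<in> A \<inter> {..<x} \<Longrightarrow> z \<le> c"
        unfolding c_def using fin mem x by (intro Max_in Max_ge; auto)+
      then have "(c, x) \<in> gaps A" using True by (force simp: gaps_def)
      then show ?thesis using c(1) by auto
    qed
    then show "x \<in> (\<Union>(a, b)\<in>gaps A. {a<..b})" by fastforce
  qed
  then have "card {0<..n} \<le> card (\<Union>(a, b)\<in>gaps A. {a<..b})"
    using fin by (intro card_mono finite_UN_I) auto
  also have "\<dots> \<le> (\<Sum>e\<in>gaps A. card (case e of (a, b) \<Rightarrow> {a<..b}))"
    using fin by (intro card_UN_le) auto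
  also have "\<dots> = total_length (gaps A)"
    unfolding total_length_def by (intro sum.cong) auto
  finally show ?thesis by simp
qed

text \<open>A gap is determined by its right end, which is never \<open>0\<close>.\<close>

lemma card_gaps_le:
  assumes A: "A \<in> paths 0 n" shows "card (gaps A) \<le> card A - 1"
proof -
  have fin: "finite A" by (rule finite_path[OF A])
  have "inj_on snd (gaps A)"
  proof (rule inj_onI, clarsimp)
    fix a a' b assume "(a, b) \<in> gaps A" "(a', b) \<in> gaps A"
    then show "a = a'" by (auto simp: gaps_def) (metis IntI empty_iff greaterThanLessThan_iff linorder_neqE_nat)
  qed
  moreover have "snd ` gaps A \<subseteq> A - {0}" by (auto simp: gaps_def)
  ultimately have "card (gaps A) \<le> card (A - {0})" using fin by (intro card_inj_on_le) auto
  moreover have "0 \<in> A" using A by (auto simp: paths_def)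
  ultimately show ?thesis using fin by simp
qed

text \<open>Gaps of length at most \<open>L\<close> cover at least half of [0, n], so
  \<open>A\<close> has at least n/(2L) gaps. Long gaps of \<open>A'\<close> hide at most n/(4L)
  inner points of \<open>A\<close> and bad sites at most n/(8L), which leaves n/(8L). The added 1 is
  there because inner points can be one fewer than gaps.\<close>

lemma many_free_contacts:
  assumes n: "1 \<le> n" and A: "A \<in> paths 0 n" "A' \<in> paths 0 n" "A \<inter> A' = {0, n}"
    and long: "2 * total_length (long_gaps L A) \<le> n" "4 * L * total_length (long_gaps L' A') \<le> n"
    and bad: "8 * L * card ({1..<n} - G) \<le> n"
  shows "n \<le> 8 * L * (card (free_contacts L' G A A') + 1)"
proof -
  have fin: "finite A" "finite A'" using A finite_path by auto
  let ?R = "free_contacts L' G A A'"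
  have Rfin: "finite ?R" unfolding free_contacts_def using fin by auto
  have short: "total_length (gaps A - long_gaps L A) \<le> card (gaps A) * L"
  proof -
    have "total_length (gaps A - long_gaps L A) \<le> card (gaps A - long_gaps L A) * L"
      unfolding total_length_def by (rule sum_bounded_above[where 'a = nat, simplified]) (auto simp: long_gaps_def)
    also have "\<dots> \<le> card (gaps A) * L" using fin by (intro mult_right_mono card_mono) auto
    finally show ?thesis .
  qed
  have "total_length (gaps A) = total_length (gaps A - long_gaps L A) + total_length (long_gaps L A)"
    unfolding total_length_def using fin by (intro sum.subset_diff) (auto simp: long_gaps_def)
  then have "2 * n \<le> 2 * (card (gaps A) * L) + n"
    using length_le_total_gap_length[OF A(1)] short long(1) by linarith
  moreover have cI: "card A = card (A - {0, n}) + 2"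
  proof -
    have "{0, n} \<subseteq> A" using A by (auto simp: paths_def)
    then have "card (A - {0, n}) = card A - 2" "2 \<le> card A"
      using n fin card_mono[of A "{0, n}"] by (auto simp: card_Diff_subset)
    then show ?thesis by simp
  qed
  ultimately have 1: "n \<le> 2 * (L * (card (A - {0, n}) + 1))"
    using mult_right_mono[OF card_gaps_le[OF A(1)], of L] by (simp add: algebra_simps)
  have "A - {0, n} \<subseteq> ?R \<union> ((\<Union>(a, b)\<in>long_gaps L' A'. {a<..b}) \<union> ({1..<n} - G))"
  proof
    fix x assume x: "x \<in> A - {0, n}"
    then have "x \<in> {0..n}" "x \<noteq> 0" "x \<noteq> n" using A(1) by (auto simp: paths_def)
    moreover have "x \<notin> A'" using x A(3) by blast
    ultimately have "0 < x" "x < n" "x \<notin> A'" by auto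
    moreover have "0 \<in> A'" "n \<in> A'" using A by (auto simp: paths_def)
    ultimately obtain a b where ab: "(a, b) \<in> gaps A'" "a < x" "x < b"
      using gap_around[of A' 0 n x] fin by metis
    show "x \<in> ?R \<union> ((\<Union>(a, b)\<in>long_gaps L' A'. {a<..b}) \<union> ({1..<n} - G))"
    proof (cases "b - a \<le> L' \<and> x \<in> G")
      case True
      then have "x \<in> ?R" using ab x by (auto simp: free_contacts_def)
      then show ?thesis by simp
    next
      case False
      then have "x \<in> {1..<n} - G \<or> (a, b) \<in> long_gaps L' A'"
        using ab \<open>0 < x\<close> \<open>x < n\<close> by (auto simp: long_gaps_def)
      moreover have "x \<in> (\<Union>(a, b)\<in>long_gaps L' A'. {a<..b})" if "(a, b) \<in> long_gaps L' A'"
        using that ab by (intro UN_I[of "(a, b)"]) auto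
      ultimately show ?thesis by blast
    qed
  qed
  then have "card (A - {0, n}) \<le> card (?R \<union> ((\<Union>(a, b)\<in>long_gaps L' A'. {a<..b}) \<union> ({1..<n} - G)))"
    using Rfin fin by (intro card_mono finite_UnI finite_UN_I) auto
  also have "\<dots> \<le> card ?R + (card (\<Union>(a, b)\<in>long_gaps L' A'. {a<..b}) + card ({1..<n} - G))"
    by (meson add_left_mono card_Un_le order_trans)
  also have "card (\<Union>(a, b)\<in>long_gaps L' A'. {a<..b}) \<le> total_length (long_gaps L' A')"
  proof -
    have "card (\<Union>(a, b)\<in>long_gaps L' A'. {a<..b})
        \<le> (\<Sum>e\<in>long_gaps L' A'. card (case e of (a, b) \<Rightarrow> {a<..b}))"
      using fin by (intro card_UN_le) simp
    also have "\<dots> = total_length (long_gaps L' A')"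
      unfolding total_length_def by (intro sum.cong) auto
    finally show ?thesis .
  qed
  finally have 2: "card (A - {0, n}) \<le> card ?R + (total_length (long_gaps L' A') + card ({1..<n} - G))"
    by simp
  \<comment> \<open>In units of n/(8L), \<open>A\<close> starts with 4, the long gaps of
    \<open>A'\<close> take at most 2, and the bad sites take at most 1.\<close>
  have "4 * n \<le> 8 * L * (card (A - {0, n}) + 1)" using 1 by simp
  also have "\<dots> \<le> 8 * L * (card ?R + (total_length (long_gaps L' A') + card ({1..<n} - G)) + 1)"
    using 2 by (intro mult_left_mono) auto
  also have "\<dots> = 8 * L * (card ?R + 1) + 2 * (4 * L * total_length (long_gaps L' A')) + 8 * L * card ({1..<n} - G)"
    by (simp add: algebra_simps)
  also have "\<dots> \<le> 8 * L * (card ?R + 1) + 2 * n + n" using long bad by linarith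
  finally show ?thesis by simp
qed

section \<open>Inserting contacts into short gaps, and the two resulting Gibbs bounds\<close>

context positive_kernel
begin

text \<open>The insertion multiplies the weight by
  \<open>p (x - c) * p (d - x) * exp (v x) / p (d - c)\<close>. Both new gaps are no longer than
  \<open>L\<close>, and the denominator is at most 1.\<close>

lemma path_weight_insert:
  assumes E: "E \<in> paths m n" and cd: "(c, d) \<in> gaps E" "c < x" "x < d"
    and c0: "\<And>t. 1 \<le> t \<Longrightarrow> t \<le> L \<Longrightarrow> c0 \<le> p t" "0 \<le> c0" "d - c \<le> L"
  shows "path_weight p v m n E * (c0\<^sup>2 * exp (v x)) \<le> path_weight p v m n (insert x E)"
proof -
  let ?D = "{c, x, d}"
  have g: "gaps ?D = {(c, x), (x, d)}" using cd by (auto simp: gaps_def)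
  have "?D - {c, d} = {x}" using cd by auto
  then have w: "path_weight p v c d ?D = p (x - c) * p (d - x) * exp (v x)"
    using cd by (simp add: path_weight_def gap_weight_def g)
  have "E \<union> ?D = insert x E" using cd(1) by (auto simp: gaps_def)
  moreover have "?D \<in> paths c d" using cd by (auto simp: paths_def)
  ultimately have eq: "path_weight p v m n (insert x E) * p (d - c)
      = path_weight p v m n E * (p (x - c) * p (d - x) * exp (v x))"
    using path_weight_splice[OF cd(1) _ E, of ?D p v] w by simp
  have "c0\<^sup>2 \<le> p (x - c) * p (d - x)"
    unfolding power2_eq_square using cd c0 by (intro mult_mono) auto
  then have "path_weight p v m n E * (c0\<^sup>2 * exp (v x))
      \<le> path_weight p v m n E * (p (x - c) * p (d - x) * exp (v x))"
    by (intro mult_left_mono mult_right_mono) auto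
  also have "\<dots> = path_weight p v m n (insert x E) * p (d - c)" by (simp add: eq)
  also have "\<dots> \<le> path_weight p v m n (insert x E) * 1"
    using p_le_1 by (intro mult_left_mono) auto
  finally show ?thesis by simp
qed

text \<open>Points are added one at a time. Earlier insertions may have shrunk the gap around
  \<open>x\<close>, but it stays inside the original gap of \<open>A\<close>, so the length bound
  \<open>L\<close> persists.\<close>

lemma path_weight_insert_many:
  assumes A: "A \<in> paths m n" and B: "finite B"
    and gap: "\<And>x. x \<in> B \<Longrightarrow> \<exists>(a, b)\<in>gaps A. a < x \<and> x < b \<and> b - a \<le> L"
    and c0: "\<And>t. 1 \<le> t \<Longrightarrow> t \<le> L \<Longrightarrow> c0 \<le> p t" "0 \<le> c0"
  shows "A \<union> B \<in> paths m n \<and> path_weight p v m n A * (\<Prod>x\<in>B. c0\<^sup>2 * exp (v x)) \<le> path_weight p v m n (A \<union> B)"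
  using B gap
proof (induction B)
  case empty
  then show ?case using A by simp
next
  case (insert x B)
  let ?E = "A \<union> B"
  have E: "?E \<in> paths m n"
    and IH: "path_weight p v m n A * (\<Prod>x\<in>B. c0\<^sup>2 * exp (v x)) \<le> path_weight p v m n ?E"
    using insert.IH insert.prems by auto
  obtain a b where ab: "(a, b) \<in> gaps A" "a < x" "x < b" "b - a \<le> L" using insert.prems by blast
  then have "a \<in> ?E" "b \<in> ?E" "x \<notin> ?E" using insert.hyps by (auto simp: gaps_def)
  then obtain c d where cd: "(c, d) \<in> gaps ?E" "a \<le> c" "c < x" "x < d" "d \<le> b"
    using gap_around[of ?E a b x] finite_path[OF E] ab by metis
  have "path_weight p v m n A * (\<Prod>x\<in>insert x B. c0\<^sup>2 * exp (v x))
      = path_weight p v m n A * (\<Prod>x\<in>B. c0\<^sup>2 * exp (v x)) * (c0\<^sup>2 * exp (v x))"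
    using insert.hyps by simp
  also have "\<dots> \<le> path_weight p v m n ?E * (c0\<^sup>2 * exp (v x))"
    by (intro mult_right_mono IH) auto
  also have "\<dots> \<le> path_weight p v m n (insert x ?E)"
    using cd ab by (intro path_weight_insert[OF E cd(1) _ _ c0]) auto
  finally have "path_weight p v m n A * (\<Prod>x\<in>insert x B. c0\<^sup>2 * exp (v x)) \<le> path_weight p v m n (A \<union> insert x B)"
    by simp
  moreover have "A \<union> insert x B \<in> paths m n" using E cd gap_in_path_bounds[OF E cd(1)]
    by (auto simp: paths_def)
  ultimately show ?case by simp
qed

text \<open>Adding contacts of the first path to the short gaps of the second one recovers every
  non-meeting pair from its image, because the added contacts are exactly the new meeting points.\<close>

lemma nonmeeting_pair_bound:
  assumes c0: "\<And>t. 1 \<le> t \<Longrightarrow> t \<le> L \<Longrightarrow> c0 \<le> p t" "0 \<le> c0"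
    and G: "\<And>x. x \<in> G \<Longrightarrow> \<theta> \<le> c0\<^sup>2 * exp (v x)" and \<theta>: "0 \<le> \<theta>"
  shows "(\<Sum>(A, A') | A \<in> paths m n \<and> A' \<in> paths m n \<and> A \<inter> A' = {m, n} \<and> k \<le> card (free_contacts L G A A').
            path_weight p v m n A * path_weight p v m n A') * (1 + \<theta>) ^ k \<le> (path_sum p v m n)\<^sup>2"
proof -
  let ?S = "{(A, A'). A \<in> paths m n \<and> A' \<in> paths m n \<and> A \<inter> A' = {m, n} \<and> k \<le> card (free_contacts L G A A')}"
  let ?w = "path_weight p v m n"
  let ?U = "Sigma ?S (\<lambda>(A, A'). Pow (free_contacts L G A A'))"
  let ?f = "\<lambda>((A, A'), B). (A, A' \<union> B)"
  have finS: "finite ?S" by (rule finite_subset[of _ "paths m n \<times> paths m n"]) auto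
  have finR: "finite (free_contacts L G A A')" if "(A, A') \<in> ?S" for A A'
    using that by (auto simp: free_contacts_def dest: finite_path)
  have step: "?w A * ?w A' * (1 + \<theta>) ^ k \<le> (\<Sum>B\<in>Pow (free_contacts L G A A'). ?w A * ?w (A' \<union> B))"
    if AA: "(A, A') \<in> ?S" for A A'
  proof -
    let ?R = "free_contacts L G A A'"
    have "(1 + \<theta>) ^ k \<le> (1 + \<theta>) ^ card ?R" using AA \<theta> by (intro power_increasing) auto
    \<comment> \<open>Expanding the product produces one term for each set \<open>B\<close> of added
      contacts; \<open>prod_add\<close> indexes the terms by the complement of \<open>B\<close>,
      whence the reindexing.\<close>
    also have "\<dots> = (\<Prod>x\<in>?R. 1 + \<theta>)" by simp
    also have "\<dots> = (\<Sum>B\<in>Pow ?R. \<Prod>x\<in>?R - B. \<theta>)"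
      using prod_add[OF finR[OF AA], of "\<lambda>_. 1" "\<lambda>_. \<theta>"] by simp
    also have "\<dots> = (\<Sum>B\<in>Pow ?R. \<Prod>x\<in>B. \<theta>)"
      by (rule sum.reindex_bij_witness[where i = "\<lambda>B. ?R - B" and j = "\<lambda>B. ?R - B"])
        (auto simp: double_diff)
    finally have "?w A * ?w A' * (1 + \<theta>) ^ k \<le> ?w A * ?w A' * (\<Sum>B\<in>Pow ?R. \<Prod>x\<in>B. \<theta>)"
      by (intro mult_left_mono) auto
    also have "\<dots> = (\<Sum>B\<in>Pow ?R. ?w A * (?w A' * (\<Prod>x\<in>B. \<theta>)))"
      by (simp add: sum_distrib_left mult.assoc)
    also have "\<dots> \<le> (\<Sum>B\<in>Pow ?R. ?w A * ?w (A' \<union> B))"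
    proof (intro sum_mono mult_left_mono)
      fix B assume B: "B \<in> Pow ?R"
      have "(\<Prod>x\<in>B. \<theta>) \<le> (\<Prod>x\<in>B. c0\<^sup>2 * exp (v x))"
        using B G \<theta> by (intro prod_mono) (auto simp: free_contacts_def)
      then have "?w A' * (\<Prod>x\<in>B. \<theta>) \<le> ?w A' * (\<Prod>x\<in>B. c0\<^sup>2 * exp (v x))"
        by (intro mult_left_mono) auto
      also have "\<dots> \<le> ?w (A' \<union> B)"
      proof -
        have 1: "A' \<in> paths m n" "finite B" using AA finR[OF AA] B by (auto intro: finite_subset)
        have 2: "\<exists>(a, b)\<in>gaps A'. a < x \<and> x < b \<and> b - a \<le> L" if "x \<in> B" for x
          using that B by (auto simp: free_contacts_def)
        show ?thesis by (rule path_weight_insert_many[OF 1 2 c0, THEN conjunct2])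
      qed
      finally show "?w A' * (\<Prod>x\<in>B. \<theta>) \<le> ?w (A' \<union> B)" .
    qed auto
    finally show ?thesis .
  qed
  have B_props: "A' \<union> B \<in> paths m n" "B \<subseteq> A" "m \<notin> B" "n \<notin> B"
    if AA: "(A, A') \<in> ?S" and B: "B \<subseteq> free_contacts L G A A'" for A A' B
  proof -
    have 1: "A' \<in> paths m n" "finite B" using AA finR[OF AA] B by (auto intro: finite_subset)
    have 2: "\<exists>(a, b)\<in>gaps A'. a < x \<and> x < b \<and> b - a \<le> L" if "x \<in> B" for x
      using that B by (auto simp: free_contacts_def)
    show "A' \<union> B \<in> paths m n"
      by (rule path_weight_insert_many[OF 1 2 c0, THEN conjunct1])
    show "B \<subseteq> A" using B by (auto simp: free_contacts_def)
    have "m < x \<and> x < n" if "x \<in> B" for x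
    proof -
      obtain a b where "(a, b) \<in> gaps A'" "a < x" "x < b" using 2[OF \<open>x \<in> B\<close>] by auto
      then show ?thesis using gap_in_path_bounds[OF 1(1), of a b] by auto
    qed
    then show "m \<notin> B" "n \<notin> B" by auto
  qed
  have inj: "inj_on ?f ?U"
  proof (rule inj_onI, clarsimp)
    fix A A' B D' E
    assume 1: "A' \<union> B = D' \<union> E" "B \<subseteq> free_contacts L G A A'" "E \<subseteq> free_contacts L G A D'"
      "A \<in> paths m n" "A' \<in> paths m n" "A \<inter> A' = {m, n}" "k \<le> card (free_contacts L G A A')"
      "D' \<in> paths m n" "A \<inter> D' = {m, n}" "k \<le> card (free_contacts L G A D')"
    have "B \<subseteq> A" "m \<notin> B" "n \<notin> B" using B_props[of A A' B] 1 by auto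
    moreover have "E \<subseteq> A" "m \<notin> E" "n \<notin> E" using B_props[of A D' E] 1 by auto
    moreover have "m \<in> A'" "n \<in> A'" "m \<in> D'" "n \<in> D'" using 1 by (auto simp: paths_def)
    moreover have "x \<in> A \<and> x \<in> A' \<longleftrightarrow> x = m \<or> x = n" "x \<in> A \<and> x \<in> D' \<longleftrightarrow> x = m \<or> x = n"
      "x \<in> A' \<or> x \<in> B \<longleftrightarrow> x \<in> D' \<or> x \<in> E" for x
      using 1(1,6,9) by (simp_all add: set_eq_iff)
    ultimately have "x \<in> A' \<longleftrightarrow> x \<in> D'" "x \<in> B \<longleftrightarrow> x \<in> E" for x by (metis subsetD)+
    then show "A' = D' \<and> B = E" by blast
  qed
  have "(\<Sum>(A, A')\<in>?S. ?w A * ?w A') * (1 + \<theta>) ^ k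
      = (\<Sum>(A, A')\<in>?S. ?w A * ?w A' * (1 + \<theta>) ^ k)"
    by (simp add: sum_distrib_right case_prod_beta')
  also have "\<dots> \<le> (\<Sum>x\<in>?S. \<Sum>B\<in>Pow (free_contacts L G (fst x) (snd x)). ?w (fst x) * ?w (snd x \<union> B))"
  proof (rule sum_mono)
    fix x assume "x \<in> ?S"
    then show "(case x of (A, A') \<Rightarrow> ?w A * ?w A' * (1 + \<theta>) ^ k)
        \<le> (\<Sum>B\<in>Pow (free_contacts L G (fst x) (snd x)). ?w (fst x) * ?w (snd x \<union> B))"
      using step[of "fst x" "snd x"] by (simp add: case_prod_beta)
  qed
  also have "\<dots> = (\<Sum>(x, B)\<in>Sigma ?S (\<lambda>x. Pow (free_contacts L G (fst x) (snd x))). ?w (fst x) * ?w (snd x \<union> B))"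
    using finR by (intro sum.Sigma finS) auto
  also have "\<dots> = (\<Sum>y\<in>?U. (\<lambda>(A, E). ?w A * ?w E) (?f y))"
    by (intro sum.cong) (auto simp: case_prod_beta')
  also have "\<dots> = (\<Sum>(A, E)\<in>?f ` ?U. ?w A * ?w E)"
    by (subst sum.reindex[OF inj]) simp
  also have "\<dots> \<le> (\<Sum>(A, E)\<in>paths m n \<times> paths m n. ?w A * ?w E)"
  proof (rule sum_mono2)
    show "?f ` ?U \<subseteq> paths m n \<times> paths m n"
    proof clarsimp
      fix A A' B assume "A \<in> paths m n" "A' \<in> paths m n" "A \<inter> A' = {m, n}"
        "k \<le> card (free_contacts L G A A')" "B \<subseteq> free_contacts L G A A'"
      then show "A' \<union> B \<in> paths m n" using B_props(1)[of A A' B] by simp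
    qed
  qed (auto intro: mult_nonneg_nonneg)
  also have "\<dots> = (path_sum p v m n)\<^sup>2"
    by (simp add: path_sum_def power2_eq_square sum_product sum.cartesian_product)
  finally show ?thesis by (simp add: case_prod_beta')
qed

text \<open>Paths are grouped by their set \<open>J\<close> of long gaps. That all members of
  \<open>J\<close> are gaps has Gibbs probability at most \<open>exp (- F)\<close>, with
  \<open>F\<close> the sum of the logarithms, and at most 1, hence at most
  \<open>exp (- s * F)\<close> whatever the sign of \<open>F\<close>. The freedom to lower
  \<open>s\<close> makes the exponential moments affordable later.\<close>

lemma long_gaps_bound:
  assumes s: "0 \<le> s" "s \<le> 1" and mn: "m < n"
  shows "(\<Sum>A | A \<in> paths m n \<and> N \<le> total_length (long_gaps L A). path_weight p v m n A)
     \<le> path_sum p v m n * (\<Sum>J\<in>{J \<in> long_gaps L ` paths m n. N \<le> total_length J}.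
          exp (- s * (\<Sum>(a, b)\<in>J. ln (path_sum p v a b))))"
proof -
  let ?w = "path_weight p v m n" and ?Z = "path_sum p v m n"
  let ?T = "{J \<in> long_gaps L ` paths m n. N \<le> total_length J}"
  let ?S = "{A \<in> paths m n. N \<le> total_length (long_gaps L A)}"
  have "(\<Sum>A\<in>?S. ?w A) = (\<Sum>J\<in>?T. \<Sum>A | A \<in> ?S \<and> long_gaps L A = J. ?w A)"
    by (rule sum.group[symmetric]) auto
  also have "\<dots> \<le> (\<Sum>J\<in>?T. ?Z * exp (- s * (\<Sum>(a, b)\<in>J. ln (path_sum p v a b))))"
  proof (rule sum_mono)
    fix J assume "J \<in> ?T"
    then obtain A0 where A0: "A0 \<in> paths m n" "J = long_gaps L A0" by auto
    have J: "finite J" "\<And>a b. (a, b) \<in> J \<Longrightarrow> a < b"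
      using A0 finite_path[OF A0(1)] by (simp, auto simp: long_gaps_def gaps_def)
    let ?S' = "\<Sum>A | A \<in> paths m n \<and> J \<subseteq> gaps A. ?w A"
    have Zpos: "0 < path_sum p v a b" if "a < b" for a b using path_sum_pos[OF that] .
    have "(\<Sum>A | A \<in> ?S \<and> long_gaps L A = J. ?w A) \<le> ?S'"
      by (intro sum_mono2) (auto simp: long_gaps_def)
    moreover have "?S' \<le> ?Z" unfolding path_sum_def by (intro sum_mono2) auto
    moreover have "?S' \<le> exp (- (\<Sum>(a, b)\<in>J. ln (path_sum p v a b))) * ?Z"
    proof -
      \<comment> \<open>The factors \<open>p (b - a)\<close> are dropped, being at most 1.\<close>
      have "(\<Prod>(a, b)\<in>J. p (b - a) / path_sum p v a b) \<le> (\<Prod>(a, b)\<in>J. exp (- ln (path_sum p v a b)))"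
      proof (intro prod_mono, clarify, intro conjI)
        fix a b assume "(a, b) \<in> J"
        then have ab: "a < b" using J by auto
        show "0 \<le> p (b - a) / path_sum p v a b" using Zpos[OF ab] ab by (simp add: less_imp_le)
        show "p (b - a) / path_sum p v a b \<le> exp (- ln (path_sum p v a b))"
          using Zpos[OF ab] p_le_1[of "b - a"] by (simp add: exp_minus divide_simps)
      qed
      also have "\<dots> = exp (- (\<Sum>(a, b)\<in>J. ln (path_sum p v a b)))"
        using J(1) by (simp add: exp_sum[symmetric] case_prod_beta' sum_negf)
      finally have "(\<Prod>(a, b)\<in>J. p (b - a) / path_sum p v a b) * ?Z
          \<le> exp (- (\<Sum>(a, b)\<in>J. ln (path_sum p v a b))) * ?Z"
        using Zpos[OF mn] by (intro mult_right_mono) auto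
      then show ?thesis using gap_sum_le[OF J, where m = m and n = n and v = v] by simp
    qed
    ultimately show "(\<Sum>A | A \<in> ?S \<and> long_gaps L A = J. ?w A)
        \<le> ?Z * exp (- s * (\<Sum>(a, b)\<in>J. ln (path_sum p v a b)))"
    proof -
      assume a: "(\<Sum>A | A \<in> ?S \<and> long_gaps L A = J. ?w A) \<le> ?S'" "?S' \<le> ?Z"
        "?S' \<le> exp (- (\<Sum>(a, b)\<in>J. ln (path_sum p v a b))) * ?Z"
      let ?F = "\<Sum>(a, b)\<in>J. ln (path_sum p v a b)"
      have "?S' \<le> exp (- s * ?F) * ?Z"
      proof (cases "0 \<le> ?F")
        case True
        then have "exp (- ?F) \<le> exp (- s * ?F)" using s mult_left_le_one_le[of ?F s] by simp
        then show ?thesis using a(3) Zpos[OF mn]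
          by (meson mult_right_mono less_imp_le order_trans)
      next
        case False
        then have "1 \<le> exp (- s * ?F)" using s by (simp add: mult_nonneg_nonpos)
        then have "1 * ?Z \<le> exp (- s * ?F) * ?Z" using Zpos[OF mn] by (intro mult_right_mono) auto
        then show ?thesis using a(2) by linarith
      qed
      then show ?thesis using a(1) by (simp add: mult.commute)
    qed
  qed
  finally show ?thesis by (simp add: sum_distrib_left)
qed

end

section \<open>Gaussian sequences\<close>

text \<open>As an affine image of the standard normal law, the degenerate case
  \<open>\<sigma> = 0\<close> is on the same footing as the others.\<close>

lemma normal_law_distr:
  assumes "0 \<le> \<sigma>"
  shows "normal_law \<mu> \<sigma> = distr std_normal_distribution borel (\<lambda>x. \<mu> + \<sigma> * x)"
proof (cases "\<sigma> = 0")
  case True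
  interpret prob_space std_normal_distribution
    by (rule prob_space_normal_density) simp
  show ?thesis using True by (simp add: normal_law_def distr_const)
next
  case False
  interpret N: prob_space std_normal_distribution
    by (rule prob_space_normal_density) simp
  have "distributed std_normal_distribution lborel (\<lambda>x. x) (\<lambda>x. ennreal (std_normal_density x))"
    by (auto simp: distributed_def distr_id2)
  from N.normal_density_affine[OF this, of \<sigma> \<mu>] False assms
  have "distributed std_normal_distribution lborel (\<lambda>x. \<mu> + \<sigma> * x) (normal_density \<mu> \<sigma>)" by simp
  then have "distr std_normal_distribution lborel (\<lambda>x. \<mu> + \<sigma> * x) = density lborel (normal_density \<mu> \<sigma>)"
    by (simp add: distributed_def)
  moreover have "distr std_normal_distribution lborel (\<lambda>x. \<mu> + \<sigma> * x) = distr std_normal_distribution borel (\<lambda>x. \<mu> + \<sigma> * x)"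
    by (rule distr_cong) auto
  ultimately show ?thesis using False by (simp add: normal_law_def)
qed

lemma std_normal_integrals:
  "integrable std_normal_distribution (\<lambda>x. x)" "integrable std_normal_distribution (\<lambda>x. x\<^sup>2)"
  "(\<integral>x. x \<partial>std_normal_distribution) = 0" "(\<integral>x. x\<^sup>2 \<partial>std_normal_distribution) = 1"
  using integrable_std_normal_distribution_moment[of 1] integrable_std_normal_distribution_moment[of 2]
    integral_std_normal_distribution_moment_odd[of 1] std_normal_distribution_even_moments(1)[of 1]
  by (simp_all add: fact_numeral eval_nat_numeral)

text \<open>Completing the square moves the mean of the normal density from 0 to
  \<open>t\<close>.\<close>

lemma std_normal_exp:
  "(\<integral>\<^sup>+x. ennreal (exp (t * x)) \<partial>std_normal_distribution) = ennreal (exp (t\<^sup>2 / 2))"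
proof -
  have "(\<integral>\<^sup>+x. ennreal (exp (t * x)) \<partial>std_normal_distribution)
      = (\<integral>\<^sup>+x. ennreal (std_normal_density x) * ennreal (exp (t * x)) \<partial>lborel)"
    by (intro nn_integral_density) auto
  also have "\<dots> = (\<integral>\<^sup>+x. ennreal (exp (t\<^sup>2 / 2)) * ennreal (normal_density t 1 x) \<partial>lborel)"
  proof (intro nn_integral_cong)
    fix x :: real
    have "std_normal_density x * exp (t * x) = exp (t\<^sup>2 / 2) * normal_density t 1 x"
      by (simp add: normal_density_def exp_add[symmetric] power2_diff field_simps)
    then show "ennreal (std_normal_density x) * ennreal (exp (t * x)) = ennreal (exp (t\<^sup>2 / 2)) * ennreal (normal_density t 1 x)"
      by (simp add: ennreal_mult[symmetric])
  qed
  also have "\<dots> = ennreal (exp (t\<^sup>2 / 2)) * (\<integral>\<^sup>+x. ennreal (normal_density t 1 x) \<partial>lborel)"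
    by (intro nn_integral_cmult) auto
  also have "(\<integral>\<^sup>+x. ennreal (normal_density t 1 x) \<partial>lborel) = 1"
    by (subst nn_integral_eq_integral) auto
  finally show ?thesis by simp
qed

section \<open>Laws on sequence space determined by characteristic functions\<close>

lemma integral_complex_parts:
  fixes f g :: "'a \<Rightarrow> real"
  assumes "integrable M f" "integrable M g"
  shows "(CLINT x|M. of_real (f x) + \<i> * of_real (g x)) = of_real (\<integral>x. f x \<partial>M) + \<i> * of_real (\<integral>x. g x \<partial>M)"
  using assms by simp

text \<open>Levy's uniqueness theorem on the line, for the law of \<open>X\<close> under the
  normalised density \<open>W / c\<close>. It serves to exchange one Fourier factor for an indicator
  while the other coordinates are hidden in the weight; the bound 2 fits weights such as
  \<open>1 + cos S\<close>.\<close>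

lemma (in finite_measure) char_unique_weighted:
  fixes X :: "'a \<Rightarrow> real"
  assumes M': "finite_measure M'" and sets: "sets M' = sets M"
    and X [measurable]: "X \<in> borel_measurable M"
    and W [measurable]: "W \<in> borel_measurable M" and W0: "\<And>x. 0 \<le> W x" and W2: "\<And>x. W x \<le> 2"
    and eq: "\<And>u. (CLINT x|M. W x *\<^sub>R iexp (u * X x)) = (CLINT x|M'. W x *\<^sub>R iexp (u * X x))"
    and B [measurable]: "B \<in> sets borel"
  shows "(\<integral>x. W x * indicator B (X x) \<partial>M) = (\<integral>x. W x * indicator B (X x) \<partial>M')"
proof -
  interpret M': finite_measure M' by (rule M')
  have [measurable]: "X \<in> borel_measurable M'" "W \<in> borel_measurable M'"
    using X W by (simp_all add: measurable_cong_sets[OF sets refl])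
  have int: "integrable M W" "integrable M' W"
    using W0 W2 by (auto intro!: integrable_const_bound[where B = 2] M'.integrable_const_bound[where B = 2])
  define c where "c = (\<integral>x. W x \<partial>M)"
  have c': "c = (\<integral>x. W x \<partial>M')"
  proof -
    have "complex_of_real (\<integral>x. W x \<partial>M) = complex_of_real (\<integral>x. W x \<partial>M')"
      using eq[of 0] by (simp add: of_real_def[symmetric])
    then show ?thesis by (simp add: c_def)
  qed
  have c0: "0 \<le> c" unfolding c_def using W0 by simp
  show ?thesis
  proof (cases "c = 0")
    \<comment> \<open>Total mass 0 admits no normalisation, but then the weight vanishes almost
      everywhere under both measures.\<close>
    case True
    have "AE x in M. W x = 0" using int(1) W0 True
      by (subst integral_nonneg_eq_0_iff_AE[symmetric]) (auto simp: c_def)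
    then have "(\<integral>x. W x * indicator B (X x) \<partial>M) = (\<integral>x. 0 \<partial>M)"
      by (intro integral_cong_AE) auto
    moreover have "AE x in M'. W x = 0" using int(2) W0 True
      by (subst integral_nonneg_eq_0_iff_AE[symmetric]) (auto simp: c')
    then have "(\<integral>x. W x * indicator B (X x) \<partial>M') = (\<integral>x. 0 \<partial>M')"
      by (intro integral_cong_AE) auto
    ultimately show ?thesis by simp
  next
    case False
    define D where "D N = distr (density N (\<lambda>x. ennreal (W x / c))) borel X" for N
    have pos: "0 < c" using c0 False by simp
    have gen: "real_distribution (D N) \<and> char (D N) t = (CLINT x|N. W x *\<^sub>R iexp (t * X x)) / of_real c
        \<and> measure (D N) B = (\<integral>x. W x * indicator B (X x) \<partial>N) / c"
      if N: "X \<in> borel_measurable N" "W \<in> borel_measurable N" "integrable N W" "(\<integral>x. W x \<partial>N) = c" for N t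
    proof -
      note [measurable] = N(1,2)
      have "(\<integral>\<^sup>+x. ennreal (W x / c) \<partial>N) = ennreal (\<integral>x. W x / c \<partial>N)"
        using N W0 pos by (intro nn_integral_eq_integral) auto
      also have "\<dots> = 1" using N(4) pos by simp
      finally have "prob_space (density N (\<lambda>x. ennreal (W x / c)))"
        by (intro prob_spaceI) (simp add: emeasure_density cong: nn_integral_cong)
      then interpret P: prob_space "density N (\<lambda>x. ennreal (W x / c))" .
      have rd: "real_distribution (D N)"
        unfolding D_def real_distribution_def real_distribution_axioms_def
        by (auto intro!: P.prob_space_distr)
      have "char (D N) t = (CLINT x|density N (\<lambda>x. ennreal (W x / c)). iexp (t * X x))"
        unfolding D_def char_def by (subst integral_distr) auto
      also have "\<dots> = (CLINT x|N. (W x / c) *\<^sub>R iexp (t * X x))"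
        using W0 pos by (intro integral_density) auto
      also have "\<dots> = (CLINT x|N. (1 / of_real c) * (W x *\<^sub>R iexp (t * X x)))"
        by (intro Bochner_Integration.integral_cong refl) (simp add: scaleR_conv_of_real)
      also have "\<dots> = (CLINT x|N. W x *\<^sub>R iexp (t * X x)) / of_real c"
        by (subst integral_mult_right_zero) simp
      finally have ch: "char (D N) t = (CLINT x|N. W x *\<^sub>R iexp (t * X x)) / of_real c" .
      have "measure (D N) B = (\<integral>x. indicator B x \<partial>D N)"
        unfolding D_def by simp
      also have "\<dots> = (\<integral>x. indicator B (X x) \<partial>density N (\<lambda>x. ennreal (W x / c)))"
        unfolding D_def by (subst integral_distr) auto
      also have "\<dots> = (\<integral>x. (W x / c) *\<^sub>R indicator B (X x) \<partial>N)"
        using W0 pos by (intro integral_density) auto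
      also have "\<dots> = (\<integral>x. W x * indicator B (X x) \<partial>N) / c"
        by simp
      finally show ?thesis using rd ch by auto
    qed
    have "D M = D M'"
      using gen[of M] gen[of M'] int c' eq by (intro Levy_uniqueness) (auto simp: c_def intro!: ext)
    then have "measure (D M) B = measure (D M') B" by simp
    then show ?thesis using gen[of M] gen[of M'] int c' pos by (auto simp: c_def)
  qed
qed

text \<open>The coordinates in \<open>J\<close> are converted one by one from Fourier factors into
  indicators. The inductive claim keeps an arbitrary linear form in further coordinates; with no
  such coordinates left it says that the two measures agree on cylinder sets.\<close>

lemma sequence_law_unique:
  fixes M N :: "(nat \<Rightarrow> real) measure"
  assumes M: "prob_space M" "sets M = sets borel" and N: "prob_space N" "sets N = sets borel"
    and eq: "\<And>V c. finite V \<Longrightarrow> (CLINT \<omega>|M. iexp (\<Sum>a\<in>V. c a * \<omega> a)) = (CLINT \<omega>|N. iexp (\<Sum>a\<in>V. c a * \<omega> a))"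
  shows "M = N"
proof -
  interpret M: prob_space M by (rule M)
  interpret N: prob_space N by (rule N)
  have coord: "(\<lambda>\<omega>. \<omega> a) \<in> borel_measurable M" "(\<lambda>\<omega>. \<omega> a) \<in> borel_measurable N" for a
    using M(2) N(2) measurable_product_coordinates[of a] measurable_cong_sets by blast+
  note [measurable] = coord
  have claim: "(CLINT \<omega>|M. (\<Prod>j\<in>J. indicator (A j) (\<omega> j)) *\<^sub>R iexp (\<Sum>a\<in>V. c a * \<omega> a))
      = (CLINT \<omega>|N. (\<Prod>j\<in>J. indicator (A j) (\<omega> j) :: real) *\<^sub>R iexp (\<Sum>a\<in>V. c a * \<omega> a))"
    if "finite J" "finite V" "J \<inter> V = {}" "\<And>j. A j \<in> sets borel"
    for J A and V :: "nat set" and c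
    using that
  proof (induction J arbitrary: V c)
    case empty
    then show ?case using eq by simp
  next
    case (insert k J)
    define I :: "(nat \<Rightarrow> real) \<Rightarrow> real" where "I \<omega> = (\<Prod>j\<in>J. indicator (A j) (\<omega> j))" for \<omega>
    define S where "S \<omega> = (\<Sum>a\<in>V. c a * \<omega> a)" for \<omega> :: "nat \<Rightarrow> real"
    have Am [measurable]: "A j \<in> sets borel" for j using insert.prems by simp
    have I01: "0 \<le> I \<omega>" "I \<omega> \<le> 1" for \<omega>
      unfolding I_def by (auto intro!: prod_nonneg prod_le_1)
    have [measurable]: "I \<in> borel_measurable M" "S \<in> borel_measurable M" "I \<in> borel_measurable N" "S \<in> borel_measurable N"
      unfolding I_def S_def by measurable
    have kV: "k \<notin> V" "J \<inter> insert k V = {}" "finite (insert k V)" using insert by auto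
    have IH: "(CLINT \<omega>|M. I \<omega> *\<^sub>R iexp (r * S \<omega> + u * \<omega> k)) = (CLINT \<omega>|N. I \<omega> *\<^sub>R iexp (r * S \<omega> + u * \<omega> k))" for r u
    proof -
      have "(\<Sum>a\<in>insert k V. (if a = k then u else r * c a) * \<omega> a) = r * S \<omega> + u * \<omega> k" for \<omega> :: "nat \<Rightarrow> real"
        using kV insert.prems(1) unfolding S_def
        by (simp add: sum_distrib_left mult.assoc) (intro sum.cong; auto)
      then show ?thesis
        using insert.IH[OF kV(3,2) Am, of "\<lambda>a. if a = k then u else r * c a"]
        unfolding I_def by simp
    qed
    have bint: "integrable K (\<lambda>\<omega>. I \<omega> *\<^sub>R iexp (r * S \<omega> + u * \<omega> k))" 
      if "prob_space K" and [measurable]: "I \<in> borel_measurable K" "S \<in> borel_measurable K" "(\<lambda>\<omega>. \<omega> k) \<in> borel_measurable K"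
      for K r u
    proof -
      interpret prob_space K by fact
      show ?thesis using I01 by (intro integrable_const_bound[where B = 1]) auto
    qed
    \<comment> \<open>Levy's theorem wants a nonnegative real weight, but the Fourier factor
      \<open>iexp (S \<omega>)\<close> is complex. It is a linear combination of the admissible
      weights \<open>1\<close>, \<open>1 + cos (S \<omega>)\<close> and
      \<open>1 + sin (S \<omega>)\<close>, which have frequencies 0, 1 and -1 in \<open>S\<close>;
      this is why the induction hypothesis was freed to multiples
      \<open>r * S \<omega>\<close>.\<close>
    have part: "(\<integral>\<omega>. W \<omega> * indicator (A k) (\<omega> k) \<partial>M) = (\<integral>\<omega>. W \<omega> * indicator (A k) (\<omega> k) \<partial>N)"
      if W: "\<And>\<omega>. W \<omega> = I \<omega> * g \<omega>" and g: "\<And>\<omega>. 0 \<le> g \<omega> \<and> g \<omega> \<le> 2"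
        and exp: "\<And>\<omega>. of_real (g \<omega>) = x + y * iexp (S \<omega>) + z * iexp (- S \<omega>)"
        and gm: "g \<in> borel_measurable M" for W g and x y z :: complex
    proof (rule M.char_unique_weighted[OF N.finite_measure_axioms])
      show "sets N = sets M" using M(2) N(2) by simp
      show "W \<in> borel_measurable M" using gm unfolding W by measurable
      show "0 \<le> W \<omega>" for \<omega> using W I01 g by simp
      show "W \<omega> \<le> 2" for \<omega> using W I01[of \<omega>] g[of \<omega>] mult_mono[of "I \<omega>" 1 "g \<omega>" 2] by simp
      show "(CLINT \<omega>|M. W \<omega> *\<^sub>R iexp (u * \<omega> k)) = (CLINT \<omega>|N. W \<omega> *\<^sub>R iexp (u * \<omega> k))" for u
      proof -
        have *: "W \<omega> *\<^sub>R iexp (u * \<omega> k) = x * (I \<omega> *\<^sub>R iexp (0 * S \<omega> + u * \<omega> k))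
           + y * (I \<omega> *\<^sub>R iexp (1 * S \<omega> + u * \<omega> k)) + z * (I \<omega> *\<^sub>R iexp ((-1) * S \<omega> + u * \<omega> k))" for \<omega>
        proof -
          have "W \<omega> *\<^sub>R iexp (u * \<omega> k) = of_real (I \<omega>) * (x + y * iexp (S \<omega>) + z * iexp (- S \<omega>)) * iexp (u * \<omega> k)"
            by (simp only: exp[symmetric]) (simp add: W scaleR_conv_of_real)
          then show ?thesis by (simp add: scaleR_conv_of_real distrib_left exp_add exp_diff exp_minus field_simps)
        qed
        show ?thesis unfolding * using bint[OF M(1)] bint[OF N(1)] IH
          by (simp only: Bochner_Integration.integral_add integral_mult_right_zero integrable_mult_right
              Bochner_Integration.integrable_add \<open>I \<in> borel_measurable M\<close> \<open>I \<in> borel_measurable N\<close>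
              \<open>S \<in> borel_measurable M\<close> \<open>S \<in> borel_measurable N\<close> coord)
      qed
    qed (use coord in auto)
    have J: "(\<Prod>j\<in>insert k J. indicator (A j) (\<omega> j)) = I \<omega> * indicator (A k) (\<omega> k)" for \<omega>
      using insert.hyps by (simp add: I_def mult.commute)
    have range: "0 \<le> 1 + cos t" "0 \<le> 1 + sin t" for t :: real
      using cos_ge_minus_one[of t] sin_ge_minus_one[of t] by linarith+
    have one: "(\<integral>\<omega>. I \<omega> * indicator (A k) (\<omega> k) \<partial>M) = (\<integral>\<omega>. I \<omega> * indicator (A k) (\<omega> k) \<partial>N)"
      by (rule part[of _ "\<lambda>_. 1" 1 0 0]) auto
    have cos: "(\<integral>\<omega>. I \<omega> * (1 + cos (S \<omega>)) * indicator (A k) (\<omega> k) \<partial>M) = (\<integral>\<omega>. I \<omega> * (1 + cos (S \<omega>)) * indicator (A k) (\<omega> k) \<partial>N)"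
      by (rule part[of _ "\<lambda>\<omega>. 1 + cos (S \<omega>)" 1 "1/2" "1/2"])
        (auto simp: cos_of_real[symmetric] cos_exp_eq field_simps range simp del: cos_of_real)
    have sin: "(\<integral>\<omega>. I \<omega> * (1 + sin (S \<omega>)) * indicator (A k) (\<omega> k) \<partial>M) = (\<integral>\<omega>. I \<omega> * (1 + sin (S \<omega>)) * indicator (A k) (\<omega> k) \<partial>N)"
      by (rule part[of _ "\<lambda>\<omega>. 1 + sin (S \<omega>)" 1 "1/(2*\<i>)" "-1/(2*\<i>)"])
        (auto simp: sin_of_real[symmetric] sin_exp_eq field_simps range simp del: sin_of_real)
    have split: "(CLINT \<omega>|K. (I \<omega> * indicator (A k) (\<omega> k)) *\<^sub>R iexp (S \<omega>))
       = of_real ((\<integral>\<omega>. I \<omega> * (1 + cos (S \<omega>)) * indicator (A k) (\<omega> k) \<partial>K) - (\<integral>\<omega>. I \<omega> * indicator (A k) (\<omega> k) \<partial>K))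
        + \<i> * of_real ((\<integral>\<omega>. I \<omega> * (1 + sin (S \<omega>)) * indicator (A k) (\<omega> k) \<partial>K) - (\<integral>\<omega>. I \<omega> * indicator (A k) (\<omega> k) \<partial>K))"
      if "prob_space K" and [measurable]: "I \<in> borel_measurable K" "S \<in> borel_measurable K" "(\<lambda>\<omega>. \<omega> k) \<in> borel_measurable K"
      for K
    proof -
      interpret prob_space K by fact
      let ?c = "\<lambda>\<omega>. I \<omega> * (1 + cos (S \<omega>)) * indicator (A k) (\<omega> k)"
      let ?s = "\<lambda>\<omega>. I \<omega> * (1 + sin (S \<omega>)) * indicator (A k) (\<omega> k)"
      let ?o = "\<lambda>\<omega>. I \<omega> * indicator (A k) (\<omega> k) :: real"
      have b: "\<bar>I \<omega> * indicator (A k) (\<omega> k)\<bar> \<le> 1" for \<omega> using I01[of \<omega>] by (auto simp: indicator_def)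
      have io: "integrable K ?o" using b by (intro integrable_const_bound[where B = 1]) auto
      have ic: "integrable K ?c"
      proof (intro integrable_const_bound[where B = 2] AE_I2)
        fix \<omega> show "norm (?c \<omega>) \<le> 2"
          using range[of "S \<omega>"] mult_mono[OF b[of \<omega>], of "1 + cos (S \<omega>)" 2] cos_le_one[of "S \<omega>"] cos_ge_minus_one[of "S \<omega>"]
          by (simp add: abs_mult abs_of_nonneg[OF range(1)] abs_of_nonneg[OF range(2)] mult_ac)
      qed auto
      have isn: "integrable K ?s"
      proof (intro integrable_const_bound[where B = 2] AE_I2)
        fix \<omega> show "norm (?s \<omega>) \<le> 2"
          using range[of "S \<omega>"] mult_mono[OF b[of \<omega>], of "1 + sin (S \<omega>)" 2] sin_le_one[of "S \<omega>"] sin_ge_minus_one[of "S \<omega>"]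
          by (simp add: abs_mult abs_of_nonneg[OF range(1)] abs_of_nonneg[OF range(2)] mult_ac)
      qed auto
      have eq: "(?o \<omega>) *\<^sub>R iexp (S \<omega>) = of_real (?c \<omega> - ?o \<omega>) + \<i> * of_real (?s \<omega> - ?o \<omega>)" for \<omega>
        by (simp add: exp_Euler scaleR_conv_of_real algebra_simps cos_of_real sin_of_real)
      show ?thesis unfolding eq using io ic isn
        by (subst integral_complex_parts) (simp_all only: Bochner_Integration.integral_diff Bochner_Integration.integrable_diff)
    qed
    show ?case
      unfolding J S_def[symmetric] using split[OF M(1)] split[OF N(1)] one cos sin by simp
  qed
  show ?thesis
  proof (rule measure_eqI_PiM_infinite[where I = UNIV and M = "\<lambda>_. borel"])
    show "sets M = sets (Pi\<^sub>M UNIV (\<lambda>_. borel))" "sets N = sets (Pi\<^sub>M UNIV (\<lambda>_. borel))"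
      using M(2) N(2) by (simp_all add: sets_PiM_equal_borel)
    show "finite_measure M" by (rule M.finite_measure_axioms)
    fix A :: "nat \<Rightarrow> real set" and J :: "nat set" assume J: "finite J" and A: "\<And>i. i \<in> J \<Longrightarrow> A i \<in> sets borel"
    define A' where "A' j = (if j \<in> J then A j else UNIV)" for j
    have A'm [measurable]: "A' j \<in> sets borel" for j using A by (auto simp: A'_def)
    have emb: "prod_emb UNIV (\<lambda>_. borel) J (Pi\<^sub>E J A) = {\<omega>. \<forall>j\<in>J. \<omega> j \<in> A' j}"
      by (auto simp: prod_emb_def A'_def PiE_iff)
    have ind: "(\<Prod>j\<in>J. indicator (A' j) (\<omega> j)) = (indicator {\<omega>. \<forall>j\<in>J. \<omega> j \<in> A' j} \<omega> :: real)" for \<omega>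
      using J by (auto simp: indicator_def prod_zero_iff)
    have m: "of_real (measure K {\<omega>. \<forall>j\<in>J. \<omega> j \<in> A' j}) = (CLINT \<omega>|K. (\<Prod>j\<in>J. indicator (A' j) (\<omega> j) :: real) *\<^sub>R iexp (\<Sum>a\<in>{}. 0 * \<omega> a))"
      if K: "space K = UNIV" and [measurable]: "\<And>j. (\<lambda>\<omega>. \<omega> j) \<in> borel_measurable K" for K :: "(nat \<Rightarrow> real) measure"
    proof -
      have "{\<omega> \<in> space K. \<forall>j\<in>J. \<omega> j \<in> A' j} \<in> sets K" using J by measurable
      then show ?thesis unfolding ind by (simp add: K of_real_def[symmetric])
    qed
    have sp: "space M = UNIV" "space N = UNIV" using sets_eq_imp_space_eq[OF M(2)] sets_eq_imp_space_eq[OF N(2)] by auto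
    have "complex_of_real (measure M {\<omega>. \<forall>j\<in>J. \<omega> j \<in> A' j}) = of_real (measure N {\<omega>. \<forall>j\<in>J. \<omega> j \<in> A' j})"
      using m[OF sp(1) coord(1)] m[OF sp(2) coord(2)] claim[OF J, of "{}" A' "\<lambda>_. 0"] A'm by simp
    then show "emeasure M (prod_emb UNIV (\<lambda>_. borel) J (Pi\<^sub>E J A)) = emeasure N (prod_emb UNIV (\<lambda>_. borel) J (Pi\<^sub>E J A))"
      unfolding emb by (simp add: M.emeasure_eq_measure N.emeasure_eq_measure)
  qed
qed

lemma affine_image_moments:
  fixes N :: "real measure" and \<mu> \<sigma> :: real
  assumes N: "prob_space N" "sets N = sets borel"
    and int: "integrable N (\<lambda>x. x)" "integrable N (\<lambda>x. x\<^sup>2)"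
    and mom: "(\<integral>x. x \<partial>N) = 0" "(\<integral>x. x\<^sup>2 \<partial>N) = 1"
  defines "D \<equiv> distr N borel (\<lambda>x. \<mu> + \<sigma> * x)"
  shows "integrable D (\<lambda>x. x)" "integrable D (\<lambda>x. x\<^sup>2)"
    "(\<integral>x. x \<partial>D) = \<mu>" "(\<integral>x. x\<^sup>2 \<partial>D) = \<mu>\<^sup>2 + \<sigma>\<^sup>2"
proof -
  interpret prob_space N by (rule N)
  note [measurable_cong] = N(2)
  have [measurable]: "(\<lambda>x. \<mu> + \<sigma> * x) \<in> measurable N borel" by measurable
  have sq: "(\<mu> + \<sigma> * x)\<^sup>2 = \<mu>\<^sup>2 + 2 * \<mu> * \<sigma> * x + \<sigma>\<^sup>2 * x\<^sup>2" for x
    by (auto simp: power2_eq_square algebra_simps)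
  have d: "integrable D f \<longleftrightarrow> integrable N (\<lambda>x. f (\<mu> + \<sigma> * x))" "(\<integral>x. f x \<partial>D) = (\<integral>x. f (\<mu> + \<sigma> * x) \<partial>N)"
    if "f \<in> borel_measurable borel" for f :: "real \<Rightarrow> real"
    unfolding D_def using that by (auto intro!: integrable_distr_eq integral_distr)
  note intros = Bochner_Integration.integrable_add integrable_mult_right int integrable_const
  have m: "(\<lambda>x. x) \<in> borel_measurable (borel :: real measure)" "(\<lambda>x. x\<^sup>2) \<in> borel_measurable (borel :: real measure)"
    by measurable
  show "integrable D (\<lambda>x. x)" unfolding d(1)[OF m(1)] by (intro intros)
  show "integrable D (\<lambda>x. x\<^sup>2)" unfolding d(1)[OF m(2)] sq
    by (intro intros)
  have "(\<integral>x. \<mu> + \<sigma> * x \<partial>N) = \<mu> + \<sigma> * (\<integral>x. x \<partial>N)"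
    by (subst Bochner_Integration.integral_add) (intro intros | simp add: prob_space)+
  then show "(\<integral>x. x \<partial>D) = \<mu>" unfolding d(2)[OF m(1)] mom by simp
  have "(\<integral>x. \<mu>\<^sup>2 + 2 * \<mu> * \<sigma> * x + \<sigma>\<^sup>2 * x\<^sup>2 \<partial>N)
      = \<mu>\<^sup>2 + 2 * \<mu> * \<sigma> * (\<integral>x. x \<partial>N) + \<sigma>\<^sup>2 * (\<integral>x. x\<^sup>2 \<partial>N)"
    by (subst Bochner_Integration.integral_add, (intro intros)+)+ (simp add: prob_space)
  then show "(\<integral>x. x\<^sup>2 \<partial>D) = \<mu>\<^sup>2 + \<sigma>\<^sup>2"
    unfolding d(2)[OF m(2)] sq mom by simp
qed

lemmas normal_image_moments = affine_image_moments[OF prob_space_normal_density[OF zero_less_one] _ std_normal_integrals]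

lemma measurable_into_sequences:
  assumes "\<And>a. (\<lambda>x. f x a) \<in> borel_measurable M" shows "f \<in> measurable M (borel :: (nat \<Rightarrow> real) measure)"
proof -
  have "f \<in> measurable M (Pi\<^sub>M UNIV (\<lambda>_. borel))"
    using assms by (intro measurable_PiM_single') auto
  then show ?thesis using sets_PiM_equal_borel measurable_cong_sets by blast
qed

section \<open>Stationary Gaussian environments with summable covariance\<close>

locale gaussian_environment =
  fixes P :: "(nat \<Rightarrow> real) measure"
  assumes gauss: "centered_stationary_gaussian P"
    and summable_cov: "summable (\<lambda>a. \<bar>autocovariance P a\<bar>)"
begin

sublocale prob_space P using gauss by (simp add: centered_stationary_gaussian_def)

lemma sets_P [measurable_cong, simp]: "sets P = sets borel"
  using gauss by (simp add: centered_stationary_gaussian_def)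

lemma space_P [simp]: "space P = UNIV"
  using sets_eq_imp_space_eq[OF sets_P] by simp

lemma coord_measurable [measurable]: "(\<lambda>\<omega>. \<omega> a) \<in> borel_measurable P"
  using measurable_product_coordinates[of a] measurable_cong_sets[OF sets_P refl] by blast

lemma shift_measurable: "(\<lambda>\<omega> a. \<omega> (a + k)) \<in> measurable P borel"
proof -
  have "(\<lambda>\<omega> a. \<omega> (a + k) :: real) \<in> measurable borel borel"
    by (intro borel_measurable_continuous_onI continuous_on_coordinatewise_then_product) simp
  then show ?thesis by (simp add: measurable_cong_sets[OF sets_P refl])
qed

lemma shift_distr: "distr P borel (\<lambda>\<omega> a. \<omega> (a + k)) = P"
proof (induction k)
  case 0
  show ?case by (simp add: distr_id2)
next
  case (Suc k)
  have m: "(\<lambda>\<omega> a. \<omega> (a + 1)) \<in> measurable borel (borel :: (nat \<Rightarrow> real) measure)"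
    using shift_measurable[of 1] by (simp only: measurable_cong_sets[OF sets_P refl])
  have "P = distr P borel (\<lambda>\<omega> a. \<omega> (Suc a))"
    using gauss by (simp add: centered_stationary_gaussian_def)
  also have "\<dots> = distr (distr P borel (\<lambda>\<omega> a. \<omega> (a + k))) borel (\<lambda>\<omega> a. \<omega> (a + 1))"
    by (simp add: Suc)
  also have "\<dots> = distr P borel ((\<lambda>\<omega> a. \<omega> (a + 1)) \<circ> (\<lambda>\<omega> a. \<omega> (a + k)))"
    by (rule distr_distr[OF m shift_measurable])
  also have "(\<lambda>\<omega> a. \<omega> (a + 1)) \<circ> (\<lambda>\<omega> a. \<omega> (a + k)) = (\<lambda>\<omega> a. \<omega> (a + Suc k) :: real)"
    by (auto simp: fun_eq_iff)
  finally show ?case by simp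
qed

lemma shift_integral:
  fixes F :: "(nat \<Rightarrow> real) \<Rightarrow> real"
  assumes "F \<in> borel_measurable P"
  shows "(\<integral>\<omega>. F (\<lambda>a. \<omega> (a + k)) \<partial>P) = (\<integral>\<omega>. F \<omega> \<partial>P)"
proof -
  have F: "F \<in> borel_measurable borel" using assms by (simp add: measurable_cong_sets[OF sets_P refl])
  have "(\<integral>\<omega>. F \<omega> \<partial>P) = (\<integral>\<omega>. F \<omega> \<partial>distr P borel (\<lambda>\<omega> a. \<omega> (a + k)))"
    by (simp add: shift_distr)
  also have "\<dots> = (\<integral>\<omega>. F (\<lambda>a. \<omega> (a + k)) \<partial>P)"
    by (rule integral_distr[OF shift_measurable F])
  finally show ?thesis by simp
qed

definition lin :: "(nat \<Rightarrow> real) \<Rightarrow> nat set \<Rightarrow> (nat \<Rightarrow> real) \<Rightarrow> real" where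
  "lin c V \<omega> = (\<Sum>a\<in>V. c a * \<omega> a)"

abbreviation lin_variance :: "(nat \<Rightarrow> real) \<Rightarrow> nat set \<Rightarrow> real" where
  "lin_variance c V \<equiv> (\<integral>\<omega>. (lin c V \<omega>)\<^sup>2 \<partial>P)"

lemma linear_measurable [measurable]: "lin c V \<in> borel_measurable P"
  unfolding lin_def by measurable

lemma linear_law:
  assumes V: "finite V"
  shows "\<exists>\<mu> \<sigma>. 0 \<le> \<sigma> \<and> distr P borel (lin c V) = distr std_normal_distribution borel (\<lambda>x. \<mu> + \<sigma> * x)"
proof -
  obtain N where N: "V \<subseteq> {..<N}" using V finite_nat_bounded by blast
  \<comment> \<open>\<open>gaussian_sequence\<close> speaks of combinations over an initial segment,
    so the coefficients are extended by zero.\<close>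
  have eq: "lin c V = (\<lambda>\<omega>. \<Sum>a<N. (if a \<in> V then c a else 0) * \<omega> a)"
    unfolding lin_def fun_eq_iff using N by (auto intro!: sum.mono_neutral_cong_left)
  obtain \<mu> \<sigma> where "0 \<le> \<sigma>" "distr P borel (lin c V) = normal_law \<mu> \<sigma>"
    using gauss unfolding eq centered_stationary_gaussian_def gaussian_sequence_def by metis
  then show ?thesis using normal_law_distr by metis
qed

lemma linear_integrals:
  assumes V: "finite V"
  shows "integrable P (lin c V)" "integrable P (\<lambda>\<omega>. (lin c V \<omega>)\<^sup>2)"
proof -
  obtain \<mu> \<sigma> where law: "distr P borel (lin c V) = distr std_normal_distribution borel (\<lambda>x. \<mu> + \<sigma> * x)"
    using linear_law[OF V] by blast
  have "integrable (distr P borel (lin c V)) (\<lambda>x. x)" "integrable (distr P borel (lin c V)) (\<lambda>x. x\<^sup>2)"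
    unfolding law by (rule normal_image_moments; simp)+
  then show "integrable P (lin c V)" "integrable P (\<lambda>\<omega>. (lin c V \<omega>)\<^sup>2)"
    by (simp_all add: integrable_distr_eq)
qed

lemma coord_integrable [simp]: "integrable P (\<lambda>\<omega>. \<omega> a)"
  using linear_integrals(1)[of "{a}" "\<lambda>_. 1"] by (simp add: lin_def[abs_def])

lemma coord_mean [simp]: "(\<integral>\<omega>. \<omega> a \<partial>P) = 0"
  using gauss by (simp add: centered_stationary_gaussian_def)

lemma linear_mean: "(\<integral>\<omega>. lin c V \<omega> \<partial>P) = 0"
  unfolding lin_def by simp

text \<open>The parameters of the normal law are read off from its first two moments. From here on
  the law of a linear form is a function of its variance alone.\<close>

lemma linear_law_centered:
  assumes V: "finite V"
  obtains \<sigma> where "0 \<le> \<sigma>" "\<sigma>\<^sup>2 = lin_variance c V"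
    "distr P borel (lin c V) = distr std_normal_distribution borel (\<lambda>x. \<sigma> * x)"
proof -
  obtain \<mu> \<sigma> where law: "0 \<le> \<sigma>" "distr P borel (lin c V) = distr std_normal_distribution borel (\<lambda>x. \<mu> + \<sigma> * x)"
    using linear_law[OF V] by blast
  have "(\<integral>\<omega>. lin c V \<omega> \<partial>P) = (\<integral>x. x \<partial>distr P borel (lin c V))"
    by (simp add: integral_distr)
  also have "\<dots> = \<mu>" unfolding law(2) by (rule normal_image_moments) simp
  finally have \<mu>: "\<mu> = 0" by (simp add: linear_mean)
  have "lin_variance c V = (\<integral>x. x\<^sup>2 \<partial>distr P borel (lin c V))"
    by (simp add: integral_distr)
  also have "\<dots> = \<mu>\<^sup>2 + \<sigma>\<^sup>2" unfolding law(2) by (rule normal_image_moments) simp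
  finally have "\<sigma>\<^sup>2 = lin_variance c V" using \<mu> by simp
  moreover have "distr P borel (lin c V) = distr std_normal_distribution borel (\<lambda>x. \<sigma> * x)"
    using law(2) unfolding \<mu> by simp
  ultimately show thesis using that law(1) by blast
qed

lemma linear_char:
  assumes V: "finite V"
  shows "(CLINT \<omega>|P. iexp (lin c V \<omega>)) = of_real (exp (- lin_variance c V / 2))"
proof -
  obtain \<sigma> where \<sigma>: "\<sigma>\<^sup>2 = lin_variance c V"
    "distr P borel (lin c V) = distr std_normal_distribution borel (\<lambda>x. \<sigma> * x)"
    using linear_law_centered[OF V] by metis
  have "(CLINT \<omega>|P. iexp (lin c V \<omega>)) = (CLINT x|distr P borel (lin c V). iexp x)"
    by (subst integral_distr) auto
  also have "\<dots> = (CLINT x|std_normal_distribution. iexp (\<sigma> * x))"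
    unfolding \<sigma>(2) by (subst integral_distr) auto
  also have "\<dots> = char std_normal_distribution \<sigma>" by (simp add: char_def)
  finally show ?thesis unfolding char_std_normal_distribution \<sigma>(1) by simp
qed

lemma linear_exp:
  assumes V: "finite V"
  shows "(\<integral>\<^sup>+\<omega>. ennreal (exp (lin c V \<omega>)) \<partial>P) = ennreal (exp (lin_variance c V / 2))"
proof -
  obtain \<sigma> where \<sigma>: "\<sigma>\<^sup>2 = lin_variance c V"
    "distr P borel (lin c V) = distr std_normal_distribution borel (\<lambda>x. \<sigma> * x)"
    using linear_law_centered[OF V] by metis
  have "(\<integral>\<^sup>+\<omega>. ennreal (exp (lin c V \<omega>)) \<partial>P) = (\<integral>\<^sup>+x. ennreal (exp x) \<partial>distr P borel (lin c V))"
    by (subst nn_integral_distr) auto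
  also have "\<dots> = (\<integral>\<^sup>+x. ennreal (exp (\<sigma> * x)) \<partial>std_normal_distribution)"
    unfolding \<sigma>(2) by (subst nn_integral_distr) auto
  finally show ?thesis unfolding std_normal_exp \<sigma>(1) by simp
qed

lemma coord_product_integrable [simp]: "integrable P (\<lambda>\<omega>. \<omega> a * \<omega> b)"
proof -
  have "integrable P (\<lambda>\<omega>. (\<omega> x)\<^sup>2)" for x
    using linear_integrals(2)[of "{x}" "\<lambda>_. 1"] by (simp add: lin_def[abs_def])
  then have int: "integrable P (\<lambda>\<omega>. (\<omega> a)\<^sup>2 + (\<omega> b)\<^sup>2)" by simp
  have "norm (x * y) \<le> norm (x\<^sup>2 + y\<^sup>2)" for x y :: real
    using sum_squares_bound[of x y] sum_squares_bound[of x "- y"] zero_le_power2[of x] zero_le_power2[of y]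
    by (auto simp: abs_if simp del: zero_le_power2)
  then show ?thesis by (intro Bochner_Integration.integrable_bound[OF int]) auto
qed

lemma covariance_eq: "(\<integral>\<omega>. \<omega> (a + k) * \<omega> (b + k) \<partial>P) = (\<integral>\<omega>. \<omega> a * \<omega> b \<partial>P)"
  using shift_integral[of "\<lambda>\<omega>. \<omega> a * \<omega> b" k] by simp

text \<open>A bound on every absolute row sum of the covariance matrix; the factor 2 is there
  because a lag occurs on both sides of a site.\<close>

definition covariance_bound :: real where
  "covariance_bound = 2 * (\<Sum>a. \<bar>autocovariance P a\<bar>)"

lemma covariance_bound_nonneg: "0 \<le> covariance_bound"
  unfolding covariance_bound_def by (simp add: suminf_nonneg summable_cov)

lemma covariance_row_sum:
  assumes V: "finite V" shows "(\<Sum>b\<in>V. \<bar>\<integral>\<omega>. \<omega> a * \<omega> b \<partial>P\<bar>) \<le> covariance_bound"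
proof -
  let ?g = "\<lambda>a. \<bar>autocovariance P a\<bar>"
  have "\<bar>\<integral>\<omega>. \<omega> a * \<omega> b \<partial>P\<bar> = ?g (b - a)" if "a \<le> b" for b
    using covariance_eq[of 0 a "b - a"] that by (simp add: autocovariance_def)
  then have "(\<Sum>b\<in>V \<inter> {a..}. \<bar>\<integral>\<omega>. \<omega> a * \<omega> b \<partial>P\<bar>) = (\<Sum>b\<in>V \<inter> {a..}. ?g (b - a))"
    by (intro sum.cong) auto
  also have "\<dots> = (\<Sum>x\<in>(\<lambda>b. b - a) ` (V \<inter> {a..}). ?g x)"
    by (subst sum.reindex) (auto simp: inj_on_def)
  also have "\<dots> \<le> (\<Sum>a. ?g a)"
    using V by (intro sum_le_suminf summable_cov) auto
  finally have 1: "(\<Sum>b\<in>V \<inter> {a..}. \<bar>\<integral>\<omega>. \<omega> a * \<omega> b \<partial>P\<bar>) \<le> (\<Sum>a. ?g a)" .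
  have "\<bar>\<integral>\<omega>. \<omega> a * \<omega> b \<partial>P\<bar> = ?g (a - b)" if "b < a" for b
    using covariance_eq[of "a - b" b 0] that by (simp add: autocovariance_def mult.commute)
  then have "(\<Sum>b\<in>V \<inter> {..<a}. \<bar>\<integral>\<omega>. \<omega> a * \<omega> b \<partial>P\<bar>) = (\<Sum>b\<in>V \<inter> {..<a}. ?g (a - b))"
    by (intro sum.cong) auto
  also have "\<dots> = (\<Sum>x\<in>(\<lambda>b. a - b) ` (V \<inter> {..<a}). ?g x)"
    by (subst sum.reindex) (auto simp: inj_on_def)
  also have "\<dots> \<le> (\<Sum>a. ?g a)"
    using V by (intro sum_le_suminf summable_cov) auto
  finally have 2: "(\<Sum>b\<in>V \<inter> {..<a}. \<bar>\<integral>\<omega>. \<omega> a * \<omega> b \<partial>P\<bar>) \<le> (\<Sum>a. ?g a)" .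
  have "V = (V \<inter> {a..}) \<union> (V \<inter> {..<a})" by auto
  then have "(\<Sum>b\<in>V. \<bar>\<integral>\<omega>. \<omega> a * \<omega> b \<partial>P\<bar>)
      = (\<Sum>b\<in>V \<inter> {a..}. \<bar>\<integral>\<omega>. \<omega> a * \<omega> b \<partial>P\<bar>) + (\<Sum>b\<in>V \<inter> {..<a}. \<bar>\<integral>\<omega>. \<omega> a * \<omega> b \<partial>P\<bar>)"
    by (subst sum.union_disjoint[symmetric]) (use V in auto)
  then show ?thesis using 1 2 by (simp add: covariance_bound_def)
qed

text \<open>The variance is a quadratic form, estimated row by row. Since row sums are bounded by
  summability, it grows only linearly in \<open>card V\<close>, as for independent
  variables.\<close>

lemma linear_variance_le:
  assumes V: "finite V" and c: "\<And>a. a \<in> V \<Longrightarrow> \<bar>c a\<bar> \<le> t"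
  shows "lin_variance c V \<le> t\<^sup>2 * (covariance_bound * card V)"
proof -
  have "lin_variance c V = (\<integral>\<omega>. (\<Sum>a\<in>V. \<Sum>b\<in>V. c a * c b * (\<omega> a * \<omega> b)) \<partial>P)"
    by (simp add: lin_def power2_eq_square sum_product mult_ac)
  also have "\<dots> = (\<Sum>a\<in>V. \<Sum>b\<in>V. c a * c b * (\<integral>\<omega>. \<omega> a * \<omega> b \<partial>P))" by simp
  also have "\<dots> \<le> (\<Sum>a\<in>V. \<Sum>b\<in>V. t\<^sup>2 * \<bar>\<integral>\<omega>. \<omega> a * \<omega> b \<partial>P\<bar>)"
  proof (intro sum_mono)
    fix a b assume ab: "a \<in> V" "b \<in> V"
    have "0 \<le> t" using c[OF ab(1)] abs_ge_zero[of "c a"] by linarith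
    then have "\<bar>c a\<bar> * \<bar>c b\<bar> \<le> t * t" by (rule mult_mono[OF c[OF ab(1)] c[OF ab(2)]]) (rule abs_ge_zero)
    then have "\<bar>c a * c b\<bar> \<le> t\<^sup>2" by (simp only: abs_mult power2_eq_square)
    then have "\<bar>c a * c b\<bar> * \<bar>\<integral>\<omega>. \<omega> a * \<omega> b \<partial>P\<bar> \<le> t\<^sup>2 * \<bar>\<integral>\<omega>. \<omega> a * \<omega> b \<partial>P\<bar>"
      by (rule mult_right_mono) (rule abs_ge_zero)
    with abs_ge_self[of "c a * c b * (\<integral>\<omega>. \<omega> a * \<omega> b \<partial>P)"]
    show "c a * c b * (\<integral>\<omega>. \<omega> a * \<omega> b \<partial>P) \<le> t\<^sup>2 * \<bar>\<integral>\<omega>. \<omega> a * \<omega> b \<partial>P\<bar>"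
      unfolding abs_mult[of "c a * c b"] by (rule order_trans)
  qed
  also have "\<dots> \<le> (\<Sum>a\<in>V. t\<^sup>2 * covariance_bound)"
    unfolding sum_distrib_left[symmetric] by (intro sum_mono mult_left_mono covariance_row_sum V) auto
  finally show ?thesis by (simp add: mult_ac)
qed

lemma linear_exp_le:
  assumes V: "finite V" and c: "\<And>a. a \<in> V \<Longrightarrow> \<bar>c a\<bar> \<le> t"
  shows "(\<integral>\<^sup>+\<omega>. ennreal (exp (lin c V \<omega>)) \<partial>P) \<le> ennreal (exp (t\<^sup>2 * (covariance_bound * card V) / 2))"
  unfolding linear_exp[OF V] using linear_variance_le[OF assms] by (intro ennreal_leI) simp

section \<open>Rotation of two independent copies of the environment\<close>

definition rotate :: "real \<Rightarrow> (nat \<Rightarrow> real) \<times> (nat \<Rightarrow> real) \<Rightarrow> (nat \<Rightarrow> real) \<times> (nat \<Rightarrow> real)" where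
  "rotate \<phi> = (\<lambda>(x, y). (\<lambda>a. cos \<phi> * x a + sin \<phi> * y a, \<lambda>a. cos \<phi> * y a - sin \<phi> * x a))"

text \<open>Codes two sequences as one, so that the uniqueness of laws on sequence space applies to
  pairs.\<close>

definition interleave :: "(nat \<Rightarrow> real) \<times> (nat \<Rightarrow> real) \<Rightarrow> nat \<Rightarrow> real" where
  "interleave = (\<lambda>(x, y) i. if even i then x (i div 2) else y (i div 2))"

lemma rotate_add: "rotate \<phi> (rotate \<psi> z) = rotate (\<phi> + \<psi>) z"
  by (cases z) (simp add: rotate_def fun_eq_iff cos_add sin_add algebra_simps)

lemma pair_coord_measurable [measurable]:
  "(\<lambda>z. fst z a) \<in> borel_measurable (P \<Otimes>\<^sub>M P)" "(\<lambda>z. snd z a) \<in> borel_measurable (P \<Otimes>\<^sub>M P)"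
  using measurable_compose[OF measurable_fst coord_measurable] measurable_compose[OF measurable_snd coord_measurable]
  by auto

lemma measurable_into_P: "measurable M P = measurable M borel"
  by (rule measurable_cong_sets) auto

lemma rotate_measurable [measurable]: "rotate \<phi> \<in> measurable (P \<Otimes>\<^sub>M P) (P \<Otimes>\<^sub>M P)"
proof -
  have "(\<lambda>z. (\<lambda>a. cos \<phi> * fst z a + sin \<phi> * snd z a)) \<in> measurable (P \<Otimes>\<^sub>M P) P"
    "(\<lambda>z. (\<lambda>a. cos \<phi> * snd z a - sin \<phi> * fst z a)) \<in> measurable (P \<Otimes>\<^sub>M P) P"
    unfolding measurable_into_P by (intro measurable_into_sequences; measurable)+
  then have "(\<lambda>z. ((\<lambda>a. cos \<phi> * fst z a + sin \<phi> * snd z a), (\<lambda>a. cos \<phi> * snd z a - sin \<phi> * fst z a))) \<in> measurable (P \<Otimes>\<^sub>M P) (P \<Otimes>\<^sub>M P)"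
    by (rule measurable_Pair)
  then show ?thesis by (simp add: rotate_def case_prod_beta')
qed

lemma interleave_measurable [measurable]: "interleave \<in> measurable (P \<Otimes>\<^sub>M P) borel"
  by (rule measurable_into_sequences) (auto simp: interleave_def case_prod_beta' pair_coord_measurable)

text \<open>For independent copies the characteristic function at a coefficient pair
  \<open>(c, d)\<close> depends only on the sum of the variances of the two linear forms. Rotating
  the pair of sequences amounts to rotating \<open>(c, d)\<close>, which preserves this sum because
  the squares of cosine and sine add up to 1.\<close>

lemma rotation_invariance: "distr (P \<Otimes>\<^sub>M P) (P \<Otimes>\<^sub>M P) (rotate \<phi>) = P \<Otimes>\<^sub>M P"
proof -
  interpret PP: pair_prob_space P P ..
  let ?PP = "P \<Otimes>\<^sub>M P"
  have pair_char: "(CLINT z|?PP. iexp (lin c V (fst z) + lin d V (snd z)))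
      = of_real (exp (- (\<integral>\<omega>. (lin c V \<omega>)\<^sup>2 + (lin d V \<omega>)\<^sup>2 \<partial>P) / 2))"
    if V: "finite V" for V c d
  proof -
    have "(CLINT z|?PP. iexp (lin c V (fst z) + lin d V (snd z)))
        = (CLINT x|P. CLINT y|P. iexp (lin c V x + lin d V y))"
    proof -
      have [measurable]: "(\<lambda>z. lin c V (fst z)) \<in> borel_measurable ?PP" "(\<lambda>z. lin d V (snd z)) \<in> borel_measurable ?PP"
        by (auto simp: lin_def)
      have "integrable ?PP (\<lambda>z. iexp (lin c V (fst z) + lin d V (snd z)))"
        by (intro PP.P.integrable_const_bound[where B = 1]) (auto simp del: of_real_add)
      from PP.integral_fst'[OF this] show ?thesis by simp
    qed
    also have "\<dots> = (CLINT x|P. iexp (lin c V x) * (CLINT y|P. iexp (lin d V y)))"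
      by (simp add: distrib_left exp_add)
    also have "\<dots> = (CLINT x|P. iexp (lin c V x)) * (CLINT y|P. iexp (lin d V y))"
      by (rule integral_mult_left_zero)
    finally show ?thesis unfolding linear_char[OF V]
      by (simp add: linear_integrals[OF V] exp_add[symmetric] exp_of_real[symmetric] add_divide_distrib diff_divide_distrib
          del: exp_of_real)
  qed
  have inter: "(\<Sum>i\<in>V. c i * interleave z i) = lin (\<lambda>a. if 2 * a \<in> V then c (2 * a) else 0) {..<N} (fst z)
      + lin (\<lambda>a. if 2 * a + 1 \<in> V then c (2 * a + 1) else 0) {..<N} (snd z)"
    if N: "V \<subseteq> {..<2 * N}" for V c N z
  proof -
    let ?g = "\<lambda>i. (if i \<in> V then c i else 0) * interleave z i"
    have "(\<Sum>i\<in>V. c i * interleave z i) = (\<Sum>i<2 * N. ?g i)"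
      using N by (intro sum.mono_neutral_cong_left) auto
    also have "\<dots> = (\<Sum>a<N. ?g (2 * a) + ?g (2 * a + 1))"
      by (induction N) (simp_all add: algebra_simps)
    finally show ?thesis by (cases z) (simp add: lin_def interleave_def sum.distrib)
  qed
  have law: "distr ?PP borel (interleave \<circ> rotate \<phi>) = distr ?PP borel interleave"
  proof (rule sequence_law_unique)
    have [measurable]: "interleave \<circ> rotate \<phi> \<in> measurable ?PP borel" by measurable
    show "prob_space (distr ?PP borel (interleave \<circ> rotate \<phi>))" "prob_space (distr ?PP borel interleave)"
      by (intro PP.P.prob_space_distr; measurable)+
    fix V :: "nat set" and c :: "nat \<Rightarrow> real" assume V: "finite V"
    obtain N' where N': "V \<subseteq> {..<N'}" using V finite_nat_bounded by blast
    then have N: "V \<subseteq> {..<2 * N'}" by auto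
    define d where "d = (\<lambda>a. if 2 * a \<in> V then c (2 * a) else 0)"
    define e where "e = (\<lambda>a. if 2 * a + 1 \<in> V then c (2 * a + 1) else 0)"
    define d' where "d' = (\<lambda>a. cos \<phi> * d a - sin \<phi> * e a)"
    define e' where "e' = (\<lambda>a. sin \<phi> * d a + cos \<phi> * e a)"
    let ?W = "{..<N'}"
    have rot: "lin d ?W (fst (rotate \<phi> z)) + lin e ?W (snd (rotate \<phi> z)) = lin d' ?W (fst z) + lin e' ?W (snd z)" for z
      by (cases z) (simp add: rotate_def lin_def d'_def e'_def algebra_simps sum.distrib sum_subtractf)
    have sq: "(lin d' ?W \<omega>)\<^sup>2 + (lin e' ?W \<omega>)\<^sup>2 = (lin d ?W \<omega>)\<^sup>2 + (lin e ?W \<omega>)\<^sup>2" for \<omega>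
    proof -
      have 1: "lin d' ?W \<omega> = cos \<phi> * lin d ?W \<omega> - sin \<phi> * lin e ?W \<omega>"
        "lin e' ?W \<omega> = sin \<phi> * lin d ?W \<omega> + cos \<phi> * lin e ?W \<omega>"
        by (simp_all add: lin_def d'_def e'_def sum_distrib_left algebra_simps sum.distrib sum_subtractf)
      have "(lin d' ?W \<omega>)\<^sup>2 + (lin e' ?W \<omega>)\<^sup>2
          = ((cos \<phi>)\<^sup>2 + (sin \<phi>)\<^sup>2) * ((lin d ?W \<omega>)\<^sup>2 + (lin e ?W \<omega>)\<^sup>2)"
        unfolding 1 by (simp only: power2_eq_square) algebra
      then show ?thesis by simp
    qed
    have m: "(\<lambda>\<omega>. iexp (\<Sum>a\<in>V. c a * \<omega> a)) \<in> borel_measurable (borel :: (nat \<Rightarrow> real) measure)"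
    proof -
      have "(\<lambda>\<omega>. \<omega> a) \<in> borel_measurable (borel :: (nat \<Rightarrow> real) measure)" for a
        by (rule measurable_product_coordinates)
      note [measurable] = this
      show ?thesis by measurable
    qed
    have "(CLINT \<omega>|distr ?PP borel (interleave \<circ> rotate \<phi>). iexp (\<Sum>a\<in>V. c a * \<omega> a))
        = (CLINT z|?PP. iexp (lin d' ?W (fst z) + lin e' ?W (snd z)))"
      by (subst integral_distr[OF _ m]) (simp_all only: o_def inter[OF N] d_def[symmetric] e_def[symmetric] rot, measurable)
    also have "\<dots> = (CLINT z|?PP. iexp (lin d ?W (fst z) + lin e ?W (snd z)))"
      by (simp only: pair_char[OF finite_lessThan] sq)
    also have "\<dots> = (CLINT \<omega>|distr ?PP borel interleave. iexp (\<Sum>a\<in>V. c a * \<omega> a))"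
      by (subst integral_distr[OF _ m]) (simp_all only: o_def inter[OF N] d_def[symmetric] e_def[symmetric], measurable)
    finally show "(CLINT \<omega>|distr ?PP borel (interleave \<circ> rotate \<phi>). iexp (\<Sum>a\<in>V. c a * \<omega> a))
        = (CLINT \<omega>|distr ?PP borel interleave. iexp (\<Sum>a\<in>V. c a * \<omega> a))" .
  qed auto
  \<comment> \<open>Undoing the interleaving carries the equality of laws back to pairs.\<close>
  define split where "split = (\<lambda>x :: nat \<Rightarrow> real. (\<lambda>a. x (2 * a), \<lambda>a. x (2 * a + 1)))"
  have split_inter: "split (interleave z) = z" for z
    by (cases z) (simp add: split_def interleave_def)
  have [measurable]: "split \<in> measurable borel ?PP"
  proof -
    have "(\<lambda>x :: nat \<Rightarrow> real. (\<lambda>a. x (2 * a))) \<in> measurable borel P" "(\<lambda>x :: nat \<Rightarrow> real. (\<lambda>a. x (2 * a + 1))) \<in> measurable borel P"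
      unfolding measurable_into_P by (intro measurable_into_sequences measurable_product_coordinates)+
    then show ?thesis unfolding split_def by (rule measurable_Pair)
  qed
  have "distr ?PP ?PP (rotate \<phi>) = distr (distr ?PP borel (interleave \<circ> rotate \<phi>)) ?PP split"
    by (subst distr_distr) (simp_all add: o_def split_inter)
  also have "\<dots> = distr (distr ?PP borel interleave) ?PP split" by (simp only: law)
  also have "\<dots> = ?PP" by (subst distr_distr) (simp_all add: o_def split_inter distr_id2)
  finally show ?thesis .
qed

end

section \<open>Concentration\<close>

lemma exp_tangent: "exp m * (1 + x - m) \<le> exp (x :: real)"
proof -
  have "exp m * (1 + (x - m)) \<le> exp m * exp (x - m)"
    by (intro mult_left_mono exp_ge_add_one_self) simp
  then show ?thesis by (simp add: exp_diff add_diff_eq)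
qed

text \<open>Jensen's inequality for the \<open>K\<close> numbers \<open>real K * y k\<close>, whose
  average is the sum of the \<open>y k\<close>: the tangent at this average is evaluated at each of
  them and summed.\<close>

lemma exp_sum_le_average:
  assumes "1 \<le> K"
  shows "exp (\<Sum>k<K. y k) \<le> (\<Sum>k<K. exp (real K * y k)) / real K"
proof -
  let ?m = "\<Sum>k<K. y k"
  have "(\<Sum>k<K. exp ?m * (1 + real K * y k - ?m)) \<le> (\<Sum>k<K. exp (real K * y k))"
    by (intro sum_mono exp_tangent)
  moreover have "(\<Sum>k<K. exp ?m * (1 + real K * y k - ?m)) = exp ?m * real K"
    unfolding sum_distrib_left[symmetric]
    by (simp add: sum.distrib sum_subtractf sum_distrib_left[symmetric] algebra_simps)
  ultimately show ?thesis using assms by (simp add: field_simps)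
qed

lemma exp_sum_le_sum_exp:
  fixes x :: "'i \<Rightarrow> real"
  assumes V: "finite V" "V \<noteq> {}"
  shows "exp (\<Sum>a\<in>V. x a) \<le> (\<Sum>a\<in>V. exp (real (card V) * x a))"
proof -
  have "Max (x ` V) \<in> x ` V" using V by (intro Max_in) auto
  then obtain a where a: "a \<in> V" "x a = Max (x ` V)" by (metis imageE)
  have "(\<Sum>b\<in>V. x b) \<le> real (card V) * x a"
    using V a by (intro sum_bounded_above[where K = "x a"]) simp
  then have "exp (\<Sum>b\<in>V. x b) \<le> exp (real (card V) * x a)" by simp
  also have "\<dots> \<le> (\<Sum>a\<in>V. exp (real (card V) * x a))"
    using V a by (intro member_le_sum) auto
  finally show ?thesis .
qed

text \<open>\<open>\<eta> * y\<close> is the average of \<open>y\<close> and \<open>0\<close> with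
  weights \<open>\<eta>\<close> and \<open>1 - \<eta>\<close>, so convexity gives
  \<open>\<eta> * exp y + (1 - \<eta>)\<close>.\<close>

lemma exp_scaled_le:
  fixes y \<eta> :: real
  assumes "0 \<le> \<eta>" "\<eta> \<le> 1" shows "exp (\<eta> * y) \<le> 1 + \<eta> * exp y"
proof -
  have 1: "exp (\<eta> * y) * (1 + y - \<eta> * y) \<le> exp y" by (rule exp_tangent)
  have 2: "exp (\<eta> * y) * (1 + 0 - \<eta> * y) \<le> 1" using exp_tangent[of "\<eta> * y" 0] by simp
  have "\<eta> * (exp (\<eta> * y) * (1 + y - \<eta> * y)) + (1 - \<eta>) * (exp (\<eta> * y) * (1 + 0 - \<eta> * y)) \<le> \<eta> * exp y + (1 - \<eta>) * 1"
    using assms by (intro add_mono mult_left_mono 1 2) auto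
  moreover have "\<eta> * (exp (\<eta> * y) * (1 + y - \<eta> * y)) + (1 - \<eta>) * (exp (\<eta> * y) * (1 + 0 - \<eta> * y)) = exp (\<eta> * y)"
    by (simp add: algebra_simps)
  ultimately have "exp (\<eta> * y) \<le> \<eta> * exp y + (1 - \<eta>) * 1" by (simp only:)
  then show ?thesis using assms by simp
qed

lemma ennreal_one_plus_mult: "0 \<le> c \<Longrightarrow> 0 \<le> e \<Longrightarrow> ennreal (1 + c * e) = 1 + ennreal c * ennreal e"
  by (simp add: ennreal_plus ennreal_mult)

lemma ennreal_integral_le_nn_integral:
  assumes "integrable M g" shows "ennreal (\<integral>x. g x \<partial>M) \<le> (\<integral>\<^sup>+x. ennreal (g x) \<partial>M)"
proof -
  have fin: "(\<integral>\<^sup>+x. ennreal (g x) \<partial>M) \<noteq> \<infinity>"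
    using assms by (auto simp: real_integrable_def)
  have "(\<integral>x. g x \<partial>M) \<le> enn2real (\<integral>\<^sup>+x. ennreal (g x) \<partial>M)"
    unfolding real_lebesgue_integral_def[OF assms] by simp
  then have "ennreal (\<integral>x. g x \<partial>M) \<le> ennreal (enn2real (\<integral>\<^sup>+x. ennreal (g x) \<partial>M))" by (rule ennreal_leI)
  also have "\<dots> = (\<integral>\<^sup>+x. ennreal (g x) \<partial>M)" using fin by (intro ennreal_enn2real) (auto simp: less_top)
  finally show ?thesis .
qed

text \<open>Jensen's inequality from the single tangent at the mean, with the value infinity allowed
  on the right.\<close>

lemma (in prob_space) exp_mean_le:
  assumes "integrable M f" shows "ennreal (exp (\<integral>x. f x \<partial>M)) \<le> (\<integral>\<^sup>+x. ennreal (exp (f x)) \<partial>M)"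
proof -
  let ?m = "\<integral>x. f x \<partial>M"
  have int: "integrable M (\<lambda>x. exp ?m * (1 + f x - ?m))" using assms by simp
  have "(\<integral>x. exp ?m * (1 + f x - ?m) \<partial>M) = exp ?m"
    using assms by (simp add: prob_space)
  then have "ennreal (exp ?m) \<le> (\<integral>\<^sup>+x. ennreal (exp ?m * (1 + f x - ?m)) \<partial>M)"
    using ennreal_integral_le_nn_integral[OF int] by simp
  also have "\<dots> \<le> (\<integral>\<^sup>+x. ennreal (exp (f x)) \<partial>M)"
    by (intro nn_integral_mono ennreal_leI exp_tangent)
  finally show ?thesis .
qed

section \<open>Exponential moments of convex functions of the environment\<close>

context gaussian_environment
begin

text \<open>Convex functions of the coordinates in \<open>V\<close> with all slopes in [0, 1],
  \<open>u y\<close> being a subgradient at \<open>y\<close>. For log Z the slopes are contact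
  probabilities. Written at the end \<open>y\<close>, the inequality bounds increments from above,
  as exponential moments require.\<close>

definition has_subgradient :: "nat set \<Rightarrow> ((nat \<Rightarrow> real) \<Rightarrow> real) \<Rightarrow> ((nat \<Rightarrow> real) \<Rightarrow> nat \<Rightarrow> real) \<Rightarrow> bool" where
  "has_subgradient V F u \<longleftrightarrow> F \<in> borel_measurable P \<and> (\<forall>a. (\<lambda>\<omega>. u \<omega> a) \<in> borel_measurable P) \<and>
     (\<forall>\<omega> a. 0 \<le> u \<omega> a \<and> u \<omega> a \<le> 1) \<and> (\<forall>x y. F y - F x \<le> (\<Sum>a\<in>V. u y a * (y a - x a)))"

lemma subgradient_lipschitz:
  assumes "has_subgradient V F u" shows "\<bar>F y - F x\<bar> \<le> (\<Sum>a\<in>V. \<bar>y a - x a\<bar>)"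
proof -
  have "F y - F x \<le> (\<Sum>a\<in>V. \<bar>y a - x a\<bar>)" for x y
  proof -
    have "F y - F x \<le> (\<Sum>a\<in>V. u y a * (y a - x a))" using assms by (auto simp: has_subgradient_def)
    also have "\<dots> \<le> (\<Sum>a\<in>V. \<bar>y a - x a\<bar>)"
    proof (rule sum_mono)
      fix a
      have "u y a * (y a - x a) \<le> u y a * \<bar>y a - x a\<bar>"
        using assms by (intro mult_left_mono) (auto simp: has_subgradient_def)
      also have "\<dots> \<le> 1 * \<bar>y a - x a\<bar>"
        using assms by (intro mult_right_mono) (auto simp: has_subgradient_def)
      finally show "u y a * (y a - x a) \<le> \<bar>y a - x a\<bar>" by simp
    qed
    finally show ?thesis .
  qed
  from this[of y x] this[of x y] show ?thesis by (simp add: abs_minus_commute abs_le_iff)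
qed

lemma subgradient_integrable:
  assumes "has_subgradient V F u" shows "integrable P F"
proof (rule Bochner_Integration.integrable_bound)
  show "integrable P (\<lambda>\<omega>. \<bar>F (\<lambda>_. 0)\<bar> + (\<Sum>a\<in>V. \<bar>\<omega> a\<bar>))" by simp
  show "F \<in> borel_measurable P" using assms by (simp add: has_subgradient_def)
  have "\<bar>F \<omega>\<bar> \<le> \<bar>F (\<lambda>_. 0)\<bar> + (\<Sum>a\<in>V. \<bar>\<omega> a\<bar>)" for \<omega>
    using subgradient_lipschitz[OF assms, of \<omega> "\<lambda>_. 0"] by simp
  then show "AE \<omega> in P. norm (F \<omega>) \<le> norm (\<bar>F (\<lambda>_. 0)\<bar> + (\<Sum>a\<in>V. \<bar>\<omega> a\<bar>))"
    by (intro AE_I2) (simp add: abs_le_iff)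
qed

abbreviation abs_moment :: "nat set \<Rightarrow> ennreal" where
  "abs_moment V \<equiv> (\<integral>\<^sup>+\<omega>. ennreal (exp (\<Sum>a\<in>V. \<bar>\<omega> a\<bar>)) \<partial>P)"

text \<open>The value does not matter, since this moment will enter with a factor of order
  \<open>1 / K\<close>; comparison with single coordinates is therefore enough.\<close>

lemma exp_abs_sum_finite:
  assumes V: "finite V" shows "abs_moment V < \<infinity>"
proof (cases "V = {}")
  case True
  then show ?thesis by (simp add: emeasure_space_1[simplified])
next
  case False
  let ?n = "real (card V)"
  have "ennreal (exp (\<Sum>a\<in>V. \<bar>\<omega> a\<bar>)) \<le> (\<Sum>a\<in>V. ennreal (exp (lin (\<lambda>_. ?n) {a} \<omega>)) + ennreal (exp (lin (\<lambda>_. - ?n) {a} \<omega>)))" for \<omega> :: "nat \<Rightarrow> real"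
  proof -
    have "exp (\<Sum>a\<in>V. \<bar>\<omega> a\<bar>) \<le> (\<Sum>a\<in>V. exp (?n * \<bar>\<omega> a\<bar>))"
      by (rule exp_sum_le_sum_exp[OF V False])
    also have "\<dots> \<le> (\<Sum>a\<in>V. exp (?n * \<omega> a) + exp (- ?n * \<omega> a))"
      by (intro sum_mono) (auto simp: abs_if)
    finally have "ennreal (exp (\<Sum>a\<in>V. \<bar>\<omega> a\<bar>)) \<le> ennreal (\<Sum>a\<in>V. exp (?n * \<omega> a) + exp (- ?n * \<omega> a))"
      by (rule ennreal_leI)
    then show ?thesis by (simp add: sum_ennreal[symmetric] ennreal_plus lin_def)
  qed
  then have "abs_moment V
      \<le> (\<integral>\<^sup>+\<omega>. (\<Sum>a\<in>V. ennreal (exp (lin (\<lambda>_. ?n) {a} \<omega>)) + ennreal (exp (lin (\<lambda>_. - ?n) {a} \<omega>))) \<partial>P)"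
    by (intro nn_integral_mono)
  also have "\<dots> = (\<Sum>a\<in>V. (\<integral>\<^sup>+\<omega>. ennreal (exp (lin (\<lambda>_. ?n) {a} \<omega>)) \<partial>P) + (\<integral>\<^sup>+\<omega>. ennreal (exp (lin (\<lambda>_. - ?n) {a} \<omega>)) \<partial>P))"
    by (subst nn_integral_sum) (auto intro!: sum.cong nn_integral_add)
  also have "\<dots> < \<infinity>" using V by (simp add: linear_exp)
  finally show ?thesis .
qed

text \<open>The subgradient is taken at the unrotated point \<open>x\<close>, so it is independent
  of \<open>y\<close>. For fixed \<open>x\<close> the increment is at most a linear form in
  \<open>y\<close>, with coefficients bounded by \<open>\<bar>\<tau> * sin \<delta>\<bar>\<close>,
  plus a drift with factor \<open>1 - cos \<delta>\<close>, which is quadratic in the angle.\<close>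

lemma rotation_step_bound:
  assumes V: "finite V" and F: "has_subgradient V F u" and \<tau>: "0 \<le> \<tau>"
  shows "(\<integral>\<^sup>+z. ennreal (exp (\<tau> * (F (fst z) - F (fst (rotate (- \<delta>) z))))) \<partial>(P \<Otimes>\<^sub>M P))
    \<le> (\<integral>\<^sup>+\<omega>. ennreal (exp (\<tau> * (1 - cos \<delta>) * (\<Sum>a\<in>V. \<bar>\<omega> a\<bar>))) \<partial>P)
       * ennreal (exp ((\<tau> * sin \<delta>)\<^sup>2 * (covariance_bound * card V) / 2))"
proof -
  have Fm [measurable]: "F \<in> borel_measurable P" and um [measurable]: "\<And>a. (\<lambda>\<omega>. u \<omega> a) \<in> borel_measurable P"
    and u01: "\<And>\<omega> a. 0 \<le> u \<omega> a" "\<And>\<omega> a. u \<omega> a \<le> 1"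
    and sub: "\<And>x y. F y - F x \<le> (\<Sum>a\<in>V. u y a * (y a - x a))"
    using F by (auto simp: has_subgradient_def)
  let ?a = "\<tau> * (1 - cos \<delta>)" and ?C = "ennreal (exp ((\<tau> * sin \<delta>)\<^sup>2 * (covariance_bound * card V) / 2))"
  let ?c = "\<lambda>x a. \<tau> * sin \<delta> * u x a"
  have a0: "0 \<le> ?a" using \<tau> by simp
  have pw: "\<tau> * (F x - F (fst (rotate (- \<delta>) (x, y)))) \<le> ?a * (\<Sum>a\<in>V. \<bar>x a\<bar>) + lin (?c x) V y" for x y
  proof -
    have "F x - F (fst (rotate (- \<delta>) (x, y))) \<le> (\<Sum>a\<in>V. u x a * (x a - (cos \<delta> * x a - sin \<delta> * y a)))"
      using sub[of x "fst (rotate (- \<delta>) (x, y))"] by (simp add: rotate_def)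
    also have "\<dots> = (1 - cos \<delta>) * (\<Sum>a\<in>V. u x a * x a) + (\<Sum>a\<in>V. sin \<delta> * u x a * y a)"
      by (simp add: sum_distrib_left sum.distrib[symmetric] algebra_simps)
    also have "\<dots> \<le> (1 - cos \<delta>) * (\<Sum>a\<in>V. \<bar>x a\<bar>) + (\<Sum>a\<in>V. sin \<delta> * u x a * y a)"
    proof (intro add_right_mono mult_left_mono sum_mono)
      fix a
      have "u x a * x a \<le> u x a * \<bar>x a\<bar>" using u01 by (intro mult_left_mono) auto
      also have "\<dots> \<le> 1 * \<bar>x a\<bar>" using u01 by (intro mult_right_mono) auto
      finally show "u x a * x a \<le> \<bar>x a\<bar>" by simp
    qed simp
    finally have "\<tau> * (F x - F (fst (rotate (- \<delta>) (x, y))))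
        \<le> \<tau> * ((1 - cos \<delta>) * (\<Sum>a\<in>V. \<bar>x a\<bar>) + (\<Sum>a\<in>V. sin \<delta> * u x a * y a))"
      by (rule mult_left_mono[OF _ \<tau>])
    then show ?thesis by (simp add: lin_def sum_distrib_left algebra_simps)
  qed
  have "(\<integral>\<^sup>+z. ennreal (exp (\<tau> * (F (fst z) - F (fst (rotate (- \<delta>) z))))) \<partial>(P \<Otimes>\<^sub>M P))
      = (\<integral>\<^sup>+x. \<integral>\<^sup>+y. ennreal (exp (\<tau> * (F x - F (fst (rotate (- \<delta>) (x, y)))))) \<partial>P \<partial>P)"
    by (subst nn_integral_fst[symmetric]) simp_all
  also have "\<dots> \<le> (\<integral>\<^sup>+x. ennreal (exp (?a * (\<Sum>a\<in>V. \<bar>x a\<bar>))) * ?C \<partial>P)"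
  proof (rule nn_integral_mono)
    fix x
    have "(\<integral>\<^sup>+y. ennreal (exp (\<tau> * (F x - F (fst (rotate (- \<delta>) (x, y)))))) \<partial>P)
        \<le> (\<integral>\<^sup>+y. ennreal (exp (?a * (\<Sum>a\<in>V. \<bar>x a\<bar>))) * ennreal (exp (lin (?c x) V y)) \<partial>P)"
      using pw by (intro nn_integral_mono) (simp add: ennreal_mult[symmetric] exp_add[symmetric] ennreal_leI)
    also have "\<dots> = ennreal (exp (?a * (\<Sum>a\<in>V. \<bar>x a\<bar>))) * (\<integral>\<^sup>+y. ennreal (exp (lin (?c x) V y)) \<partial>P)"
      by (rule nn_integral_cmult) simp
    also have "\<dots> \<le> ennreal (exp (?a * (\<Sum>a\<in>V. \<bar>x a\<bar>))) * ?C"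
    proof (rule mult_left_mono)
      have "\<bar>?c x a\<bar> \<le> \<bar>\<tau> * sin \<delta>\<bar>" for a
        using u01[of x a] mult_left_mono[of "u x a" 1 "\<bar>\<tau> * sin \<delta>\<bar>"] by (simp add: abs_mult)
      from linear_exp_le[OF V this] show "(\<integral>\<^sup>+y. ennreal (exp (lin (?c x) V y)) \<partial>P) \<le> ?C"
        by (simp only: power2_abs)
    qed simp
    finally show "(\<integral>\<^sup>+y. ennreal (exp (\<tau> * (F x - F (fst (rotate (- \<delta>) (x, y)))))) \<partial>P)
        \<le> ennreal (exp (?a * (\<Sum>a\<in>V. \<bar>x a\<bar>))) * ?C" .
  qed
  also have "\<dots> = (\<integral>\<^sup>+x. ennreal (exp (?a * (\<Sum>a\<in>V. \<bar>x a\<bar>))) \<partial>P) * ?C"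
    by (rule nn_integral_multc) simp
  finally show ?thesis .
qed

text \<open>Jensen's inequality replaces the mean by an independent copy, and the quarter turn from
  one copy to the other is cut into \<open>K\<close> rotations. The exponential of the sum of
  increments is at most an average of exponentials with an extra factor \<open>K\<close>, and
  rotation invariance gives all of them the same bound. The factor is harmless:
  \<open>K * sin \<delta>\<close> stays bounded and \<open>K * (1 - cos \<delta>)\<close> is of
  order \<open>1 / K\<close>.\<close>

lemma concentration_steps:
  assumes V: "finite V" and F: "has_subgradient V F u" and s: "0 \<le> s" and K: "1 \<le> K" "2 * s \<le> real K"
  shows "(\<integral>\<^sup>+\<omega>. ennreal (exp (- s * (F \<omega> - (\<integral>\<omega>. F \<omega> \<partial>P)))) \<partial>P)
    \<le> (1 + ennreal (2 * s / real K) * abs_moment V)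
       * ennreal (exp (2 * s\<^sup>2 * (covariance_bound * card V)))"
proof -
  interpret PP: pair_prob_space P P ..
  let ?PP = "P \<Otimes>\<^sub>M P" and ?m = "\<integral>\<omega>. F \<omega> \<partial>P"
  have Fm [measurable]: "F \<in> borel_measurable P" using F by (simp add: has_subgradient_def)
  define \<delta> where "\<delta> = pi / (2 * real K)"
  define X where "X k z = F (fst (rotate (real k * \<delta>) z))" for k z
  let ?B = "(1 + ennreal (2 * s / real K) * abs_moment V)
       * ennreal (exp (2 * s\<^sup>2 * (covariance_bound * card V)))"
  have [measurable]: "X k \<in> borel_measurable ?PP" for k unfolding X_def by measurable
  have \<delta>0: "0 \<le> \<delta>" unfolding \<delta>_def by simp
  \<comment> \<open>Crude bounds on pi produce the constants: \<open>pi\<^sup>2 / 8 \<le> 2\<close>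
    in the drift, and \<open>K * \<delta> = pi / 2 \<le> 2\<close> in the Gaussian exponent.\<close>
  have pi2: "pi\<^sup>2 \<le> 16" using power_mono[of pi 4 2] pi_less_4 by simp
  have K\<delta>: "real K * \<delta> = pi / 2" unfolding \<delta>_def using K by simp
  have step: "(\<integral>\<^sup>+z. ennreal (exp (real K * (s * (X (Suc k) z - X k z)))) \<partial>?PP) \<le> ?B" for k
  proof -
    \<comment> \<open>After a change of variables by the later rotation, the later point is the
      unrotated one, where the subgradient has to be taken.\<close>
    have unrot: "rotate (- \<delta>) (rotate (real (Suc k) * \<delta>) z) = rotate (real k * \<delta>) z" for z
      by (simp add: rotate_add algebra_simps)
    let ?G = "\<lambda>z. ennreal (exp (real K * s * (F (fst z) - F (fst (rotate (- \<delta>) z)))))"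
    have "(\<integral>\<^sup>+z. ennreal (exp (real K * (s * (X (Suc k) z - X k z)))) \<partial>?PP) = (\<integral>\<^sup>+z. ?G (rotate (real (Suc k) * \<delta>) z) \<partial>?PP)"
      unfolding X_def unrot by (simp add: mult.assoc)
    also have "\<dots> = (\<integral>\<^sup>+z. ?G z \<partial>distr ?PP ?PP (rotate (real (Suc k) * \<delta>)))"
      by (rule nn_integral_distr[symmetric]) measurable
    also have "\<dots> = (\<integral>\<^sup>+z. ?G z \<partial>?PP)" by (simp only: rotation_invariance)
    also have "\<dots> \<le> (\<integral>\<^sup>+\<omega>. ennreal (exp (real K * s * (1 - cos \<delta>) * (\<Sum>a\<in>V. \<bar>\<omega> a\<bar>))) \<partial>P)
       * ennreal (exp ((real K * s * sin \<delta>)\<^sup>2 * (covariance_bound * card V) / 2))"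
      using s by (intro rotation_step_bound[OF V F]) simp
    also have "\<dots> \<le> ?B"
    proof (intro mult_mono ennreal_leI)
      have "1 - cos \<delta> \<le> \<delta>\<^sup>2 / 2"
      proof -
        have "cos \<delta> = 1 - 2 * (sin (\<delta> / 2))\<^sup>2" using cos_double_sin[of "\<delta> / 2"] by simp
        moreover have "(sin (\<delta> / 2))\<^sup>2 \<le> (\<delta> / 2)\<^sup>2"
          by (rule abs_le_square_iff[THEN iffD1, OF abs_sin_x_le_abs_x])
        ultimately show ?thesis by (simp add: power_divide)
      qed
      then have "real K * s * (1 - cos \<delta>) \<le> real K * s * (\<delta>\<^sup>2 / 2)"
        using s by (intro mult_left_mono) auto
      also have "\<dots> = s * pi\<^sup>2 / (8 * real K)"
        unfolding \<delta>_def using K by (simp add: field_simps power2_eq_square)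
      also have "\<dots> \<le> s * 16 / (8 * real K)"
        using s pi2 K by (intro divide_right_mono mult_left_mono) auto
      finally have c: "real K * s * (1 - cos \<delta>) \<le> 2 * s / real K" by simp
      have "(\<integral>\<^sup>+\<omega>. ennreal (exp (real K * s * (1 - cos \<delta>) * (\<Sum>a\<in>V. \<bar>\<omega> a\<bar>))) \<partial>P)
         \<le> (\<integral>\<^sup>+\<omega>. 1 + ennreal (2 * s / real K) * ennreal (exp (\<Sum>a\<in>V. \<bar>\<omega> a\<bar>)) \<partial>P)"
      proof (rule nn_integral_mono)
        fix \<omega> :: "nat \<Rightarrow> real"
        let ?y = "\<Sum>a\<in>V. \<bar>\<omega> a\<bar>"
        have "exp (real K * s * (1 - cos \<delta>) * ?y) \<le> exp (2 * s / real K * ?y)"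
          using c by (simp only: exp_le_cancel_iff) (intro mult_right_mono sum_nonneg; simp)
        also have "\<dots> \<le> 1 + 2 * s / real K * exp ?y"
          using s K by (intro exp_scaled_le) (auto simp: divide_le_eq)
        finally have "ennreal (exp (real K * s * (1 - cos \<delta>) * ?y)) \<le> ennreal (1 + 2 * s / real K * exp ?y)"
          by (rule ennreal_leI)
        also have "\<dots> = 1 + ennreal (2 * s / real K) * ennreal (exp ?y)"
          using s by (intro ennreal_one_plus_mult) auto
        finally show "ennreal (exp (real K * s * (1 - cos \<delta>) * ?y)) \<le> 1 + ennreal (2 * s / real K) * ennreal (exp ?y)" .
      qed
      also have "\<dots> = 1 + ennreal (2 * s / real K) * abs_moment V"
        by (simp add: nn_integral_add nn_integral_cmult emeasure_space_1[simplified])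
      finally show "(\<integral>\<^sup>+\<omega>. ennreal (exp (real K * s * (1 - cos \<delta>) * (\<Sum>a\<in>V. \<bar>\<omega> a\<bar>))) \<partial>P)
         \<le> 1 + ennreal (2 * s / real K) * abs_moment V" .
      have "\<bar>real K * sin \<delta>\<bar> \<le> \<bar>real K * \<delta>\<bar>"
        unfolding abs_mult by (intro mult_left_mono abs_sin_x_le_abs_x) simp
      also have "\<dots> \<le> \<bar>2 :: real\<bar>" unfolding K\<delta> using pi_less_4 pi_gt_zero by simp
      finally have "(real K * sin \<delta>)\<^sup>2 \<le> 2\<^sup>2" by (simp only: abs_le_square_iff)
      then have "s\<^sup>2 * (real K * sin \<delta>)\<^sup>2 \<le> s\<^sup>2 * 4" by (intro mult_left_mono) auto
      then have "(real K * s * sin \<delta>)\<^sup>2 \<le> 4 * s\<^sup>2"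
        by (simp add: power_mult_distrib mult_ac)
      then have "(real K * s * sin \<delta>)\<^sup>2 * (covariance_bound * card V) \<le> 4 * s\<^sup>2 * (covariance_bound * card V)"
        using covariance_bound_nonneg by (intro mult_right_mono) auto
      then show "exp ((real K * s * sin \<delta>)\<^sup>2 * (covariance_bound * card V) / 2) \<le> exp (2 * s\<^sup>2 * (covariance_bound * card V))"
        by (simp add: mult.assoc)
    qed auto
    finally show ?thesis .
  qed
  have tele: "s * (F (snd z) - F (fst z)) = (\<Sum>k<K. s * (X (Suc k) z - X k z))" for z
  proof -
    have "X K z = F (snd z)" "X 0 z = F (fst z)"
      unfolding X_def K\<delta> by (cases z; simp add: rotate_def)+
    then show ?thesis
      using sum_lessThan_telescope[of "\<lambda>k. X k z" K] by (simp add: sum_distrib_left[symmetric])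
  qed
  have "(\<integral>\<^sup>+\<omega>. ennreal (exp (- s * (F \<omega> - ?m))) \<partial>P) \<le> (\<integral>\<^sup>+x. \<integral>\<^sup>+y. ennreal (exp (s * (F y - F x))) \<partial>P \<partial>P)"
  proof (rule nn_integral_mono)
    fix x
    have "integrable P (\<lambda>y. s * (F y - F x))" using subgradient_integrable[OF F] by simp
    from exp_mean_le[OF this] show "ennreal (exp (- s * (F x - ?m))) \<le> (\<integral>\<^sup>+y. ennreal (exp (s * (F y - F x))) \<partial>P)"
      using subgradient_integrable[OF F] by (simp add: prob_space[simplified] algebra_simps)
  qed
  also have "\<dots> = (\<integral>\<^sup>+z. ennreal (exp (s * (F (snd z) - F (fst z)))) \<partial>?PP)"
    by (subst nn_integral_fst[symmetric]) simp_all
  also have "\<dots> \<le> (\<integral>\<^sup>+z. ennreal (1 / real K) * (\<Sum>k<K. ennreal (exp (real K * (s * (X (Suc k) z - X k z))))) \<partial>?PP)"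
  proof (rule nn_integral_mono)
    fix z
    have "exp (s * (F (snd z) - F (fst z))) \<le> 1 / real K * (\<Sum>k<K. exp (real K * (s * (X (Suc k) z - X k z))))"
      unfolding tele using exp_sum_le_average[OF K(1)] by simp
    then have "ennreal (exp (s * (F (snd z) - F (fst z)))) \<le> ennreal (1 / real K * (\<Sum>k<K. exp (real K * (s * (X (Suc k) z - X k z)))))"
      by (rule ennreal_leI)
    also have "\<dots> = ennreal (1 / real K) * (\<Sum>k<K. ennreal (exp (real K * (s * (X (Suc k) z - X k z)))))"
      by (subst ennreal_mult) (auto intro!: sum_nonneg)
    finally show "ennreal (exp (s * (F (snd z) - F (fst z)))) \<le> \<dots>" .
  qed
  also have "\<dots> = ennreal (1 / real K) * (\<Sum>k<K. \<integral>\<^sup>+z. ennreal (exp (real K * (s * (X (Suc k) z - X k z)))) \<partial>?PP)"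
  proof -
    have "(\<Sum>k<K. \<integral>\<^sup>+z. ennreal (exp (real K * (s * (X (Suc k) z - X k z)))) \<partial>?PP)
        = (\<integral>\<^sup>+z. (\<Sum>k<K. ennreal (exp (real K * (s * (X (Suc k) z - X k z))))) \<partial>?PP)"
      by (rule nn_integral_sum[symmetric]) measurable
    then show ?thesis by (simp only:) (rule nn_integral_cmult, measurable)
  qed
  also have "\<dots> \<le> ennreal (1 / real K) * (\<Sum>k<K. ?B)"
    by (intro mult_left_mono sum_mono step) auto
  also have "\<dots> = ?B"
  proof -
    have "ennreal (1 / real K) * (of_nat K * b) = b" for b
    proof -
      have "ennreal (1 / real K) * of_nat K = 1"
        using K by (simp add: ennreal_of_nat_eq_real_of_nat ennreal_mult[symmetric])
      then show ?thesis by (simp add: mult.assoc[symmetric])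
    qed
    then show ?thesis by simp
  qed
  finally show ?thesis .
qed

text \<open>This is the Maurey--Pisier argument with the rotation split into \<open>K\<close> small steps.\<close>

theorem concentration:
  assumes V: "finite V" and F: "has_subgradient V F u" and s: "0 \<le> s"
  shows "(\<integral>\<^sup>+\<omega>. ennreal (exp (- s * (F \<omega> - (\<integral>\<omega>. F \<omega> \<partial>P)))) \<partial>P) \<le> ennreal (exp (2 * s\<^sup>2 * (covariance_bound * card V)))"
proof -
  let ?L = "\<integral>\<^sup>+\<omega>. ennreal (exp (- s * (F \<omega> - (\<integral>\<omega>. F \<omega> \<partial>P)))) \<partial>P"
  let ?C = "exp (2 * s\<^sup>2 * (covariance_bound * card V))"
  \<comment> \<open>Since this moment is finite, the drift factor tends to 1 as \<open>K\<close>
    grows.\<close>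
  obtain B where B: "abs_moment V = ennreal B" "0 \<le> B"
    using exp_abs_sum_finite[OF V] by (auto simp: less_top_ennreal)
  have "(\<lambda>K. (1 + 2 * s / real K * B) * ?C) \<longlonglongrightarrow> (1 + 0 * B) * ?C"
    by (intro tendsto_intros lim_const_over_n)
  then have lim: "(\<lambda>K. ennreal ((1 + 2 * s / real K * B) * ?C)) \<longlonglongrightarrow> ennreal ?C" by (simp add: tendsto_ennrealI)
  have "\<exists>N. \<forall>K\<ge>N. ?L \<le> ennreal ((1 + 2 * s / real K * B) * ?C)"
  proof (intro exI allI impI)
    fix K assume "max 1 (nat \<lceil>2 * s\<rceil>) \<le> K"
    then have K: "1 \<le> K" "2 * s \<le> real K" by linarith+
    have "(1 + ennreal (2 * s / real K) * ennreal B) * ennreal ?C = ennreal ((1 + 2 * s / real K * B) * ?C)"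
      using s B(2) ennreal_one_plus_mult[of "2 * s / real K" B]
        ennreal_mult[of "1 + 2 * s / real K * B" ?C] by simp
    then show "?L \<le> ennreal ((1 + 2 * s / real K * B) * ?C)"
      using concentration_steps[OF V F s K] unfolding B(1) by simp
  qed
  then show ?thesis by (rule LIMSEQ_le_const[OF lim])
qed

end

section \<open>The renewal process\<close>

lemma nth_sorted_list_of_set_less_iff:
  assumes "i < card A" "j < card A"
  shows "sorted_list_of_set A ! i < sorted_list_of_set A ! j \<longleftrightarrow> i < (j :: nat)"
  using assms sorted_wrt_nth_less[of "(<)" "sorted_list_of_set A"] strict_sorted_list_of_set[of A]
  by (metis length_sorted_list_of_set linorder_neqE_nat less_asym less_irrefl)

text \<open>Links the unordered set of gaps with the ordered increments: the gap that ends at the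
  point with list index \<open>i\<close> is the one produced by \<open>T i\<close>.\<close>

lemma gap_weight_sorted:
  assumes A: "finite A"
  defines "xs \<equiv> sorted_list_of_set A"
  shows "gap_weight f (gaps A) = (\<Prod>i\<in>{1..card A - 1}. f (xs ! i - xs ! (i - 1)))"
proof -
  have len: "length xs = card A" and set: "set xs = A" using A by (simp_all add: xs_def)
  note mono = nth_sorted_list_of_set_less_iff[of _ A, folded xs_def]
  have inj: "i = j" if "xs ! i = xs ! j" "i < card A" "j < card A" for i j
    using that mono[of i j] mono[of j i] by (metis linorder_neqE_nat less_irrefl)
  have img: "gaps A = (\<lambda>i. (xs ! (i - 1), xs ! i)) ` {1..card A - 1}"
  proof (intro equalityI subsetI)
    fix e assume "e \<in> gaps A"
    then obtain a b where e: "e = (a, b)" "a \<in> A" "b \<in> A" "a < b" "A \<inter> {a<..<b} = {}" by (auto simp: gaps_def)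
    obtain i where i: "i < card A" "xs ! i = a" using e set len by (metis in_set_conv_nth)
    obtain j where j: "j < card A" "xs ! j = b" using e set len by (metis in_set_conv_nth)
    have "i < j" using mono[OF i(1) j(1)] i j e by simp
    moreover have "\<not> Suc i < j"
    proof
      assume ij: "Suc i < j"
      then have "xs ! Suc i \<in> A" using j set len nth_mem[of "Suc i" xs] by auto
      moreover have "a < xs ! Suc i" "xs ! Suc i < b" using mono[of i "Suc i"] mono[of "Suc i" j] i j ij by auto
      ultimately show False using e(5) by auto
    qed
    ultimately have "j = Suc i" by simp
    then show "e \<in> (\<lambda>i. (xs ! (i - 1), xs ! i)) ` {1..card A - 1}" using e i j by (intro image_eqI[of _ _ j]) auto
  next
    fix e assume "e \<in> (\<lambda>i. (xs ! (i - 1), xs ! i)) ` {1..card A - 1}"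
    then obtain j where j: "j \<in> {1..card A - 1}" "e = (xs ! (j - 1), xs ! j)" by blast
    define i where "i = j - 1"
    have "1 \<le> j" "j \<le> card A - 1" using j(1) by simp_all
    then have ji: "j = Suc i" "Suc i < card A" unfolding i_def by linarith+
    then have i: "Suc i < card A" "e = (xs ! i, xs ! Suc i)" using j(2) by simp_all
    have "\<not> (xs ! i < z \<and> z < xs ! Suc i)" if "z \<in> A" for z
    proof -
      obtain m where m: "m < card A" "xs ! m = z" using \<open>z \<in> A\<close> set len by (metis in_set_conv_nth)
      show ?thesis using mono[OF Suc_lessD[OF i(1)] m(1)] mono[OF m(1) i(1)] m(2) by linarith
    qed
    moreover have "xs ! i \<in> A" "xs ! Suc i \<in> A" using i(1) set len nth_mem[of i xs] nth_mem[of "Suc i" xs] by auto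
    moreover have "xs ! i < xs ! Suc i" using mono[OF Suc_lessD[OF i(1)] i(1)] by simp
    ultimately show "e \<in> gaps A" unfolding i(2) gaps_def by auto
  qed
  have "inj_on (\<lambda>i. (xs ! (i - 1), xs ! i)) {1..card A - 1}"
    by (auto simp: inj_on_def intro!: inj)
  then show ?thesis unfolding gap_weight_def img by (simp add: prod.reindex)
qed

locale renewal =
  fixes M :: "'a measure" and T :: "nat \<Rightarrow> 'a \<Rightarrow> nat" and \<alpha> :: real and l :: "real \<Rightarrow> real"
  assumes increments: "renewal_increments M T \<alpha> l"
begin

sublocale prob_space M using increments by (simp add: renewal_increments_def)

definition p :: "nat \<Rightarrow> real" where
  "p t = prob {x \<in> space M. T 1 x = t}"

sublocale positive_kernel p
proof
  show "0 < p t" if "1 \<le> t" for t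
    using increments that unfolding renewal_increments_def p_def by blast
  show "p t \<le> 1" for t by (simp add: p_def)
qed

lemma indep_increments: "indep_vars (\<lambda>_. count_space UNIV) T {1..}"
  using increments by (simp add: renewal_increments_def)

lemma increment_measurable: "1 \<le> i \<Longrightarrow> T i \<in> measurable M (count_space UNIV)"
  using indep_increments by (simp add: indep_vars_def)

lemma increment_ge_1: "1 \<le> i \<Longrightarrow> x \<in> space M \<Longrightarrow> 1 \<le> T i x"
  using increments by (simp add: renewal_increments_def)

lemma increment_prob:
  assumes "1 \<le> i" shows "prob (T i -` {t} \<inter> space M) = p t"
proof -
  have "prob (T i -` {t} \<inter> space M) = measure (distr M (count_space UNIV) (T i)) {t}"
    using increment_measurable[OF assms] by (simp add: measure_distr)
  also have "\<dots> = measure (distr M (count_space UNIV) (T 1)) {t}"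
    using increments assms unfolding renewal_increments_def by metis
  also have "\<dots> = p t"
    using increment_measurable[of 1] by (simp add: measure_distr p_def vimage_def Int_def conj_commute)
  finally show ?thesis .
qed

lemma renewal_time_simps [simp]: "renewal_time T 0 x = 0" "renewal_time T (Suc i) x = renewal_time T i x + T (Suc i) x"
  by (simp_all add: renewal_time_def)

lemma renewal_time_strict_mono:
  assumes "x \<in> space M" "i < j" shows "renewal_time T i x < renewal_time T j x"
proof (rule lift_Suc_mono_less[of "\<lambda>i. renewal_time T i x", OF _ assms(2)])
  show "renewal_time T n x < renewal_time T (Suc n) x" for n
    using increment_ge_1[of "Suc n" x] assms(1) by simp
qed

lemma renewal_time_less_iff: "x \<in> space M \<Longrightarrow> renewal_time T i x < renewal_time T j x \<longleftrightarrow> i < j"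
  using renewal_time_strict_mono by (metis linorder_neqE_nat less_asym less_irrefl)

lemma renewal_time_le_iff: "x \<in> space M \<Longrightarrow> renewal_time T i x \<le> renewal_time T j x \<longleftrightarrow> i \<le> j"
  using renewal_time_less_iff[of x j i] by (simp add: not_less[symmetric])

definition contact_set :: "nat \<Rightarrow> 'a \<Rightarrow> nat set" where
  "contact_set n x = {a \<in> {0..n}. a \<in> range (\<lambda>i. renewal_time T i x)}"

lemma renewal_time_measurable [measurable]: "renewal_time T i \<in> measurable M (count_space UNIV)"
proof (induction i)
  case 0
  then show ?case by (simp add: renewal_time_def[abs_def])
next
  case (Suc i)
  have [measurable]: "T (Suc i) \<in> measurable M (count_space UNIV)" by (rule increment_measurable) simp
  note [measurable] = Suc
  have "(\<lambda>x. renewal_time T i x + T (Suc i) x) \<in> measurable M (count_space UNIV)" by measurable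
  then show ?case by (simp add: fun_eq_iff[symmetric] cong: measurable_cong)
qed

lemma contact_sets [measurable]: "{x \<in> space M. a \<in> range (\<lambda>i. renewal_time T i x)} \<in> sets M"
proof -
  have "{x \<in> space M. a \<in> range (\<lambda>i. renewal_time T i x)} = {x \<in> space M. \<exists>i. renewal_time T i x = a}" by auto
  also have "\<dots> \<in> sets M" by measurable
  finally show ?thesis .
qed

lemma contact_set_measurable [measurable]: "contact_set n \<in> measurable M (count_space UNIV)"
proof -
  have "contact_set n \<in> measurable M (count_space (Pow {0..n}))"
  proof (subst measurable_count_space_eq2, simp, intro conjI ballI)
    show "contact_set n \<in> space M \<rightarrow> Pow {0..n}" by (auto simp: contact_set_def)
    fix A assume A: "A \<in> Pow {0..n}"
    define E where "E a = {x \<in> space M. a \<in> range (\<lambda>i. renewal_time T i x)}" for a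
    have E: "a \<in> contact_set n x \<longleftrightarrow> x \<in> E a" if "a \<in> {0..n}" "x \<in> space M" for a x
      using that unfolding contact_set_def E_def by blast
    have sub: "contact_set n x \<subseteq> {0..n}" for x unfolding contact_set_def by blast
    have "contact_set n x = A \<longleftrightarrow> (\<forall>a\<in>{0..n}. a \<in> contact_set n x \<longleftrightarrow> a \<in> A)" for x
      using sub[of x] A by blast
    then have "contact_set n -` {A} \<inter> space M = {x \<in> space M. \<forall>a\<in>{0..n}. (x \<in> E a) = (a \<in> A)}"
      using E by blast
    also have "\<dots> \<in> sets M"
    proof (rule sets.sets_Collect_finite_All)
      have Es: "E a \<in> sets M" "E a \<subseteq> space M" for a using contact_sets unfolding E_def by blast+
      show "{x \<in> space M. (x \<in> E a) = (a \<in> A)} \<in> sets M" for a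
      proof (cases "a \<in> A")
        case True
        then have "{x \<in> space M. (x \<in> E a) = (a \<in> A)} = E a" using Es(2)[of a] by blast
        then show ?thesis using Es(1)[of a] by simp
      next
        case False
        then have "{x \<in> space M. (x \<in> E a) = (a \<in> A)} = space M - E a" by blast
        then show ?thesis using Es(1)[of a] by simp
      qed
    qed simp
    finally show "contact_set n -` {A} \<inter> space M \<in> sets M" .
  qed
  from measurable_compose[OF this, of "\<lambda>A. A" "count_space UNIV"] show ?thesis by simp
qed

text \<open>Renewal times increase strictly from 0, so seeing exactly \<open>A\<close> up to
  \<open>n\<close> prescribes the first \<open>card A - 1\<close> increments and nothing beyond: the
  last of them lands on \<open>n\<close>, which belongs to \<open>A\<close>.\<close>

lemma contact_set_eq_iff:
  assumes x: "x \<in> space M" and A: "A \<in> paths 0 n"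
  defines "xs \<equiv> sorted_list_of_set A"
  shows "contact_set n x = A \<longleftrightarrow> (\<forall>i\<in>{1..card A - 1}. T i x = xs ! i - xs ! (i - 1))"
proof -
  have fin: "finite A" by (rule finite_path[OF A])
  have A0: "0 \<in> A" "n \<in> A" "A \<subseteq> {0..n}" using A by (auto simp: paths_def)
  have len: "length xs = card A" and set: "set xs = A" using fin by (simp_all add: xs_def)
  have cpos: "0 < card A" using A0 fin by (auto simp: card_gt_0_iff)
  note mono = nth_sorted_list_of_set_less_iff[of _ A, folded xs_def]
  have first: "xs ! 0 = 0"
  proof -
    obtain i where "i < card A" "xs ! i = 0" using A0(1) set len by (metis in_set_conv_nth)
    then show ?thesis using mono[of 0 i] cpos by (cases i) auto
  qed
  have last: "xs ! (card A - 1) = n"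
  proof -
    obtain i where i: "i < card A" "xs ! i = n" using A0(2) set len by (metis in_set_conv_nth)
    have "xs ! (card A - 1) \<le> n" using A0(3) set len cpos nth_mem[of "card A - 1" xs] by auto
    then have "\<not> i < card A - 1" using mono[of i "card A - 1"] i cpos by auto
    then have "i = card A - 1" using i by simp
    then show ?thesis using i by simp
  qed
  let ?S = "\<lambda>i. renewal_time T i x"
  have times: "(\<forall>i\<in>{1..card A - 1}. T i x = xs ! i - xs ! (i - 1)) \<longleftrightarrow> (\<forall>i\<le>card A - 1. ?S i = xs ! i)"
  proof
    assume *: "\<forall>i\<in>{1..card A - 1}. T i x = xs ! i - xs ! (i - 1)"
    have "?S i = xs ! i" if "i \<le> card A - 1" for i
      using that
    proof (induction i)
      case (Suc i)
      moreover have "i < card A" "Suc i < card A" using Suc.prems cpos by auto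
      ultimately show ?case using * mono[of i "Suc i"] by auto
    qed (simp add: first)
    then show "\<forall>i\<le>card A - 1. ?S i = xs ! i" by blast
  next
    assume *: "\<forall>i\<le>card A - 1. ?S i = xs ! i"
    have "T i x = xs ! i - xs ! (i - 1)" if "i \<in> {1..card A - 1}" for i
    proof -
      define k where "k = i - 1"
      then have k: "i = Suc k" "Suc k \<le> card A - 1" "k \<le> card A - 1" using that by auto
      have "?S (Suc k) = xs ! Suc k" "?S k = xs ! k" using * k by blast+
      then show ?thesis using k(1) renewal_time_simps(2)[of k x] by simp
    qed
    then show "\<forall>i\<in>{1..card A - 1}. T i x = xs ! i - xs ! (i - 1)" by blast
  qed
  have "contact_set n x = A \<longleftrightarrow> (\<forall>i\<le>card A - 1. ?S i = xs ! i)"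
  proof
    assume *: "\<forall>i\<le>card A - 1. ?S i = xs ! i"
    show "contact_set n x = A"
    proof (intro equalityI subsetI)
      fix a assume "a \<in> contact_set n x"
      then obtain j where j: "a = ?S j" "a \<le> n" by (auto simp: contact_set_def)
      have "?S (card A - 1) = n" using * last by simp
      then have "j \<le> card A - 1" using j renewal_time_le_iff[OF x] by metis
      then show "a \<in> A" using * j set len cpos nth_mem[of j xs] by auto
    next
      fix a assume a: "a \<in> A"
      then obtain i where i: "i < card A" "xs ! i = a" using set len by (metis in_set_conv_nth)
      then have "?S i = a" using * by auto
      then show "a \<in> contact_set n x" using a A0(3) by (auto simp: contact_set_def)
    qed
  next
    assume *: "contact_set n x = A"
    \<comment> \<open>The next renewal time cannot exceed the next point of \<open>A\<close>, which
      is itself a renewal time, and cannot precede it, because it lies in \<open>A\<close>.\<close>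
    have "?S i = xs ! i" if "i \<le> card A - 1" for i
      using that
    proof (induction i)
      case (Suc i)
      have ic: "i < card A" "Suc i < card A" using Suc.prems cpos by auto
      have IH: "?S i = xs ! i" using Suc by simp
      have "xs ! Suc i \<in> A" using ic set len nth_mem[of "Suc i" xs] by auto
      then obtain j where j: "xs ! Suc i = ?S j" "?S j \<le> n" using * by (auto simp: contact_set_def)
      have "?S i < ?S j" using IH j mono[OF ic] by simp
      then have "Suc i \<le> j" using renewal_time_less_iff[OF x] by simp
      then have 1: "?S (Suc i) \<le> xs ! Suc i" using j renewal_time_le_iff[OF x] by metis
      then have "?S (Suc i) \<in> A" using * j unfolding contact_set_def by (metis (mono_tags, lifting) atLeastAtMost_iff le0 mem_Collect_eq order_trans rangeI)
      then obtain m where m: "m < card A" "xs ! m = ?S (Suc i)" using set len by (metis in_set_conv_nth)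
      have "xs ! i < xs ! m" using m IH renewal_time_strict_mono[OF x, of i "Suc i"] by simp
      then have "Suc i \<le> m" using mono[OF ic(1) m(1)] by simp
      then have "xs ! Suc i \<le> xs ! m" using mono[OF m(1) ic(2)] by (simp add: not_less[symmetric])
      then show ?case using 1 m by simp
    qed (simp add: first)
    then show "\<forall>i\<le>card A - 1. ?S i = xs ! i" by blast
  qed
  then show ?thesis using times by simp
qed

section \<open>Gibbs averages as finite sums over paths\<close>

abbreviation contact_event :: "nat \<Rightarrow> nat set \<Rightarrow> 'a set" where
  "contact_event n A \<equiv> {x \<in> space M. contact_set n x = A}"

lemma contact_set_prob:
  assumes A: "A \<in> paths 0 n" and n: "1 \<le> n"
  shows "prob (contact_event n A) = gap_weight p (gaps A)"
proof -
  define xs where "xs = sorted_list_of_set A"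
  have fin: "finite A" by (rule finite_path[OF A])
  have "{0, n} \<subseteq> A" using A by (auto simp: paths_def)
  then have "2 \<le> card A" using card_mono[OF fin, of "{0, n}"] n by simp
  then have ne: "{1..card A - 1} \<noteq> {}" by simp
  have "contact_event n A = {x \<in> space M. \<forall>i\<in>{1..card A - 1}. T i x = xs ! i - xs ! (i - 1)}"
    using contact_set_eq_iff[OF _ A] by (auto simp: xs_def)
  also have "\<dots> = (\<Inter>i\<in>{1..card A - 1}. T i -` {xs ! i - xs ! (i - 1)} \<inter> space M)"
    using ne by auto
  finally have "prob (contact_event n A) = prob (\<Inter>i\<in>{1..card A - 1}. T i -` {xs ! i - xs ! (i - 1)} \<inter> space M)"
    by simp
  also have "\<dots> = (\<Prod>i\<in>{1..card A - 1}. prob (T i -` {xs ! i - xs ! (i - 1)} \<inter> space M))"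
    using ne by (intro indep_varsD[OF indep_increments]) auto
  also have "\<dots> = (\<Prod>i\<in>{1..card A - 1}. p (xs ! i - xs ! (i - 1)))"
    by (intro prod.cong refl increment_prob) auto
  finally show ?thesis using gap_weight_sorted[OF fin] by (simp add: xs_def)
qed

text \<open>The factor \<open>contact T n x\<close> keeps only paths that end at \<open>n\<close>.
  Site 0 collects no reward in the model and the reward at \<open>n\<close> is common to all these
  paths, so it splits off and the rewards at inner sites remain.\<close>

lemma boltzmann_weight_eq:
  assumes n: "1 \<le> n" and x: "x \<in> space M"
  shows "boltzmann_weight T n h \<omega> x * g (contact_set n x) = exp (h + \<omega> n) *
    (\<Sum>A\<in>paths 0 n. indicator (contact_event n A) x * (exp (\<Sum>a\<in>A - {0, n}. h + \<omega> a) * g A))"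
proof -
  let ?C = "contact_set n x"
  have mem: "a \<in> ?C \<longleftrightarrow> contact T a x = 1" "a \<notin> ?C \<longleftrightarrow> contact T a x = 0" if "a \<le> n" for a
    using that by (auto simp: contact_set_def contact_def of_bool_def)
  have C0: "0 \<in> ?C" unfolding contact_set_def by (auto intro: image_eqI[of _ _ 0])
  have Csub: "?C \<subseteq> {0..n}" by (auto simp: contact_set_def)
  show ?thesis
  proof (cases "n \<in> ?C")
    case False
    then have "\<not> (\<exists>A\<in>paths 0 n. ?C = A)" by (auto simp: paths_def)
    then have "(\<Sum>A\<in>paths 0 n. indicator (contact_event n A) x * (exp (\<Sum>a\<in>A - {0, n}. h + \<omega> a) * g A)) = 0"
      by (intro sum.neutral ballI) (auto simp: indicator_def)
    then show ?thesis using False mem(2)[of n] by (simp add: boltzmann_weight_def)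
  next
    case True
    have P: "?C \<in> paths 0 n" using True C0 Csub by (auto simp: paths_def)
    have "(\<Sum>A\<in>paths 0 n. indicator (contact_event n A) x * (exp (\<Sum>a\<in>A - {0, n}. h + \<omega> a) * g A))
        = (\<Sum>A\<in>{?C}. indicator (contact_event n A) x * (exp (\<Sum>a\<in>A - {0, n}. h + \<omega> a) * g A))"
      using P by (intro sum.mono_neutral_right) (auto simp: indicator_def)
    also have "\<dots> = exp (\<Sum>a\<in>?C - {0, n}. h + \<omega> a) * g ?C" using x by simp
    finally have rhs: "(\<Sum>A\<in>paths 0 n. indicator (contact_event n A) x * (exp (\<Sum>a\<in>A - {0, n}. h + \<omega> a) * g A))
        = exp (\<Sum>a\<in>?C - {0, n}. h + \<omega> a) * g ?C" .
    have "(\<Sum>a=1..n. (h + \<omega> a) * contact T a x) = (\<Sum>a\<in>?C - {0}. (h + \<omega> a) * contact T a x)"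
    proof (intro sum.mono_neutral_right ballI)
      fix i assume "i \<in> {1..n} - (?C - {0})"
      then have "i \<le> n" "i \<notin> ?C" by auto
      then show "(h + \<omega> i) * contact T i x = 0" using mem(2)[of i] by simp
    qed (use Csub in auto)
    also have "\<dots> = (\<Sum>a\<in>?C - {0}. h + \<omega> a)"
    proof (intro sum.cong refl)
      fix i assume "i \<in> ?C - {0}"
      then have "i \<le> n" "i \<in> ?C" using Csub by auto
      then show "(h + \<omega> i) * contact T i x = h + \<omega> i" using mem(1)[of i] by simp
    qed
    also have "\<dots> = (h + \<omega> n) + (\<Sum>a\<in>?C - {0} - {n}. h + \<omega> a)"
      using True n finite_subset[OF Csub] by (intro sum.remove) auto
    also have "?C - {0} - {n} = ?C - {0, n}" by auto
    finally show ?thesis using True mem(1)[of n] unfolding rhs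
      by (simp add: boltzmann_weight_def exp_add mult_ac)
  qed
qed

lemma boltzmann_integral:
  assumes n: "1 \<le> n"
  shows "(\<integral>x. boltzmann_weight T n h \<omega> x * g (contact_set n x) \<partial>M)
    = exp (h + \<omega> n) * (\<Sum>A\<in>paths 0 n. path_weight p (\<lambda>a. h + \<omega> a) 0 n A * g A)"
proof -
  have ev: "contact_event n A \<in> sets M" for A by measurable
  have "(\<integral>x. boltzmann_weight T n h \<omega> x * g (contact_set n x) \<partial>M) = (\<integral>x. exp (h + \<omega> n) *
    (\<Sum>A\<in>paths 0 n. indicator (contact_event n A) x * (exp (\<Sum>a\<in>A - {0, n}. h + \<omega> a) * g A)) \<partial>M)"
    by (intro Bochner_Integration.integral_cong refl boltzmann_weight_eq[OF n])
  also have "\<dots> = exp (h + \<omega> n) * (\<integral>x. (\<Sum>A\<in>paths 0 n.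
      indicator (contact_event n A) x * (exp (\<Sum>a\<in>A - {0, n}. h + \<omega> a) * g A)) \<partial>M)"
    by (rule integral_mult_right_zero)
  also have "(\<integral>x. (\<Sum>A\<in>paths 0 n.
      indicator (contact_event n A) x * (exp (\<Sum>a\<in>A - {0, n}. h + \<omega> a) * g A)) \<partial>M)
    = (\<Sum>A\<in>paths 0 n. \<integral>x. indicator (contact_event n A) x * (exp (\<Sum>a\<in>A - {0, n}. h + \<omega> a) * g A) \<partial>M)"
    using ev by (intro Bochner_Integration.integral_sum integrable_mult_left integrable_real_indicator)
      (simp_all add: emeasure_eq_measure)
  also have "\<dots> = (\<Sum>A\<in>paths 0 n. prob (contact_event n A) * (exp (\<Sum>a\<in>A - {0, n}. h + \<omega> a) * g A))"
  proof (rule sum.cong[OF refl])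
    fix A
    have "contact_event n A \<inter> space M = contact_event n A" by blast
    then show "(\<integral>x. indicator (contact_event n A) x * (exp (\<Sum>a\<in>A - {0, n}. h + \<omega> a) * g A) \<partial>M)
        = prob (contact_event n A) * (exp (\<Sum>a\<in>A - {0, n}. h + \<omega> a) * g A)"
      by (simp only: integral_mult_left_zero Bochner_Integration.integral_indicator real_scaleR_def mult_1_right)
  qed
  finally show ?thesis
    using n by (simp add: contact_set_prob path_weight_def mult_ac cong: sum.cong)
qed

lemma partition_function_eq:
  assumes n: "1 \<le> n"
  shows "partition_function M T n h \<omega> = exp (h + \<omega> n) * path_sum p (\<lambda>a. h + \<omega> a) 0 n"
  using boltzmann_integral[OF n, of h \<omega> "\<lambda>_. 1"] by (simp add: partition_function_def path_sum_def)

lemma partition_function_pos: "1 \<le> n \<Longrightarrow> 0 < partition_function M T n h \<omega>"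
  by (simp add: partition_function_eq path_sum_pos)

lemma boltzmann_measurable [measurable]: "boltzmann_weight T n h \<omega> \<in> borel_measurable M"
proof -
  have [measurable]: "contact T a \<in> borel_measurable M" for a
    unfolding contact_def[abs_def] of_bool_def using contact_sets by measurable
  show ?thesis unfolding boltzmann_weight_def[abs_def] by measurable
qed

lemma boltzmann_nonneg: "0 \<le> boltzmann_weight T n h \<omega> x"
  by (simp add: boltzmann_weight_def contact_def)

text \<open>The reward at \<open>n\<close> cancels against the same factor of the partition
  function.\<close>

lemma gibbs_integral:
  assumes n: "1 \<le> n"
  shows "(\<integral>x. g (contact_set n x) \<partial>quenched_gibbs M T n h \<omega>)
    = (\<Sum>A\<in>paths 0 n. path_weight p (\<lambda>a. h + \<omega> a) 0 n A * g A) / path_sum p (\<lambda>a. h + \<omega> a) 0 n"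
proof -
  let ?Z = "partition_function M T n h \<omega>"
  have gm: "(\<lambda>x. g (contact_set n x)) \<in> borel_measurable M"
    by (rule measurable_compose[OF contact_set_measurable]) simp
  have "(\<integral>x. g (contact_set n x) \<partial>quenched_gibbs M T n h \<omega>)
      = (\<integral>x. (boltzmann_weight T n h \<omega> x / ?Z) *\<^sub>R g (contact_set n x) \<partial>M)"
    unfolding quenched_gibbs_def using partition_function_pos[OF n, of h \<omega>] boltzmann_nonneg gm
    by (intro integral_density) (auto simp: divide_nonneg_pos)
  also have "\<dots> = (\<integral>x. boltzmann_weight T n h \<omega> x * g (contact_set n x) \<partial>M) / ?Z" by simp
  finally show ?thesis unfolding boltzmann_integral[OF n] partition_function_eq[OF n] by simp
qed

lemma prob_space_gibbs:
  assumes n: "1 \<le> n" shows "prob_space (quenched_gibbs M T n h \<omega>)"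
proof (rule prob_spaceI)
  let ?Z = "partition_function M T n h \<omega>"
  have Z: "0 < ?Z" by (rule partition_function_pos[OF n])
  \<comment> \<open>A non-integrable function has integral 0 by convention, whereas the partition
    function is positive.\<close>
  have "integrable M (boltzmann_weight T n h \<omega>)"
  proof (rule ccontr)
    assume "\<not> integrable M (boltzmann_weight T n h \<omega>)"
    then have "?Z = 0" unfolding partition_function_def by (rule not_integrable_integral_eq)
    then show False using Z by simp
  qed
  then have "(\<integral>\<^sup>+x. ennreal (boltzmann_weight T n h \<omega> x / ?Z) \<partial>M) = ennreal (\<integral>x. boltzmann_weight T n h \<omega> x / ?Z \<partial>M)"
    using Z boltzmann_nonneg by (intro nn_integral_eq_integral) auto
  also have "\<dots> = 1" using Z by (simp add: partition_function_def[symmetric])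
  finally show "emeasure (quenched_gibbs M T n h \<omega>) (space (quenched_gibbs M T n h \<omega>)) = 1"
    by (simp add: quenched_gibbs_def emeasure_density cong: nn_integral_cong)
qed

definition nonmeeting :: "nat \<Rightarrow> real \<Rightarrow> (nat \<Rightarrow> real) \<Rightarrow> real" where
  "nonmeeting n h \<omega> = replica_expectation M T n h \<omega> (\<lambda>(x, x'). \<Prod>k=1..<n. (1 - contact T k x * contact T k x'))"

text \<open>Under the Gibbs measure contact sets are paths, so two of them always share 0 and
  \<open>n\<close>; the product vanishes as soon as they share an inner site.\<close>

lemma nonmeeting_eq:
  assumes n: "1 \<le> n"
  shows "nonmeeting n h \<omega>
    = (\<Sum>(A, A') | A \<in> paths 0 n \<and> A' \<in> paths 0 n \<and> A \<inter> A' = {0, n}.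
         path_weight p (\<lambda>a. h + \<omega> a) 0 n A * path_weight p (\<lambda>a. h + \<omega> a) 0 n A') / (path_sum p (\<lambda>a. h + \<omega> a) 0 n)\<^sup>2"
proof -
  let ?Q = "quenched_gibbs M T n h \<omega>" and ?w = "path_weight p (\<lambda>a. h + \<omega> a) 0 n" and ?Z = "path_sum p (\<lambda>a. h + \<omega> a) 0 n"
  interpret Q: prob_space ?Q by (rule prob_space_gibbs[OF n])
  interpret QQ: pair_prob_space ?Q ?Q ..
  define G where "G A A' = (if A \<inter> A' \<inter> {1..<n} = {} then 1 else 0 :: real)" for A A' :: "nat set"
  have Qs: "sets ?Q = sets M" "space ?Q = space M" by (simp_all add: quenched_gibbs_def)
  have F: "(\<Prod>k=1..<n. (1 - contact T k x * contact T k x')) = G (contact_set n x) (contact_set n x')" for x x'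
  proof -
    have "(\<Prod>k=1..<n. (1 - contact T k x * contact T k x')) = (\<Prod>k=1..<n. if k \<in> contact_set n x \<inter> contact_set n x' then 0 else 1)"
      by (intro prod.cong) (auto simp: contact_set_def contact_def)
    also have "\<dots> = G (contact_set n x) (contact_set n x')"
    proof (cases "contact_set n x \<inter> contact_set n x' \<inter> {1..<n} = {}")
      case True
      then have "(\<Prod>k=1..<n. if k \<in> contact_set n x \<inter> contact_set n x' then 0 else 1 :: real) = 1"
        by (intro prod.neutral ballI) auto
      then show ?thesis using True by (simp add: G_def)
    next
      case False
      then show ?thesis unfolding G_def by (auto simp: prod_zero_iff)
    qed
    finally show ?thesis .
  qed
  have cm: "contact_set n \<in> measurable ?Q (count_space UNIV)"
    using contact_set_measurable by (simp add: measurable_cong_sets[OF Qs(1) refl])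
  have cm1: "(\<lambda>x. g (contact_set n x)) \<in> borel_measurable ?Q" for g :: "nat set \<Rightarrow> real"
    by (rule measurable_compose[OF cm]) simp
  have int: "integrable (?Q \<Otimes>\<^sub>M ?Q) (\<lambda>(x, x'). G (contact_set n x) (contact_set n x'))"
  proof (rule QQ.P.integrable_const_bound[where B = 1])
    \<comment> \<open>Joint measurability comes from summing over the finitely many values of the
      first contact set.\<close>
    have "G (contact_set n x) (contact_set n x') = (\<Sum>A\<in>Pow {0..n}. (if contact_set n x = A then 1 else 0) * G A (contact_set n x'))" for x x'
    proof -
      have "contact_set n x \<in> Pow {0..n}" by (auto simp: contact_set_def)
      then show ?thesis by (simp add: if_distrib[of "\<lambda>c. c * _"] sum.delta cong: if_cong)
    qed
    moreover have "(\<lambda>z. \<Sum>A\<in>Pow {0..n}. (if contact_set n (fst z) = A then 1 else 0) * G A (contact_set n (snd z))) \<in> borel_measurable (?Q \<Otimes>\<^sub>M ?Q)"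
      by (intro borel_measurable_sum borel_measurable_times measurable_compose[OF measurable_fst cm1]
          measurable_compose[OF measurable_snd cm1])
    ultimately show "(\<lambda>(x, x'). G (contact_set n x) (contact_set n x')) \<in> borel_measurable (?Q \<Otimes>\<^sub>M ?Q)"
      by (simp add: case_prod_beta')
  qed (auto simp: G_def)
  have "nonmeeting n h \<omega>
      = (\<integral>x. \<integral>x'. G (contact_set n x) (contact_set n x') \<partial>?Q \<partial>?Q)"
    unfolding nonmeeting_def replica_expectation_def F using QQ.integral_fst'[OF int] by simp
  also have "\<dots> = (\<integral>x. (\<lambda>A. (\<Sum>A'\<in>paths 0 n. ?w A' * G A A') / ?Z) (contact_set n x) \<partial>?Q)"
    by (simp add: gibbs_integral[OF n])
  also have "\<dots> = (\<Sum>A\<in>paths 0 n. ?w A * ((\<Sum>A'\<in>paths 0 n. ?w A' * G A A') / ?Z)) / ?Z"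
    by (rule gibbs_integral[OF n])
  also have "\<dots> = (\<Sum>A\<in>paths 0 n. \<Sum>A'\<in>paths 0 n. ?w A * ?w A' * G A A') / ?Z\<^sup>2"
    by (simp add: sum_divide_distrib sum_distrib_left power2_eq_square mult_ac)
  also have "(\<Sum>A\<in>paths 0 n. \<Sum>A'\<in>paths 0 n. ?w A * ?w A' * G A A')
      = (\<Sum>(A, A')\<in>paths 0 n \<times> paths 0 n. ?w A * ?w A' * G A A')"
    by (simp add: sum.cartesian_product)
  also have "\<dots> = (\<Sum>(A, A') | A \<in> paths 0 n \<and> A' \<in> paths 0 n \<and> A \<inter> A' = {0, n}. ?w A * ?w A')"
  proof (rule sum.mono_neutral_cong_right)
    have iff: "A \<inter> A' = {0, n} \<longleftrightarrow> A \<inter> A' \<inter> {1..<n} = {}" if "A \<in> paths 0 n" "A' \<in> paths 0 n" for A A'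
    proof
      show "A \<inter> A' \<inter> {1..<n} = {}" if "A \<inter> A' = {0, n}" using that by auto
      assume *: "A \<inter> A' \<inter> {1..<n} = {}"
      have "{0, n} \<subseteq> A \<inter> A'" "A \<inter> A' \<subseteq> {0..n}" using that by (auto simp: paths_def)
      moreover have "z = 0 \<or> z = n" if "z \<in> A \<inter> A'" "z \<le> n" for z
        using * that by (cases "z = 0"; cases "z = n") auto
      ultimately show "A \<inter> A' = {0, n}" by fastforce
    qed
    have GG: "G A A' = (if A \<inter> A' = {0, n} then 1 else 0)" if "A \<in> paths 0 n" "A' \<in> paths 0 n" for A A'
      unfolding G_def iff[OF that] ..
    show "{(A, A'). A \<in> paths 0 n \<and> A' \<in> paths 0 n \<and> A \<inter> A' = {0, n}} \<subseteq> paths 0 n \<times> paths 0 n" by auto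
    show "\<forall>i\<in>paths 0 n \<times> paths 0 n - {(A, A'). A \<in> paths 0 n \<and> A' \<in> paths 0 n \<and> A \<inter> A' = {0, n}}.
        (case i of (A, A') \<Rightarrow> ?w A * ?w A' * G A A') = 0"
    proof
      fix z assume z: "z \<in> paths 0 n \<times> paths 0 n - {(A, A'). A \<in> paths 0 n \<and> A' \<in> paths 0 n \<and> A \<inter> A' = {0, n}}"
      then have "fst z \<in> paths 0 n" "snd z \<in> paths 0 n" "fst z \<inter> snd z \<noteq> {0, n}" by (simp_all add: mem_Times_iff case_prod_beta)
      then show "(case z of (A, A') \<Rightarrow> ?w A * ?w A' * G A A') = 0" using GG by (simp add: case_prod_beta)
    qed
    fix z assume "z \<in> {(A, A'). A \<in> paths 0 n \<and> A' \<in> paths 0 n \<and> A \<inter> A' = {0, n}}"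
    then show "(case z of (A, A') \<Rightarrow> ?w A * ?w A' * G A A') = (case z of (A, A') \<Rightarrow> ?w A * ?w A')"
      using GG by (auto split: if_splits)
  qed auto
  finally show ?thesis .
qed

end

section \<open>Free energy\<close>

text \<open>Fekete's lemma. Subtracting a line of slope \<open>t\<close> slightly below the supremum
  makes \<open>d m\<close> positive for some \<open>m\<close>. Taking off blocks of length
  \<open>m\<close> then only lowers \<open>d\<close>, so its values on \<open>{1..m}\<close> bound
  it below everywhere.\<close>

lemma superadditive_convergent:
  fixes g :: "nat \<Rightarrow> real"
  assumes super: "\<And>m n. 1 \<le> m \<Longrightarrow> 1 \<le> n \<Longrightarrow> g m + g n \<le> g (m + n)"
    and bound: "\<And>n. 1 \<le> n \<Longrightarrow> g n \<le> C * real n"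
  shows "convergent (\<lambda>n. g n / real n)"
proof -
  define R where "R = (\<lambda>n. g n / real n) ` {1..}"
  have bdd: "bdd_above R"
    unfolding R_def by (rule bdd_aboveI2[where M = C]) (use bound in \<open>auto simp: divide_le_eq\<close>)
  have "(\<lambda>n. g n / real n) \<longlonglongrightarrow> Sup R"
  proof (rule LIMSEQ_I)
    fix e :: real assume e: "0 < e"
    have "R \<noteq> {}" unfolding R_def by auto
    then obtain y where "y \<in> R" "Sup R - e / 2 < y"
      using less_cSup_iff[OF _ bdd, of "Sup R - e / 2"] e by auto
    then obtain m where m: "1 \<le> m" "Sup R - e / 2 < g m / real m" unfolding R_def by auto
    define t where "t = Sup R - e / 2"
    define d where "d n = g n - t * real n" for n
    define B where "B = (\<Sum>r=1..m. \<bar>d r\<bar>)"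
    have dm: "0 < d m" using m unfolding t_def[symmetric] by (simp add: d_def field_simps)
    have dsuper: "d i + d j \<le> d (i + j)" if "1 \<le> i" "1 \<le> j" for i j
      using super[OF that] by (simp add: d_def algebra_simps)
    have low: "- B \<le> d n" if "1 \<le> n" for n
      using that
    proof (induction n rule: less_induct)
      case (less n)
      show ?case
      proof (cases "n \<le> m")
        case True
        then have "\<bar>d n\<bar> \<le> B" unfolding B_def using less.prems by (intro member_le_sum) auto
        then show ?thesis by linarith
      next
        case False
        have "- B \<le> d (n - m)" using False m(1) by (intro less.IH) auto
        moreover have "d (n - m) + d m \<le> d n" using dsuper[of "n - m" m] False m(1) by simp
        ultimately show ?thesis using dm by linarith
      qed
    qed
    obtain N where N: "1 \<le> N" "2 * B < e * real N"
    proof -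
      obtain N where "2 * B / e < real N" using reals_Archimedean2 by blast
      then have "2 * B < e * real N" using e by (simp add: field_simps)
      also have "\<dots> \<le> e * real (max 1 N)" using e by (intro mult_left_mono) auto
      finally show thesis using that[of "max 1 N"] by simp
    qed
    show "\<exists>no. \<forall>n\<ge>no. norm (g n / real n - Sup R) < e"
    proof (intro exI allI impI)
      fix n assume n: "N \<le> n"
      then have n1: "1 \<le> n" using N by simp
      have "g n / real n \<le> Sup R" unfolding R_def using n1 bdd unfolding R_def by (intro cSup_upper) auto
      moreover have "Sup R - e < g n / real n"
      proof -
        have "2 * B < e * real n" using N n e by (smt (verit) mult_left_mono of_nat_mono)
        then show ?thesis using low[OF n1] n1 by (simp add: d_def t_def field_simps)
      qed
      ultimately show "norm (g n / real n - Sup R) < e" using e by simp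
    qed
  qed
  then show ?thesis by (rule convergentI)
qed

context gaussian_environment
begin

text \<open>On disjoint blocks the slopes do not add up, so they remain in [0, 1].\<close>

lemma subgradient_add:
  assumes "has_subgradient V F u" "has_subgradient V' F' u'" "V \<inter> V' = {}" "finite V" "finite V'"
  shows "has_subgradient (V \<union> V') (\<lambda>\<omega>. F \<omega> + F' \<omega>) (\<lambda>\<omega> a. if a \<in> V then u \<omega> a else u' \<omega> a)"
  unfolding has_subgradient_def
proof (intro conjI allI)
  show "(\<lambda>\<omega>. if a \<in> V then u \<omega> a else u' \<omega> a) \<in> borel_measurable P" for a
    using assms(1,2) by (cases "a \<in> V") (auto simp: has_subgradient_def)
  fix x y
  have "(\<Sum>a\<in>V \<union> V'. (if a \<in> V then u y a else u' y a) * (y a - x a))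
      = (\<Sum>a\<in>V. u y a * (y a - x a)) + (\<Sum>a\<in>V'. u' y a * (y a - x a))"
    using assms(3-5) by (subst sum.union_disjoint) (auto intro!: arg_cong2[where f = "(+)"] sum.cong)
  moreover have "F y - F x \<le> (\<Sum>a\<in>V. u y a * (y a - x a))" "F' y - F' x \<le> (\<Sum>a\<in>V'. u' y a * (y a - x a))"
    using assms(1,2) by (auto simp: has_subgradient_def)
  ultimately show "F y + F' y - (F x + F' x) \<le> (\<Sum>a\<in>V \<union> V'. (if a \<in> V then u y a else u' y a) * (y a - x a))"
    by linarith
qed (use assms(1,2) in \<open>auto simp: has_subgradient_def\<close>)

lemma subgradient_sum:
  assumes "finite I" "\<And>i. i \<in> I \<Longrightarrow> finite (V i)" "\<And>i. i \<in> I \<Longrightarrow> \<exists>u. has_subgradient (V i) (F i) u"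
    and "\<And>i j. i \<in> I \<Longrightarrow> j \<in> I \<Longrightarrow> i \<noteq> j \<Longrightarrow> V i \<inter> V j = {}"
  shows "\<exists>u. has_subgradient (\<Union>i\<in>I. V i) (\<lambda>\<omega>. \<Sum>i\<in>I. F i \<omega>) u"
  using assms
proof (induction I)
  case empty
  have "has_subgradient {} (\<lambda>\<omega>. 0) (\<lambda>\<omega> a. 0)" by (simp add: has_subgradient_def)
  then show ?case by auto
next
  case (insert i I)
  obtain u where u: "has_subgradient (V i) (F i) u" using insert.prems(2)[of i] by auto
  obtain u' where u': "has_subgradient (\<Union>i\<in>I. V i) (\<lambda>\<omega>. \<Sum>i\<in>I. F i \<omega>) u'"
    using insert.IH insert.prems by auto
  have "V i \<inter> (\<Union>i\<in>I. V i) = {}" using insert.prems(3)[of i] insert.hyps by fastforce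
  from subgradient_add[OF u u' this] insert.prems(1) insert.hyps show ?case by auto
qed

end

section \<open>The pinning model: convexity of log Z and growth of its mean\<close>

locale pinning = R: renewal M T \<alpha> l + G: gaussian_environment P
  for M :: "'a measure" and T :: "nat \<Rightarrow> 'a \<Rightarrow> nat" and \<alpha> :: real and l :: "real \<Rightarrow> real"
    and P :: "(nat \<Rightarrow> real) measure"
begin

definition Z :: "real \<Rightarrow> nat \<Rightarrow> nat \<Rightarrow> (nat \<Rightarrow> real) \<Rightarrow> real" where
  "Z h a b \<omega> = path_sum R.p (\<lambda>x. h + \<omega> x) a b"

lemma Z_pos: "a < b \<Longrightarrow> 0 < Z h a b \<omega>"
  by (simp add: Z_def R.path_sum_pos)

lemma path_weight_measurable [measurable]: "(\<lambda>\<omega>. path_weight R.p (\<lambda>x. h + \<omega> x) a b A) \<in> borel_measurable P"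
  unfolding path_weight_def by measurable

lemma Z_measurable [measurable]: "Z h a b \<in> borel_measurable P"
  unfolding Z_def[abs_def] path_sum_def by measurable

text \<open>\<open>u \<omega> x\<close> is the Gibbs probability of a contact at \<open>x\<close>,
  which is the derivative of the logarithm. The inequality is Jensen's under the Gibbs measure of
  \<open>y\<close>: the ratio \<open>Z h a b x / Z h a b y\<close> is the mean of
  \<open>exp (S A)\<close>, hence at least \<open>exp q\<close> with \<open>q\<close> the mean of
  \<open>S A\<close>.\<close>

lemma ln_Z_subgradient:
  assumes ab: "a < b"
  shows "\<exists>u. G.has_subgradient {a<..<b} (\<lambda>\<omega>. ln (Z h a b \<omega>)) u"
proof -
  let ?w = "\<lambda>\<omega>. path_weight R.p (\<lambda>x. h + \<omega> x) a b"
  define u where "u \<omega> x = (\<Sum>A | A \<in> paths a b \<and> x \<in> A - {a, b}. ?w \<omega> A) / Z h a b \<omega>" for \<omega> x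
  have pos: "0 < Z h a b \<omega>" for \<omega> using Z_pos[OF ab] .
  have "G.has_subgradient {a<..<b} (\<lambda>\<omega>. ln (Z h a b \<omega>)) u"
    unfolding G.has_subgradient_def
  proof (intro conjI allI)
    show "(\<lambda>\<omega>. ln (Z h a b \<omega>)) \<in> borel_measurable P" by measurable
    show "(\<lambda>\<omega>. u \<omega> x) \<in> borel_measurable P" for x unfolding u_def by measurable
    show "0 \<le> u \<omega> x" for \<omega> x
      unfolding u_def using pos[of \<omega>] by (intro divide_nonneg_pos sum_nonneg) auto
    show "u \<omega> x \<le> 1" for \<omega> x
    proof -
      have "(\<Sum>A | A \<in> paths a b \<and> x \<in> A - {a, b}. ?w \<omega> A) \<le> Z h a b \<omega>"
        unfolding Z_def path_sum_def by (intro sum_mono2) auto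
      then show ?thesis unfolding u_def using pos[of \<omega>] by (simp add: divide_le_eq)
    qed
    fix x y :: "nat \<Rightarrow> real"
    define S where "S A = (\<Sum>c\<in>A - {a, b}. x c - y c)" for A
    define q where "q = (\<Sum>A\<in>paths a b. ?w y A / Z h a b y * S A)"
    have wx: "?w x A = ?w y A * exp (S A)" for A
      unfolding path_weight_def S_def by (simp add: exp_add[symmetric] sum.distrib[symmetric])
    have "exp q * Z h a b y = (\<Sum>A\<in>paths a b. ?w y A * (exp q * (1 + S A - q)))"
    proof -
      have "(\<Sum>A\<in>paths a b. ?w y A * S A) = q * Z h a b y"
        unfolding q_def using pos[of y] by (simp add: sum_distrib_right)
      moreover have "(\<Sum>A\<in>paths a b. ?w y A * (exp q * (1 + S A - q)))
          = exp q * ((1 - q) * Z h a b y + (\<Sum>A\<in>paths a b. ?w y A * S A))"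
        unfolding Z_def path_sum_def by (simp add: sum_distrib_left sum.distrib[symmetric] algebra_simps)
      ultimately show ?thesis by (simp add: algebra_simps)
    qed
    also have "\<dots> \<le> (\<Sum>A\<in>paths a b. ?w y A * exp (S A))"
      by (intro sum_mono mult_left_mono exp_tangent) auto
    also have "\<dots> = Z h a b x" unfolding Z_def path_sum_def by (simp add: wx)
    finally have "ln (exp q * Z h a b y) \<le> ln (Z h a b x)" using pos[of y] by (intro ln_mono) auto
    then have "ln (Z h a b y) - ln (Z h a b x) \<le> - q" using pos[of y] by (simp add: ln_mult)
    also have "- q = (\<Sum>A\<in>paths a b. \<Sum>c\<in>{a<..<b}. if c \<in> A - {a, b} then ?w y A / Z h a b y * (y c - x c) else 0)"
    proof -
      have neg: "- (k * (\<Sum>c\<in>B. x c - y c)) = (\<Sum>c\<in>B. k * (y c - x c))" for k and B :: "nat set"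
        by (simp add: sum_distrib_left sum_negf[symmetric] algebra_simps)
      have "- (?w y A / Z h a b y * S A) = (\<Sum>c\<in>{a<..<b}. if c \<in> A - {a, b} then ?w y A / Z h a b y * (y c - x c) else 0)"
        if A: "A \<in> paths a b" for A
      proof -
        have "A - {a, b} = {c \<in> {a<..<b}. c \<in> A - {a, b}}" using A by (fastforce simp: paths_def)
        then have "- (?w y A / Z h a b y * S A) = (\<Sum>c | c \<in> {a<..<b} \<and> c \<in> A - {a, b}. ?w y A / Z h a b y * (y c - x c))"
          unfolding S_def neg by (rule sum.cong) (rule refl)
        also have "\<dots> = (\<Sum>c\<in>{a<..<b}. if c \<in> A - {a, b} then ?w y A / Z h a b y * (y c - x c) else 0)"
          by (rule sum.inter_filter) simp
        finally show ?thesis .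
      qed
      then show ?thesis unfolding q_def by (simp add: sum_negf[symmetric])
    qed
    also have "\<dots> = (\<Sum>c\<in>{a<..<b}. \<Sum>A\<in>paths a b. if c \<in> A - {a, b} then ?w y A / Z h a b y * (y c - x c) else 0)"
      by (rule sum.swap)
    also have "\<dots> = (\<Sum>c\<in>{a<..<b}. u y c * (y c - x c))"
    proof (rule sum.cong[OF refl])
      fix c
      have "(\<Sum>A\<in>paths a b. if c \<in> A - {a, b} then ?w y A / Z h a b y * (y c - x c) else 0)
          = (\<Sum>A | A \<in> paths a b \<and> c \<in> A - {a, b}. ?w y A / Z h a b y * (y c - x c))"
        by (rule sum.inter_filter[symmetric]) simp
      also have "\<dots> = u y c * (y c - x c)"
        unfolding u_def by (simp add: sum_distrib_right sum_divide_distrib)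
      finally show "(\<Sum>A\<in>paths a b. if c \<in> A - {a, b} then ?w y A / Z h a b y * (y c - x c) else 0) = u y c * (y c - x c)" .
    qed
    finally show "ln (Z h a b y) - ln (Z h a b x) \<le> (\<Sum>c\<in>{a<..<b}. u y c * (y c - x c))" .
  qed
  then show ?thesis by blast
qed

lemma ln_Z_integrable: "a < b \<Longrightarrow> integrable P (\<lambda>\<omega>. ln (Z h a b \<omega>))"
  using ln_Z_subgradient G.subgradient_integrable by blast

lemma ln_Z_mean_shift:
  assumes "a < b" shows "(\<integral>\<omega>. ln (Z h a b \<omega>) \<partial>P) = (\<integral>\<omega>. ln (Z h 0 (b - a) \<omega>) \<partial>P)"
proof -
  have "Z h a b \<omega> = Z h 0 (b - a) (\<lambda>x. \<omega> (x + a))" for \<omega>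
    using R.path_sum_shift[of 0 "b - a" "\<lambda>x. h + \<omega> x" a] assms by (simp add: Z_def)
  then show ?thesis using G.shift_integral[of "\<lambda>\<omega>. ln (Z h 0 (b - a) \<omega>)" a] by simp
qed

definition log_mean :: "real \<Rightarrow> nat \<Rightarrow> real" where
  "log_mean h n = (\<integral>\<omega>. ln (partition_function M T n h \<omega>) \<partial>P)"

lemma ln_partition: "1 \<le> n \<Longrightarrow> ln (partition_function M T n h \<omega>) = h + \<omega> n + ln (Z h 0 n \<omega>)"
  using Z_pos[of 0 n h \<omega>] by (simp add: R.partition_function_eq Z_def ln_mult)

lemma log_mean_eq: "1 \<le> n \<Longrightarrow> log_mean h n = h + (\<integral>\<omega>. ln (Z h 0 n \<omega>) \<partial>P)"
  using ln_Z_integrable[of 0 n h] unfolding log_mean_def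
  by (simp add: ln_partition G.prob_space[simplified])

text \<open>The reward at the junction \<open>m\<close>, absent from both factors \<open>Z\<close>,
  is exactly what turns the mean of \<open>ln Z\<close> into \<open>log_mean\<close>. Stationarity
  moves the second block to the origin.\<close>

lemma log_mean_superadd:
  assumes "1 \<le> m" "1 \<le> n" shows "log_mean h m + log_mean h n \<le> log_mean h (m + n)"
proof -
  have pw: "ln (Z h 0 m \<omega>) + (h + \<omega> m) + ln (Z h m (m + n) \<omega>) \<le> ln (Z h 0 (m + n) \<omega>)" for \<omega>
  proof -
    have p: "0 < Z h 0 m \<omega>" "0 < Z h m (m + n) \<omega>" using assms Z_pos by auto
    have "Z h 0 m \<omega> * exp (h + \<omega> m) * Z h m (m + n) \<omega> \<le> Z h 0 (m + n) \<omega>"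
      unfolding Z_def using assms by (intro R.path_sum_superadd) auto
    then have "ln (Z h 0 m \<omega> * exp (h + \<omega> m) * Z h m (m + n) \<omega>) \<le> ln (Z h 0 (m + n) \<omega>)"
      using p by (intro ln_mono) auto
    then show ?thesis using p by (simp add: ln_mult)
  qed
  have i: "integrable P (\<lambda>\<omega>. ln (Z h 0 m \<omega>))" "integrable P (\<lambda>\<omega>. ln (Z h m (m + n) \<omega>))"
    "integrable P (\<lambda>\<omega>. ln (Z h 0 (m + n) \<omega>))" using assms ln_Z_integrable by auto
  have "(\<integral>\<omega>. ln (Z h 0 m \<omega>) + (h + \<omega> m) + ln (Z h m (m + n) \<omega>) \<partial>P) \<le> (\<integral>\<omega>. ln (Z h 0 (m + n) \<omega>) \<partial>P)"
    using i pw by (intro integral_mono) auto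
  moreover have "(\<integral>\<omega>. ln (Z h 0 m \<omega>) + (h + \<omega> m) + ln (Z h m (m + n) \<omega>) \<partial>P)
      = (\<integral>\<omega>. ln (Z h 0 m \<omega>) \<partial>P) + h + (\<integral>\<omega>. ln (Z h m (m + n) \<omega>) \<partial>P)"
    using i by (simp add: G.prob_space[simplified])
  ultimately show ?thesis using assms ln_Z_mean_shift[of m "m + n" h] by (simp add: log_mean_eq)
qed

text \<open>A site contributes at most \<open>\<bar>h\<bar> + \<bar>\<omega> a\<bar>\<close> to the
  energy, and these have equal means by stationarity.\<close>

lemma log_mean_le:
  assumes n: "1 \<le> n" shows "log_mean h n \<le> (\<bar>h\<bar> + (\<integral>\<omega>. \<bar>\<omega> 0\<bar> \<partial>P)) * real n"
proof -
  have pw: "ln (partition_function M T n h \<omega>) \<le> (\<Sum>a=1..n. \<bar>h\<bar> + \<bar>\<omega> a\<bar>)" for \<omega>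
  proof -
    let ?S = "\<Sum>a=1..n. \<bar>h\<bar> + \<bar>\<omega> a\<bar>"
    have "boltzmann_weight T n h \<omega> x \<le> exp ?S" for x
    proof -
      have "(\<Sum>a=1..n. (h + \<omega> a) * contact T a x) \<le> ?S"
        by (intro sum_mono) (auto simp: contact_def)
      then have "exp (\<Sum>a=1..n. (h + \<omega> a) * contact T a x) * contact T n x \<le> exp ?S * 1"
        by (intro mult_mono) (auto simp: contact_def)
      then show ?thesis by (simp add: boltzmann_weight_def)
    qed
    moreover have "integrable M (boltzmann_weight T n h \<omega>)"
      using R.boltzmann_nonneg calculation by (intro R.integrable_const_bound[where B = "exp ?S"]) auto
    ultimately have "partition_function M T n h \<omega> \<le> exp ?S"
      unfolding partition_function_def by (intro R.integral_le_const) auto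
    then have "ln (partition_function M T n h \<omega>) \<le> ln (exp ?S)"
      using R.partition_function_pos[OF n] by (intro ln_mono) auto
    then show ?thesis by simp
  qed
  have "log_mean h n \<le> (\<integral>\<omega>. (\<Sum>a=1..n. \<bar>h\<bar> + \<bar>\<omega> a\<bar>) \<partial>P)"
    unfolding log_mean_def using pw ln_Z_integrable[of 0 n h] n
    by (intro integral_mono) (auto simp: ln_partition)
  also have "\<dots> = (\<Sum>a=1..n. \<bar>h\<bar> + (\<integral>\<omega>. \<bar>\<omega> a\<bar> \<partial>P))"
    by (simp add: G.prob_space[simplified])
  also have "\<dots> = (\<Sum>a=1..n. \<bar>h\<bar> + (\<integral>\<omega>. \<bar>\<omega> 0\<bar> \<partial>P))"
  proof (intro sum.cong refl)
    fix a
    show "\<bar>h\<bar> + (\<integral>\<omega>. \<bar>\<omega> a\<bar> \<partial>P) = \<bar>h\<bar> + (\<integral>\<omega>. \<bar>\<omega> 0\<bar> \<partial>P)"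
      using G.shift_integral[of "\<lambda>\<omega>. \<bar>\<omega> 0\<bar>" a] by simp
  qed
  finally show ?thesis by (simp add: mult.commute)
qed

text \<open>The definition uses \<open>lim\<close>, whose value can be exploited only once
  convergence is known.\<close>

lemma free_energy_limit: "(\<lambda>n. log_mean h n / real n) \<longlonglongrightarrow> free_energy M T P h"
proof -
  have "convergent (\<lambda>n. log_mean h n / real n)"
    by (rule superadditive_convergent[OF log_mean_superadd log_mean_le])
  moreover have "(\<lambda>n. \<integral>\<omega>. 1 / real n * ln (partition_function M T n h \<omega>) \<partial>P) = (\<lambda>n. log_mean h n / real n)"
    by (simp add: log_mean_def)
  ultimately show ?thesis unfolding free_energy_def by (simp only: convergent_LIMSEQ_iff)
qed

text \<open>Shows that the set whose infimum is the critical point is nonempty. For this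
  \<open>h\<close> the single step from 0 to 1 already has log mean at least 1, and superadditivity
  turns this into a free energy of at least 1.\<close>

lemma free_energy_positive_large: "\<exists>h. 0 < free_energy M T P h"
proof -
  define h where "h = 1 - ln (R.p 1)"
  have one: "1 \<le> log_mean h 1"
  proof -
    have "ln (R.p 1) \<le> ln (Z h 0 1 \<omega>)" for \<omega>
      using R.path_sum_ge_p[of 0 1 "\<lambda>x. h + \<omega> x"] R.p_pos[of 1] unfolding Z_def by (intro ln_mono) auto
    then have "(\<integral>\<omega>. ln (R.p 1) \<partial>P) \<le> (\<integral>\<omega>. ln (Z h 0 1 \<omega>) \<partial>P)"
      using ln_Z_integrable[of 0 1 h] by (intro integral_mono) auto
    then show ?thesis by (simp add: log_mean_eq h_def G.prob_space[simplified])
  qed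
  have "real n \<le> log_mean h n" if "1 \<le> n" for n
    using that
  proof (induction n rule: nat_induct_at_least)
    case base
    then show ?case using one by simp
  next
    case (Suc n)
    then show ?case using log_mean_superadd[of n 1 h] one by simp
  qed
  then have "\<forall>n\<ge>1. 1 \<le> log_mean h n / real n" by (auto simp: le_divide_eq)
  then have "1 \<le> free_energy M T P h" using LIMSEQ_le_const[OF free_energy_limit, of 1 h] by blast
  then show ?thesis by (intro exI[of _ h]) simp
qed

text \<open>Half of the free energy serves as rate, which leaves room for finite-size effects;
  stationarity extends it to every interval of length at least \<open>L\<close>.\<close>

lemma positive_growth:
  assumes "0 < free_energy M T P h"
  obtains \<mu> L where "0 < \<mu>" "\<And>a b. a < b \<Longrightarrow> L \<le> b - a \<Longrightarrow> \<mu> * real (b - a) \<le> (\<integral>\<omega>. ln (Z h a b \<omega>) \<partial>P)"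
proof -
  let ?f = "free_energy M T P h"
  have "(\<lambda>n. (log_mean h n - h) / real n) \<longlonglongrightarrow> ?f"
  proof -
    have "(\<lambda>n. log_mean h n / real n - h / real n) \<longlonglongrightarrow> ?f - 0"
      by (intro tendsto_diff free_energy_limit lim_const_over_n)
    then show ?thesis by (simp add: diff_divide_distrib)
  qed
  then have "\<forall>\<^sub>F n in sequentially. ?f / 2 < (log_mean h n - h) / real n"
    using assms by (intro order_tendstoD) auto
  then obtain L where L: "\<And>n. L \<le> n \<Longrightarrow> ?f / 2 < (log_mean h n - h) / real n"
    by (auto simp: eventually_sequentially)
  show thesis
  proof (rule that[of "?f / 2" L])
    show "0 < ?f / 2" using assms by simp
    fix a b :: nat assume ab: "a < b" "L \<le> b - a"
    then have "?f / 2 * real (b - a) \<le> log_mean h (b - a) - h"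
      using L[OF ab(2)] by (simp add: less_divide_eq split: if_splits)
    also have "\<dots> = (\<integral>\<omega>. ln (Z h a b \<omega>) \<partial>P)" using ab(1) by (simp add: log_mean_eq ln_Z_mean_shift[of a b])
    finally show "?f / 2 * real (b - a) \<le> (\<integral>\<omega>. ln (Z h a b \<omega>) \<partial>P)" .
  qed
qed

end

section \<open>Decay of the non-meeting probability\<close>

lemma geometric_tail_sum_le:
  fixes q :: real
  assumes q: "0 \<le> q" "q < 1" and B: "finite B" "B \<subseteq> {L..}"
  shows "(\<Sum>l\<in>B. q ^ l) \<le> q ^ L / (1 - q)"
proof -
  have "(\<Sum>l\<in>B. q ^ l) = (\<Sum>l\<in>B. q ^ L * q ^ (l - L))"
    using B by (intro sum.cong refl) (auto simp: power_add[symmetric])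
  also have "\<dots> = q ^ L * (\<Sum>i\<in>(\<lambda>l. l - L) ` B. q ^ i)"
  proof -
    have "inj_on (\<lambda>l. l - L) B"
    proof (rule inj_onI)
      fix x y assume xy: "x \<in> B" "y \<in> B" "x - L = y - L"
      then have "L \<le> x" "L \<le> y" using B by auto
      with xy(3) show "x = y" by simp
    qed
    then show ?thesis by (simp add: sum.reindex sum_distrib_left)
  qed
  also have "(\<Sum>i\<in>(\<lambda>l. l - L) ` B. q ^ i) \<le> (\<Sum>i. q ^ i)"
    using q B by (intro sum_le_suminf summable_geometric) auto
  also have "(\<Sum>i. q ^ i) = 1 / (1 - q)" using q by (intro suminf_geometric) simp
  finally show ?thesis using q by (simp add: mult_left_mono)
qed

text \<open>Over arbitrary families the sum factorises into a product of
  \<open>1 + q ^ (b - a)\<close>, which is at most an exponential. There are at most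
  \<open>n\<close> left ends, and each contributes a geometric tail that is small for large
  \<open>L\<close>.\<close>

lemma interval_collection_sum_le:
  fixes q :: real and n L :: nat
  assumes q: "0 \<le> q" "q < 1"
  defines "E \<equiv> {(a, b). a < b \<and> b \<le> n \<and> L < b - a}"
  shows "(\<Sum>J\<in>Pow E. q ^ total_length J) \<le> exp (real n * (q ^ L / (1 - q)))"
proof -
  have E: "E = Sigma {..<n} (\<lambda>a. {a + L<..n})" unfolding E_def by auto
  then have fin: "finite E" by simp
  let ?x = "\<lambda>e. q ^ (snd e - fst e)"
  have "(\<Sum>J\<in>Pow E. q ^ total_length J) = (\<Sum>J\<in>Pow E. \<Prod>e\<in>J. ?x e)"
    by (intro sum.cong refl) (simp add: total_length_def case_prod_beta power_sum)
  also have "\<dots> = (\<Sum>J\<in>Pow E. \<Prod>e\<in>E - J. ?x e)"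
    by (rule sum.reindex_bij_witness[where i = "\<lambda>J. E - J" and j = "\<lambda>J. E - J"]) (auto simp: double_diff)
  also have "\<dots> = (\<Prod>e\<in>E. 1 + ?x e)" using prod_add[OF fin, of "\<lambda>_. 1" ?x] by simp
  also have "\<dots> \<le> (\<Prod>e\<in>E. exp (?x e))"
    using q by (intro prod_mono) (auto intro: add_nonneg_nonneg)
  also have "\<dots> = exp (\<Sum>e\<in>E. ?x e)" using fin by (simp add: exp_sum)
  also have "\<dots> \<le> exp (real n * (q ^ L / (1 - q)))"
  proof -
    have "(\<Sum>e\<in>E. ?x e) = (\<Sum>a<n. \<Sum>b\<in>{a + L<..n}. q ^ (b - a))"
      unfolding E by (subst sum.Sigma) (auto simp: case_prod_beta)
    also have "\<dots> \<le> (\<Sum>a<n. q ^ L / (1 - q))"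
    proof (rule sum_mono)
      fix a
      have "(\<Sum>b\<in>{a + L<..n}. q ^ (b - a)) = (\<Sum>l\<in>(\<lambda>b. b - a) ` {a + L<..n}. q ^ l)"
        by (subst sum.reindex) (auto simp: inj_on_def)
      also have "\<dots> \<le> q ^ L / (1 - q)" using q by (intro geometric_tail_sum_le) auto
      finally show "(\<Sum>b\<in>{a + L<..n}. q ^ (b - a)) \<le> q ^ L / (1 - q)" .
    qed
    finally show ?thesis by simp
  qed
  finally show ?thesis .
qed

lemma long_gaps_properties:
  assumes A: "A \<in> paths m n"
  shows "finite (long_gaps L A)" "\<And>a b. (a, b) \<in> long_gaps L A \<Longrightarrow> a < b \<and> b \<le> n \<and> L < b - a"
    "\<And>e e'. e \<in> long_gaps L A \<Longrightarrow> e' \<in> long_gaps L A \<Longrightarrow> e \<noteq> e' \<Longrightarrow> {fst e<..<snd e} \<inter> {fst e'<..<snd e'} = {}"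
proof -
  show "finite (long_gaps L A)" using finite_path[OF A] by simp
  show "\<And>a b. (a, b) \<in> long_gaps L A \<Longrightarrow> a < b \<and> b \<le> n \<and> L < b - a"
    using gap_in_path_bounds[OF A] by (auto simp: long_gaps_def)
  show "{fst e<..<snd e} \<inter> {fst e'<..<snd e'} = {}"
    if "e \<in> long_gaps L A" "e' \<in> long_gaps L A" "e \<noteq> e'" for e e'
    using gaps_disjoint[of "fst e" "snd e" A "fst e'" "snd e'"] that long_gaps_subset[of L A] by (auto simp: prod_eq_iff)
qed

section \<open>Penalties for long gaps and for low disorder\<close>

context pinning
begin

definition log_gain :: "real \<Rightarrow> (nat \<times> nat) set \<Rightarrow> (nat \<Rightarrow> real) \<Rightarrow> real" where
  "log_gain h J \<omega> = (\<Sum>(a, b)\<in>J. ln (Z h a b \<omega>))"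

lemma log_gain_measurable [measurable]: "log_gain h J \<in> borel_measurable P"
proof -
  have "log_gain h J = (\<lambda>\<omega>. \<Sum>e\<in>J. ln (Z h (fst e) (snd e) \<omega>))" by (simp add: log_gain_def fun_eq_iff case_prod_beta)
  then show ?thesis by simp
qed

text \<open>Per unit length the mean gains \<open>s * \<mu>\<close> and concentration loses
  \<open>2 * s\<^sup>2 * covariance_bound\<close>; the condition on \<open>s\<close> limits the loss
  to half of the gain. Since gaps are disjoint, the whole sum of logarithms has slopes in [0, 1] and
  concentrates as one function.\<close>

lemma log_gain_exp_moment:
  assumes growth: "\<And>a b. a < b \<Longrightarrow> L0 \<le> b - a \<Longrightarrow> \<mu> * real (b - a) \<le> (\<integral>\<omega>. ln (Z h a b \<omega>) \<partial>P)"
    and s: "0 \<le> s" "4 * s * G.covariance_bound \<le> \<mu>"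
    and A: "A \<in> paths 0 n" and L: "L0 \<le> L"
  shows "(\<integral>\<^sup>+\<omega>. ennreal (exp (- s * log_gain h (long_gaps L A) \<omega>)) \<partial>P)
    \<le> ennreal (exp (- (s * \<mu> / 2) * real (total_length (long_gaps L A))))"
proof -
  let ?J = "long_gaps L A"
  let ?V = "\<Union>e\<in>?J. {fst e<..<snd e}" and ?m = "\<integral>\<omega>. log_gain h ?J \<omega> \<partial>P" and ?t = "real (total_length ?J)"
  note J = long_gaps_properties[OF A, where L = L]
  have lt: "fst e < snd e" "L0 \<le> snd e - fst e" if "e \<in> ?J" for e
    using J(2)[of "fst e" "snd e"] that L by auto
  have eq: "log_gain h ?J = (\<lambda>\<omega>. \<Sum>e\<in>?J. ln (Z h (fst e) (snd e) \<omega>))"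
    by (simp add: log_gain_def fun_eq_iff case_prod_beta)
  have "\<exists>u. G.has_subgradient ?V (\<lambda>\<omega>. \<Sum>e\<in>?J. ln (Z h (fst e) (snd e) \<omega>)) u"
    using J lt by (intro G.subgradient_sum ln_Z_subgradient) auto
  then obtain u where u: "G.has_subgradient ?V (log_gain h ?J) u" unfolding eq by blast
  have "\<mu> * ?t = (\<Sum>e\<in>?J. \<mu> * real (snd e - fst e))"
    by (simp add: total_length_def case_prod_beta sum_distrib_left)
  also have "\<dots> \<le> (\<Sum>e\<in>?J. \<integral>\<omega>. ln (Z h (fst e) (snd e) \<omega>) \<partial>P)"
    using lt by (intro sum_mono growth) auto
  also have "\<dots> = ?m"
    unfolding eq using lt ln_Z_integrable by (intro Bochner_Integration.integral_sum[symmetric]) auto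
  finally have mean: "\<mu> * ?t \<le> ?m" .
  have "card ?V \<le> (\<Sum>e\<in>?J. card {fst e<..<snd e})" by (rule card_UN_le[OF J(1)])
  also have "\<dots> \<le> total_length ?J"
    unfolding total_length_def by (intro sum_mono) auto
  finally have card: "real (card ?V) \<le> ?t" by simp
  have "(\<integral>\<^sup>+\<omega>. ennreal (exp (- s * log_gain h ?J \<omega>)) \<partial>P)
      = (\<integral>\<^sup>+\<omega>. ennreal (exp (- s * ?m)) * ennreal (exp (- s * (log_gain h ?J \<omega> - ?m))) \<partial>P)"
    by (intro nn_integral_cong) (simp add: ennreal_mult[symmetric] exp_add[symmetric] algebra_simps)
  also have "\<dots> = ennreal (exp (- s * ?m)) * (\<integral>\<^sup>+\<omega>. ennreal (exp (- s * (log_gain h ?J \<omega> - ?m))) \<partial>P)"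
    by (rule nn_integral_cmult) measurable
  also have "\<dots> \<le> ennreal (exp (- s * ?m)) * ennreal (exp (2 * s\<^sup>2 * (G.covariance_bound * card ?V)))"
    using J(1) s by (intro mult_left_mono G.concentration[OF _ u]) auto
  also have "\<dots> = ennreal (exp (- s * ?m + 2 * s\<^sup>2 * (G.covariance_bound * card ?V)))"
    by (simp only: ennreal_mult[symmetric] exp_add exp_ge_zero)
  also have "\<dots> \<le> ennreal (exp (- (s * \<mu> / 2) * ?t))"
  proof (intro ennreal_leI, simp only: exp_le_cancel_iff)
    have 1: "s * (\<mu> * ?t) \<le> s * ?m" by (rule mult_left_mono[OF mean s(1)])
    have "2 * s\<^sup>2 * (G.covariance_bound * card ?V) \<le> 2 * s\<^sup>2 * (G.covariance_bound * ?t)"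
      using card G.covariance_bound_nonneg by (intro mult_left_mono) auto
    also have "\<dots> = s / 2 * ?t * (4 * s * G.covariance_bound)" by (simp add: power2_eq_square)
    also have "\<dots> \<le> s / 2 * ?t * \<mu>" using s by (intro mult_left_mono) auto
    finally show "- s * ?m + 2 * s\<^sup>2 * (G.covariance_bound * card ?V) \<le> - (s * \<mu> / 2) * ?t"
      using 1 by (simp add: algebra_simps)
  qed
  finally show ?thesis .
qed

text \<open>A random bound for the Gibbs probability that the long gaps have total length at least
  \<open>N\<close>. Taken at the smallest \<open>h\<close>, it serves all larger ones.\<close>

definition gap_penalty :: "real \<Rightarrow> real \<Rightarrow> nat \<Rightarrow> nat \<Rightarrow> nat \<Rightarrow> (nat \<Rightarrow> real) \<Rightarrow> real" where
  "gap_penalty h s L n N \<omega> = (\<Sum>J\<in>{J \<in> long_gaps L ` paths 0 n. N \<le> total_length J}. exp (- s * log_gain h J \<omega>))"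

lemma gap_penalty_measurable [measurable]: "gap_penalty h s L n N \<in> borel_measurable P"
  unfolding gap_penalty_def[abs_def] by measurable

lemma gap_penalty_nonneg: "0 \<le> gap_penalty h s L n N \<omega>"
  unfolding gap_penalty_def by (intro sum_nonneg) simp

text \<open>The rate \<open>c\<close> per unit length is halved: one half exploits
  \<open>N \<le> total_length J\<close>, the other becomes \<open>q\<close> and pays for the sum
  over \<open>J\<close>. With \<open>L\<close> large that sum costs
  \<open>c * \<epsilon> / 4\<close> per site against a gain of \<open>c * \<epsilon> / 2\<close>;
  the difference is \<open>s * \<mu> * \<epsilon> / 8\<close>.\<close>

lemma gap_penalty_mean:
  assumes growth: "\<And>a b. a < b \<Longrightarrow> L0 \<le> b - a \<Longrightarrow> \<mu> * real (b - a) \<le> (\<integral>\<omega>. ln (Z h a b \<omega>) \<partial>P)"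
    and s: "0 < s" "4 * s * G.covariance_bound \<le> \<mu>" and \<mu>: "0 < \<mu>" and \<epsilon>: "0 < \<epsilon>"
  shows "\<exists>L\<ge>1. \<forall>n N. \<epsilon> * real n \<le> real N \<longrightarrow>
     (\<integral>\<^sup>+\<omega>. ennreal (gap_penalty h s L n N \<omega>) \<partial>P) \<le> ennreal (exp (- (s * \<mu> * \<epsilon> / 8) * real n))"
proof -
  define c where "c = s * \<mu> / 2"
  define q where "q = exp (- c / 2)"
  have c: "0 < c" unfolding c_def using s \<mu> by simp
  have q: "0 < q" "q < 1" unfolding q_def using c by auto
  have "(\<lambda>L. q ^ L / (1 - q)) \<longlonglongrightarrow> 0 / (1 - q)"
    using q by (intro tendsto_divide LIMSEQ_power_zero tendsto_const) auto
  then have "\<forall>\<^sub>F L in sequentially. q ^ L / (1 - q) < c * \<epsilon> / 4"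
    using c \<epsilon> by (intro order_tendstoD) auto
  then obtain L1 where L1: "\<And>L. L1 \<le> L \<Longrightarrow> q ^ L / (1 - q) < c * \<epsilon> / 4" by (auto simp: eventually_sequentially)
  define L where "L = max 1 (max L0 L1)"
  have L: "1 \<le> L" "L0 \<le> L" "q ^ L / (1 - q) < c * \<epsilon> / 4" unfolding L_def using L1 by auto
  have "(\<integral>\<^sup>+\<omega>. ennreal (gap_penalty h s L n N \<omega>) \<partial>P) \<le> ennreal (exp (- (s * \<mu> * \<epsilon> / 8) * real n))"
    if N: "\<epsilon> * real n \<le> real N" for n N
  proof -
    let ?T = "{J \<in> long_gaps L ` paths 0 n. N \<le> total_length J}"
    let ?E = "{(a, b). a < b \<and> b \<le> n \<and> L < b - a}"
    have finE: "finite ?E" by (rule finite_subset[of _ "{..n} \<times> {..n}"]) auto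
    have TE: "?T \<subseteq> Pow ?E" using long_gaps_properties(2) by blast
    have "(\<integral>\<^sup>+\<omega>. ennreal (gap_penalty h s L n N \<omega>) \<partial>P) = (\<integral>\<^sup>+\<omega>. (\<Sum>J\<in>?T. ennreal (exp (- s * log_gain h J \<omega>))) \<partial>P)"
      unfolding gap_penalty_def by (intro nn_integral_cong sum_ennreal[symmetric]) simp
    also have "\<dots> = (\<Sum>J\<in>?T. \<integral>\<^sup>+\<omega>. ennreal (exp (- s * log_gain h J \<omega>)) \<partial>P)"
      by (rule nn_integral_sum) measurable
    also have "\<dots> \<le> (\<Sum>J\<in>?T. ennreal (exp (- c * real N / 2) * q ^ total_length J))"
    proof (rule sum_mono)
      fix J assume J: "J \<in> ?T"
      then obtain A where A: "A \<in> paths 0 n" "J = long_gaps L A" by auto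
      have "(\<integral>\<^sup>+\<omega>. ennreal (exp (- s * log_gain h J \<omega>)) \<partial>P) \<le> ennreal (exp (- (s * \<mu> / 2) * real (total_length J)))"
        unfolding A(2) using s L A(1) by (intro log_gain_exp_moment[where ?L0.0 = L0] growth) auto
      also have "\<dots> \<le> ennreal (exp (- c * real N / 2) * q ^ total_length J)"
      proof (rule ennreal_leI)
        have "c * real N \<le> c * real (total_length J)" using J c by (intro mult_left_mono) auto
        then have "- c * real (total_length J) \<le> - c * real N / 2 + real (total_length J) * (- c / 2)"
          by (simp add: algebra_simps)
        then show "exp (- (s * \<mu> / 2) * real (total_length J)) \<le> exp (- c * real N / 2) * q ^ total_length J"
          unfolding q_def c_def[symmetric] by (simp add: exp_of_nat_mult[symmetric] exp_add[symmetric])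
      qed
      finally show "(\<integral>\<^sup>+\<omega>. ennreal (exp (- s * log_gain h J \<omega>)) \<partial>P) \<le> ennreal (exp (- c * real N / 2) * q ^ total_length J)" .
    qed
    also have "\<dots> = ennreal (\<Sum>J\<in>?T. exp (- c * real N / 2) * q ^ total_length J)"
      using q by (intro sum_ennreal) simp
    also have "\<dots> \<le> ennreal (exp (- (s * \<mu> * \<epsilon> / 8) * real n))"
    proof (rule ennreal_leI)
      have "(\<Sum>J\<in>?T. exp (- c * real N / 2) * q ^ total_length J) \<le> (\<Sum>J\<in>Pow ?E. exp (- c * real N / 2) * q ^ total_length J)"
        using TE finE q by (intro sum_mono2) auto
      also have "\<dots> = exp (- c * real N / 2) * (\<Sum>J\<in>Pow ?E. q ^ total_length J)" by (simp add: sum_distrib_left)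
      also have "\<dots> \<le> exp (- c * real N / 2) * exp (real n * (q ^ L / (1 - q)))"
        using q by (intro mult_left_mono interval_collection_sum_le) auto
      also have "\<dots> = exp (- c * real N / 2 + real n * (q ^ L / (1 - q)))" by (rule exp_add[symmetric])
      also have "\<dots> \<le> exp (- (s * \<mu> * \<epsilon> / 8) * real n)"
      proof (simp only: exp_le_cancel_iff)
        have "real n * (q ^ L / (1 - q)) \<le> real n * (c * \<epsilon> / 4)" using L(3) by (intro mult_left_mono) auto
        moreover have "c * (\<epsilon> * real n) \<le> c * real N" using N c by (intro mult_left_mono) auto
        moreover have "s * \<mu> * \<epsilon> / 8 * real n = c * (\<epsilon> * real n) / 4" "real n * (c * \<epsilon> / 4) = c * (\<epsilon> * real n) / 4"
          by (simp_all add: c_def)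
        ultimately show "- c * real N / 2 + real n * (q ^ L / (1 - q)) \<le> - (s * \<mu> * \<epsilon> / 8) * real n"
          by linarith
      qed
      finally show "(\<Sum>J\<in>?T. exp (- c * real N / 2) * q ^ total_length J) \<le> exp (- (s * \<mu> * \<epsilon> / 8) * real n)" .
    qed
    finally show ?thesis .
  qed
  then show ?thesis using L(1) by blast
qed

text \<open>Exponential Chebyshev weights summed over all candidate sets \<open>B\<close> of low
  sites. The sum is at least 1 when \<open>N\<close> or more inner sites have disorder below
  \<open>- K\<close>, so it dominates the indicator of this event.\<close>

definition low_disorder_penalty :: "real \<Rightarrow> nat \<Rightarrow> nat \<Rightarrow> (nat \<Rightarrow> real) \<Rightarrow> real" where
  "low_disorder_penalty K n N \<omega> = (\<Sum>B\<in>{B \<in> Pow {1..<n}. N \<le> card B}. exp (G.lin (\<lambda>_. - 1) B \<omega> - K * real (card B)))"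

lemma low_disorder_penalty_measurable [measurable]: "low_disorder_penalty K n N \<in> borel_measurable P"
  unfolding low_disorder_penalty_def[abs_def] by measurable

lemma low_disorder_penalty_nonneg: "0 \<le> low_disorder_penalty K n N \<omega>"
  unfolding low_disorder_penalty_def by (intro sum_nonneg) simp

lemma low_disorder_penalty_ge_1:
  assumes "N \<le> card ({1..<n} - {x. - K \<le> \<omega> x})" shows "1 \<le> low_disorder_penalty K n N \<omega>"
proof -
  let ?B = "{1..<n} - {x. - K \<le> \<omega> x}"
  have "(\<Sum>x\<in>?B. K) \<le> (\<Sum>x\<in>?B. - \<omega> x)" by (intro sum_mono) auto
  then have "K * real (card ?B) \<le> G.lin (\<lambda>_. - 1) ?B \<omega>" by (simp add: G.lin_def mult.commute)
  then have "1 \<le> exp (G.lin (\<lambda>_. - 1) ?B \<omega> - K * real (card ?B))" by simp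
  also have "\<dots> \<le> low_disorder_penalty K n N \<omega>"
    unfolding low_disorder_penalty_def using assms by (intro member_le_sum) auto
  finally show ?thesis .
qed

text \<open>In \<open>K\<close>, the term \<open>covariance_bound / 2\<close> cancels the Gaussian
  exponential moment, and \<open>2 / \<epsilon>\<close> yields \<open>exp (- 2 * real n)\<close>
  because \<open>B\<close> has at least \<open>\<epsilon> * real n\<close> elements. At most
  \<open>2 ^ n\<close> sets are summed, which costs no more than
  \<open>exp (real n)\<close>.\<close>

lemma low_disorder_penalty_mean:
  assumes \<epsilon>: "0 < \<epsilon>" "\<epsilon> * real n \<le> real N" and K: "K = G.covariance_bound / 2 + 2 / \<epsilon>"
  shows "(\<integral>\<^sup>+\<omega>. ennreal (low_disorder_penalty K n N \<omega>) \<partial>P) \<le> ennreal (exp (- real n))"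
proof -
  let ?T = "{B \<in> Pow {1..<n}. N \<le> card B}"
  have "(\<integral>\<^sup>+\<omega>. ennreal (low_disorder_penalty K n N \<omega>) \<partial>P)
      = (\<integral>\<^sup>+\<omega>. (\<Sum>B\<in>?T. ennreal (exp (- K * real (card B))) * ennreal (exp (G.lin (\<lambda>_. - 1) B \<omega>))) \<partial>P)"
    unfolding low_disorder_penalty_def
    by (intro nn_integral_cong) (simp add: ennreal_mult[symmetric] exp_add[symmetric] sum_ennreal)
  also have "\<dots> = (\<Sum>B\<in>?T. ennreal (exp (- K * real (card B))) * (\<integral>\<^sup>+\<omega>. ennreal (exp (G.lin (\<lambda>_. - 1) B \<omega>)) \<partial>P))"
    by (subst nn_integral_sum) (measurable, intro sum.cong refl nn_integral_cmult, measurable)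
  also have "\<dots> \<le> (\<Sum>B\<in>?T. ennreal (exp (- 2 * real n)))"
  proof (rule sum_mono)
    fix B assume B: "B \<in> ?T"
    then have fin: "finite B" by (auto intro: finite_subset)
    have "(\<integral>\<^sup>+\<omega>. ennreal (exp (G.lin (\<lambda>_. - 1) B \<omega>)) \<partial>P) \<le> ennreal (exp (1\<^sup>2 * (G.covariance_bound * card B) / 2))"
      by (rule G.linear_exp_le[OF fin]) simp
    then have "ennreal (exp (- K * real (card B))) * (\<integral>\<^sup>+\<omega>. ennreal (exp (G.lin (\<lambda>_. - 1) B \<omega>)) \<partial>P)
        \<le> ennreal (exp (- K * real (card B))) * ennreal (exp (1\<^sup>2 * (G.covariance_bound * card B) / 2))"
      by (rule mult_left_mono) simp
    also have "\<dots> = ennreal (exp (- K * real (card B) + 1\<^sup>2 * (G.covariance_bound * card B) / 2))"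
      by (simp only: ennreal_mult[symmetric] exp_add exp_ge_zero)
    also have "\<dots> \<le> ennreal (exp (- 2 * real n))"
    proof (intro ennreal_leI, simp only: exp_le_cancel_iff)
      have "real N \<le> real (card B)" using B by simp
      then have "\<epsilon> * real n \<le> real (card B)" using \<epsilon> by linarith
      then have "2 * real n \<le> 2 / \<epsilon> * real (card B)" using \<epsilon>(1) by (simp add: field_simps)
      then show "- K * real (card B) + 1\<^sup>2 * (G.covariance_bound * card B) / 2 \<le> - 2 * real n"
        by (simp add: K algebra_simps)
    qed
    finally show "ennreal (exp (- K * real (card B))) * (\<integral>\<^sup>+\<omega>. ennreal (exp (G.lin (\<lambda>_. - 1) B \<omega>)) \<partial>P) \<le> ennreal (exp (- 2 * real n))" .
  qed
  also have "\<dots> = ennreal (real (card ?T) * exp (- 2 * real n))"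
    by (simp add: ennreal_mult ennreal_of_nat_eq_real_of_nat)
  also have "\<dots> \<le> ennreal (exp (- real n))"
  proof (rule ennreal_leI)
    have "card ?T \<le> card (Pow {1..<n})" by (intro card_mono) auto
    also have "\<dots> \<le> 2 ^ n" by (simp add: card_Pow)
    finally have "real (card ?T) \<le> 2 ^ n" by (metis of_nat_le_iff of_nat_numeral of_nat_power)
    also have "\<dots> \<le> exp 1 ^ n" using exp_ge_add_one_self[of 1] by (intro power_mono) auto
    also have "\<dots> = exp (real n)" by (simp add: exp_of_nat_mult[symmetric])
    finally have "real (card ?T) * exp (- 2 * real n) \<le> exp (real n) * exp (- 2 * real n)" by (intro mult_right_mono) auto
    also have "\<dots> = exp (- real n)" by (simp add: exp_add[symmetric])
    finally show "real (card ?T) * exp (- 2 * real n) \<le> exp (- real n)" .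
  qed
  finally show ?thesis .
qed

section \<open>Assembling the estimates\<close>

lemma nonmeeting_le_1:
  assumes n: "1 \<le> n"
  shows "R.nonmeeting n h \<omega> \<le> 1"
proof -
  let ?w = "path_weight R.p (\<lambda>a. h + \<omega> a) 0 n"
  have "(\<Sum>(A, A') | A \<in> paths 0 n \<and> A' \<in> paths 0 n \<and> A \<inter> A' = {0, n}. ?w A * ?w A')
      \<le> (\<Sum>(A, A')\<in>paths 0 n \<times> paths 0 n. ?w A * ?w A')"
    by (intro sum_mono2) auto
  also have "\<dots> = (path_sum R.p (\<lambda>a. h + \<omega> a) 0 n)\<^sup>2"
    by (simp add: path_sum_def power2_eq_square sum_product sum.cartesian_product)
  finally show ?thesis
    unfolding R.nonmeeting_eq[OF n] using R.path_sum_pos[of 0 n "\<lambda>a. h + \<omega> a"] n by (simp add: divide_le_eq)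
qed

text \<open>Raising \<open>h\<close> raises every \<open>path_sum\<close>, so the exponentials at
  \<open>h\<close> are bounded by those at \<open>h0\<close>.\<close>

lemma long_gap_fraction:
  assumes n: "1 \<le> n" and s: "0 \<le> s" "s \<le> 1" and h: "h0 \<le> h"
  shows "(\<Sum>A | A \<in> paths 0 n \<and> N \<le> total_length (long_gaps L A). path_weight R.p (\<lambda>a. h + \<omega> a) 0 n A)
     \<le> path_sum R.p (\<lambda>a. h + \<omega> a) 0 n * gap_penalty h0 s L n N \<omega>"
proof -
  let ?T = "{J \<in> long_gaps L ` paths 0 n. N \<le> total_length J}"
  have "exp (- s * (\<Sum>(a, b)\<in>J. ln (path_sum R.p (\<lambda>a. h + \<omega> a) a b))) \<le> exp (- s * log_gain h0 J \<omega>)" if J: "J \<in> ?T" for J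
  proof -
    obtain A where A: "A \<in> paths 0 n" "J = long_gaps L A" using J by auto
    have "log_gain h0 J \<omega> \<le> (\<Sum>(a, b)\<in>J. ln (path_sum R.p (\<lambda>a. h + \<omega> a) a b))"
      unfolding log_gain_def
    proof (rule sum_mono, clarify)
      fix a b assume "(a, b) \<in> J"
      then have "a < b" using long_gaps_properties(2)[OF A(1)] A(2) by blast
      then show "ln (Z h0 a b \<omega>) \<le> ln (path_sum R.p (\<lambda>a. h + \<omega> a) a b)"
        using Z_pos[of a b h0 \<omega>] h unfolding Z_def by (intro ln_mono R.path_sum_mono) auto
    qed
    then have "s * log_gain h0 J \<omega> \<le> s * (\<Sum>(a, b)\<in>J. ln (path_sum R.p (\<lambda>a. h + \<omega> a) a b))"
      by (rule mult_left_mono[OF _ s(1)])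
    then show ?thesis by simp
  qed
  then have "(\<Sum>J\<in>?T. exp (- s * (\<Sum>(a, b)\<in>J. ln (path_sum R.p (\<lambda>a. h + \<omega> a) a b)))) \<le> gap_penalty h0 s L n N \<omega>"
    unfolding gap_penalty_def by (rule sum_mono)
  then have "path_sum R.p (\<lambda>a. h + \<omega> a) 0 n * (\<Sum>J\<in>?T. exp (- s * (\<Sum>(a, b)\<in>J. ln (path_sum R.p (\<lambda>a. h + \<omega> a) a b))))
      \<le> path_sum R.p (\<lambda>a. h + \<omega> a) 0 n * gap_penalty h0 s L n N \<omega>"
    using R.path_sum_pos[of 0 n "\<lambda>a. h + \<omega> a"] n by (intro mult_left_mono) auto
  then show ?thesis using R.long_gaps_bound[OF s, where m = 0 and n = n and N = N and L = L and v = "\<lambda>a. h + \<omega> a"] n by linarith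
qed

text \<open>If many sites have low disorder, the corresponding penalty is at least 1. Otherwise a
  non-meeting pair has too much length in long gaps of \<open>A\<close> or of \<open>A'\<close>, or
  it has many free contacts. The thresholds come from \<open>many_free_contacts\<close>; the 1 added
  after \<open>div\<close> makes the failure of a threshold exactly the inequality assumed
  there.\<close>

lemma nonmeeting_le:
  assumes n: "1 \<le> n" and s: "0 \<le> s" "s \<le> 1" and h: "h0 \<le> h" and L: "1 \<le> L"
    and c0: "\<And>t. 1 \<le> t \<Longrightarrow> t \<le> L' \<Longrightarrow> c0 \<le> R.p t" "0 < c0" and \<theta>: "\<theta> = c0\<^sup>2 * exp (h0 - K)"
  shows "R.nonmeeting n h \<omega>
    \<le> gap_penalty h0 s L n (n div 2 + 1) \<omega> + gap_penalty h0 s L' n (n div (4 * L) + 1) \<omega>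
      + low_disorder_penalty K n (n div (8 * L) + 1) \<omega> + (1 / (1 + \<theta>)) ^ (n div (8 * L) - 1)"
proof -
  let ?v = "\<lambda>a. h + \<omega> a"
  let ?w = "path_weight R.p ?v 0 n" and ?Z = "path_sum R.p ?v 0 n" and ?G = "{x. - K \<le> \<omega> x}"
  let ?U1 = "gap_penalty h0 s L n (n div 2 + 1) \<omega>" and ?U2 = "gap_penalty h0 s L' n (n div (4 * L) + 1) \<omega>"
  let ?k = "n div (8 * L) - 1"
  have \<theta>0: "0 < \<theta>" using \<theta> c0 by simp
  have Zpos: "0 < ?Z" using n by (intro R.path_sum_pos) simp
  have rest: "0 \<le> (1 / (1 + \<theta>)) ^ ?k" using \<theta>0 by simp
  show ?thesis
  proof (cases "8 * L * card ({1..<n} - ?G) \<le> n")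
    case False
    then have "n div (8 * L) < card ({1..<n} - ?G)"
      using L by (simp add: div_less_iff_less_mult mult.commute)
    then have "1 \<le> low_disorder_penalty K n (n div (8 * L) + 1) \<omega>" by (intro low_disorder_penalty_ge_1) simp
    then show ?thesis
      using nonmeeting_le_1[OF n, of h \<omega>] gap_penalty_nonneg[of h0 s L n "n div 2 + 1" \<omega>]
        gap_penalty_nonneg[of h0 s L' n "n div (4 * L) + 1" \<omega>] rest by linarith
  next
    case True
    let ?S = "{(A, A'). A \<in> paths 0 n \<and> A' \<in> paths 0 n \<and> A \<inter> A' = {0, n}}"
    let ?T1 = "{A \<in> paths 0 n. n div 2 + 1 \<le> total_length (long_gaps L A)}"
    let ?T2 = "{A \<in> paths 0 n. n div (4 * L) + 1 \<le> total_length (long_gaps L' A)}"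
    let ?S3 = "{(A, A'). A \<in> paths 0 n \<and> A' \<in> paths 0 n \<and> A \<inter> A' = {0, n} \<and> ?k \<le> card (free_contacts L' ?G A A')}"
    let ?g = "\<lambda>(A, A'). ?w A * ?w A'"
    have g0: "0 \<le> ?g z" for z by (cases z) simp
    have fin3: "finite ?S3" by (rule finite_subset[of _ "paths 0 n \<times> paths 0 n"]) auto
    have sub: "?S \<subseteq> ?T1 \<times> paths 0 n \<union> paths 0 n \<times> ?T2 \<union> ?S3"
    proof
      fix z assume "z \<in> ?S"
      then obtain A A' where z: "z = (A, A')" "A \<in> paths 0 n" "A' \<in> paths 0 n" "A \<inter> A' = {0, n}" by auto
      show "z \<in> ?T1 \<times> paths 0 n \<union> paths 0 n \<times> ?T2 \<union> ?S3"
      proof (cases "A \<in> ?T1 \<or> A' \<in> ?T2")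
        case True
        then show ?thesis using z by auto
      next
        case F: False
        then have "total_length (long_gaps L A) \<le> n div 2" "total_length (long_gaps L' A') \<le> n div (4 * L)"
          using z by auto
        then have "2 * total_length (long_gaps L A) \<le> n" "4 * L * total_length (long_gaps L' A') \<le> n"
          using L by (auto simp: less_eq_div_iff_mult_less_eq mult.commute)
        from many_free_contacts[OF n z(2-4) this True]
        have "n div (8 * L) \<le> (8 * L * (card (free_contacts L' ?G A A') + 1)) div (8 * L)" by (rule div_le_mono)
        also have "\<dots> = card (free_contacts L' ?G A A') + 1" using L by (subst nonzero_mult_div_cancel_left) auto
        finally have "?k \<le> card (free_contacts L' ?G A A')" by simp
        then show ?thesis using z by auto
      qed
    qed
    have "sum ?g ?S \<le> sum ?g (?T1 \<times> paths 0 n \<union> paths 0 n \<times> ?T2 \<union> ?S3)"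
      using sub g0 fin3 by (intro sum_mono2) auto
    also have "\<dots> \<le> sum ?g (?T1 \<times> paths 0 n) + sum ?g (paths 0 n \<times> ?T2) + sum ?g ?S3"
    proof -
      have un: "sum ?g (X \<union> Y) \<le> sum ?g X + sum ?g Y" if "finite X" "finite Y" for X Y
      proof -
        have "0 \<le> sum ?g (X \<inter> Y)" using g0 by (intro sum_nonneg)
        then show ?thesis using sum.union_inter[OF that, of ?g] by linarith
      qed
      have fin: "finite (?T1 \<times> paths 0 n)" "finite (paths 0 n \<times> ?T2)" by simp_all
      show ?thesis
        by (rule order_trans[OF un[OF finite_UnI[OF fin] fin3] add_right_mono[OF un[OF fin]]])
    qed
    \<comment> \<open>In these two parts non-meeting is forgotten, so the unrestricted path
      contributes a full partition function.\<close>
    also have "sum ?g (?T1 \<times> paths 0 n) = sum ?w ?T1 * ?Z"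
      by (simp add: path_sum_def sum_product sum.cartesian_product)
    also have "sum ?g (paths 0 n \<times> ?T2) = ?Z * sum ?w ?T2"
      by (simp add: path_sum_def sum_product sum.cartesian_product)
    also have "sum ?w ?T1 * ?Z \<le> ?Z * ?U1 * ?Z"
      using long_gap_fraction[OF n s h] Zpos by (intro mult_right_mono) auto
    also have "?Z * sum ?w ?T2 \<le> ?Z * (?Z * ?U2)"
      using long_gap_fraction[OF n s h] Zpos by (intro mult_left_mono) auto
    also have "sum ?g ?S3 \<le> ?Z\<^sup>2 * (1 / (1 + \<theta>)) ^ ?k"
    proof -
      have G: "\<theta> \<le> c0\<^sup>2 * exp (?v x)" if "x \<in> ?G" for x
        unfolding \<theta> using that h by (intro mult_left_mono) auto
      have "sum ?g ?S3 * (1 + \<theta>) ^ ?k \<le> ?Z\<^sup>2"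
        by (rule R.nonmeeting_pair_bound[where ?c0.0 = c0 and L = L' and G = ?G and v = ?v])
          (use c0 G \<theta>0 in auto)
      then show ?thesis using \<theta>0 by (simp add: power_one_over field_simps)
    qed
    finally have "sum ?g ?S \<le> (?U1 + ?U2 + (1 / (1 + \<theta>)) ^ ?k) * ?Z\<^sup>2"
      by (simp add: power2_eq_square algebra_simps)
    then have "sum ?g ?S / ?Z\<^sup>2 \<le> ?U1 + ?U2 + (1 / (1 + \<theta>)) ^ ?k"
      using Zpos by (simp add: divide_le_eq)
    then show ?thesis unfolding R.nonmeeting_eq[OF n]
      using low_disorder_penalty_nonneg[of K n "n div (8 * L) + 1" \<omega>] by linarith
  qed
qed

text \<open>A nonempty closed set that is bounded below contains its infimum, which is therefore
  strictly above the critical point. The latter being an infimum, some \<open>h0\<close> with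
  positive free energy lies below \<open>Inf H\<close>.\<close>

lemma exists_supercritical_below:
  assumes H: "closed H" "H \<subseteq> {critical_point M T P<..}" "H \<noteq> {}"
  obtains h0 where "0 < free_energy M T P h0" "\<And>h. h \<in> H \<Longrightarrow> h0 \<le> h"
proof -
  let ?A = "{h. 0 < free_energy M T P h}"
  have bdd: "bdd_below H" using H(2) by (intro bdd_belowI[of _ "critical_point M T P"]) auto
  have "Inf H \<in> H" by (rule closed_contains_Inf[OF H(3) bdd H(1)])
  then have lt: "Inf ?A < Inf H" using H(2) by (auto simp: critical_point_def)
  have "\<exists>h0\<in>?A. h0 < Inf H"
  proof (rule ccontr)
    assume "\<not> (\<exists>h0\<in>?A. h0 < Inf H)"
    then have "Inf H \<le> x" if "x \<in> ?A" for x using that not_less by blast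
    moreover have "?A \<noteq> {}" using free_energy_positive_large by blast
    ultimately have "Inf H \<le> Inf ?A" by (intro cInf_greatest)
    then show False using lt by simp
  qed
  then obtain h0 where "h0 \<in> ?A" "h0 < Inf H" by blast
  then show thesis using that[of h0] cInf_lower[OF _ bdd] by fastforce
qed

text \<open>The order of choices matters: \<open>s\<close> from the growth rate, \<open>L\<close>
  for half of the length, \<open>L'\<close> for the fraction \<open>1 / (4 * L)\<close>,
  \<open>c0\<close> from the kernel up to \<open>L'\<close>, \<open>K\<close> for the fraction
  \<open>1 / (8 * L)\<close> of low sites, and \<open>\<theta>\<close> from \<open>c0\<close> and
  \<open>K\<close>. None of them depends on \<open>n\<close> or on \<open>h\<close>.\<close>

lemma nonmeeting_decay:
  assumes h0: "0 < free_energy M T P h0" and H: "\<And>h. h \<in> H \<Longrightarrow> h0 \<le> h"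
  shows "\<exists>C>0. \<exists>r>0. \<forall>n\<ge>1.
    (\<integral>\<^sup>+\<omega>. (SUP h\<in>H. ennreal (R.nonmeeting n h \<omega>)) \<partial>P)
      \<le> ennreal (C * exp (- r * real n))"
proof -
  obtain \<mu> L0 where \<mu>: "0 < \<mu>"
    and growth: "\<And>a b. a < b \<Longrightarrow> L0 \<le> b - a \<Longrightarrow> \<mu> * real (b - a) \<le> (\<integral>\<omega>. ln (Z h0 a b \<omega>) \<partial>P)"
    using positive_growth[OF h0] by blast
  \<comment> \<open>The minimum with 1 is for \<open>long_gaps_bound\<close>; the added 1 keeps the
    denominator positive when the covariance vanishes.\<close>
  define s where "s = min 1 (\<mu> / (4 * (G.covariance_bound + 1)))"
  have G1: "0 < G.covariance_bound + 1" using G.covariance_bound_nonneg by simp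
  have s: "0 < s" "s \<le> 1" unfolding s_def using \<mu> G1 by auto
  have s4: "4 * s * G.covariance_bound \<le> \<mu>"
  proof -
    have "s \<le> \<mu> / (4 * (G.covariance_bound + 1))" unfolding s_def by simp
    then have "4 * s * (G.covariance_bound + 1) \<le> \<mu>" using G1 by (simp add: field_simps)
    then show ?thesis using s by (simp add: algebra_simps)
  qed
  have penalty: "\<exists>L\<ge>1. \<forall>n N. \<epsilon> * real n \<le> real N \<longrightarrow>
     (\<integral>\<^sup>+\<omega>. ennreal (gap_penalty h0 s L n N \<omega>) \<partial>P) \<le> ennreal (exp (- (s * \<mu> * \<epsilon> / 8) * real n))"
    if "0 < \<epsilon>" for \<epsilon>
    by (rule gap_penalty_mean[where ?L0.0 = L0]) (use growth s(1) s4 \<mu> that in auto)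
  obtain L where L: "1 \<le> L" and U1: "\<And>n N. 1 / 2 * real n \<le> real N \<Longrightarrow>
     (\<integral>\<^sup>+\<omega>. ennreal (gap_penalty h0 s L n N \<omega>) \<partial>P) \<le> ennreal (exp (- (s * \<mu> * (1 / 2) / 8) * real n))"
    using penalty[of "1 / 2"] half_gt_zero[OF zero_less_one] by blast
  let ?e = "1 / (4 * real L)"
  have e: "0 < ?e" using L by simp
  obtain L' where L': "1 \<le> L'" and U2: "\<And>n N. ?e * real n \<le> real N \<Longrightarrow>
     (\<integral>\<^sup>+\<omega>. ennreal (gap_penalty h0 s L' n N \<omega>) \<partial>P) \<le> ennreal (exp (- (s * \<mu> * ?e / 8) * real n))"
    using penalty[OF e] by blast
  define c0 where "c0 = Min (R.p ` {1..L'})"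
  have c0: "c0 \<le> R.p t" if "1 \<le> t" "t \<le> L'" for t
    unfolding c0_def using that by (intro Min_le) auto
  have "c0 \<in> R.p ` {1..L'}" unfolding c0_def using L' by (intro Min_in) auto
  then have c0pos: "0 < c0" using R.p_pos by auto
  define K where "K = G.covariance_bound / 2 + 2 / (1 / (8 * real L))"
  define \<theta> where "\<theta> = c0\<^sup>2 * exp (h0 - K)"
  have \<theta>: "0 < \<theta>" unfolding \<theta>_def using c0pos by simp
  define r1 r2 r4 where "r1 = s * \<mu> * (1 / 2) / 8" and "r2 = s * \<mu> * ?e / 8" and "r4 = ln (1 + \<theta>) / (8 * real L)"
  define r where "r = min (min r1 r2) (min 1 r4)"
  \<comment> \<open>Each of the three penalties accounts for 1, and
    \<open>(1 + \<theta>)\<^sup>2\<close> makes up for the two units by which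
    \<open>n div (8 * L) - 1\<close> may fall short of n/(8L).\<close>
  define C where "C = 3 + (1 + \<theta>)\<^sup>2"
  have "0 < r1" "0 < r2" "0 < r4" unfolding r1_def r2_def r4_def using s \<mu> L \<theta> by auto
  then have r: "0 < r" "r \<le> r1" "r \<le> r2" "r \<le> 1" "r \<le> r4" unfolding r_def by auto
  have C: "0 < C" unfolding C_def using zero_le_power2[of "1 + \<theta>"] by linarith
  have div_ge: "1 / real m * real n \<le> real (n div m + 1)" if "1 \<le> m" for m n :: nat
  proof -
    have "n < m * (n div m + 1)" using that by (simp add: dividend_less_times_div algebra_simps) 
    then have "real n \<le> real m * real (n div m + 1)" by (metis less_imp_le of_nat_le_iff of_nat_mult)
    then show ?thesis using that by (simp add: field_simps)
  qed
  have "(\<integral>\<^sup>+\<omega>. (SUP h\<in>H. ennreal (R.nonmeeting n h \<omega>)) \<partial>P) \<le> ennreal (C * exp (- r * real n))"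
    if n: "1 \<le> n" for n
  proof -
    let ?A = "\<lambda>\<omega>. gap_penalty h0 s L n (n div 2 + 1) \<omega>" and ?B = "\<lambda>\<omega>. gap_penalty h0 s L' n (n div (4 * L) + 1) \<omega>"
      and ?D = "\<lambda>\<omega>. low_disorder_penalty K n (n div (8 * L) + 1) \<omega>" and ?F = "(1 / (1 + \<theta>)) ^ (n div (8 * L) - 1)"
    let ?E = "exp (- r * real n)"
    have F0: "0 \<le> ?F" using \<theta> by simp
    have mono: "exp (- r' * real n) \<le> ?E" if "r \<le> r'" for r' using that by (simp add: mult_right_mono)
    \<comment> \<open>The bound of \<open>nonmeeting_le\<close> is free of \<open>h\<close>, so it
      dominates the supremum pointwise, before integration.\<close>
    have "(\<integral>\<^sup>+\<omega>. (SUP h\<in>H. ennreal (R.nonmeeting n h \<omega>)) \<partial>P)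
      \<le> (\<integral>\<^sup>+\<omega>. ennreal (?A \<omega>) + ennreal (?B \<omega>) + ennreal (?D \<omega>) + ennreal ?F \<partial>P)"
    proof (intro nn_integral_mono SUP_least)
      fix \<omega> h assume "h \<in> H"
      have "ennreal (R.nonmeeting n h \<omega>)
          \<le> ennreal (?A \<omega> + ?B \<omega> + ?D \<omega> + ?F)"
        by (intro ennreal_leI nonmeeting_le[OF n less_imp_le[OF s(1)] s(2) H[OF \<open>h \<in> H\<close>] L c0 c0pos \<theta>_def])
      also have "\<dots> = ennreal (?A \<omega>) + ennreal (?B \<omega>) + ennreal (?D \<omega>) + ennreal ?F"
        using F0 gap_penalty_nonneg low_disorder_penalty_nonneg by (simp add: ennreal_plus)
      finally show "ennreal (R.nonmeeting n h \<omega>)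
          \<le> ennreal (?A \<omega>) + ennreal (?B \<omega>) + ennreal (?D \<omega>) + ennreal ?F" .
    qed
    also have "\<dots> = (\<integral>\<^sup>+\<omega>. ennreal (?A \<omega>) \<partial>P) + (\<integral>\<^sup>+\<omega>. ennreal (?B \<omega>) \<partial>P) + (\<integral>\<^sup>+\<omega>. ennreal (?D \<omega>) \<partial>P) + ennreal ?F"
      by (simp add: nn_integral_add G.emeasure_space_1[simplified])
    also have "\<dots> \<le> ennreal ?E + ennreal ?E + ennreal ?E + ennreal ((1 + \<theta>)\<^sup>2 * ?E)"
    proof (intro add_mono)
      have "(\<integral>\<^sup>+\<omega>. ennreal (?A \<omega>) \<partial>P) \<le> ennreal (exp (- r1 * real n))"
        unfolding r1_def using div_ge[of 2 n] by (intro U1) simp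
      then show "(\<integral>\<^sup>+\<omega>. ennreal (?A \<omega>) \<partial>P) \<le> ennreal ?E"
        using ennreal_leI[OF mono[OF r(2)]] by (rule order_trans)
      have "(\<integral>\<^sup>+\<omega>. ennreal (?B \<omega>) \<partial>P) \<le> ennreal (exp (- r2 * real n))"
        unfolding r2_def using div_ge[of "4 * L" n] L by (intro U2) simp
      then show "(\<integral>\<^sup>+\<omega>. ennreal (?B \<omega>) \<partial>P) \<le> ennreal ?E"
        using ennreal_leI[OF mono[OF r(3)]] by (rule order_trans)
      have "(\<integral>\<^sup>+\<omega>. ennreal (?D \<omega>) \<partial>P) \<le> ennreal (exp (- real n))"
        using div_ge[of "8 * L" n] L by (intro low_disorder_penalty_mean[OF _ _ K_def]) auto
      then show "(\<integral>\<^sup>+\<omega>. ennreal (?D \<omega>) \<partial>P) \<le> ennreal ?E"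
        using ennreal_leI[OF mono[OF r(4)]] by (simp add: order_trans)
      have "?F \<le> (1 + \<theta>)\<^sup>2 * exp (- r4 * real n)"
      proof -
        let ?l = "ln (1 + \<theta>)" and ?k = "n div (8 * L) - 1"
        have l0: "0 < ?l" using \<theta> by simp
        have "1 / real (8 * L) * real n \<le> real (n div (8 * L) + 1)" using L by (intro div_ge) simp
        also have "\<dots> \<le> real ?k + 2" by simp
        finally have "?l * (1 / real (8 * L) * real n) \<le> ?l * (real ?k + 2)" using l0 by (intro mult_left_mono) auto
        then have "- (real ?k * ?l) \<le> 2 * ?l + - r4 * real n" by (simp add: r4_def algebra_simps)
        then have "exp (- (real ?k * ?l)) \<le> exp (2 * ?l) * exp (- r4 * real n)"
          by (simp only: exp_le_cancel_iff exp_add[symmetric])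
        moreover have "exp (- (real ?k * ?l)) = ?F"
          using \<theta> by (simp add: exp_minus exp_of_nat_mult power_one_over inverse_eq_divide)
        moreover have "exp (2 * ?l) = (1 + \<theta>)\<^sup>2" using \<theta> exp_of_nat_mult[of 2 ?l] by simp
        ultimately show ?thesis by simp
      qed
      also have "\<dots> \<le> (1 + \<theta>)\<^sup>2 * ?E" using mono[OF r(5)] by (intro mult_left_mono) auto
      finally show "ennreal ?F \<le> ennreal ((1 + \<theta>)\<^sup>2 * ?E)" by (rule ennreal_leI)
    qed
    also have "\<dots> = ennreal (?E + ?E + ?E + (1 + \<theta>)\<^sup>2 * ?E)"
      by (simp only: ennreal_plus[symmetric] add_nonneg_nonneg exp_ge_zero mult_nonneg_nonneg zero_le_power2)
    also have "?E + ?E + ?E + (1 + \<theta>)\<^sup>2 * ?E = C * ?E" by (simp add: C_def algebra_simps)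
    finally show ?thesis .
  qed
  then show ?thesis using C r(1) by blast
qed

end

theorem lemma4p5:
  fixes M :: "'a measure" and T :: "nat \<Rightarrow> 'a \<Rightarrow> nat"
    and \<alpha> :: real and l :: "real \<Rightarrow> real"
    and P :: "(nat \<Rightarrow> real) measure" and H :: "real set"
  assumes "0 \<le> \<alpha>" and "slowly_varying l"
    and "renewal_increments M T \<alpha> l"
    and "centered_stationary_gaussian P"
    and "summable (\<lambda>a. \<bar>autocovariance P a\<bar>)"
    and "closed H" and "H \<subseteq> {critical_point M T P<..}"
  shows "\<exists>C>0. \<exists>r>0. \<forall>n\<ge>1.
    (\<integral>\<^sup>+\<omega>. (SUP h\<in>H. ennreal (replica_expectation M T n h \<omega>
        (\<lambda>(x, x'). \<Prod>k=1..<n. (1 - contact T k x * contact T k x')))) \<partial>P)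
      \<le> ennreal (C * exp (- r * real n))"
proof (cases "H = {}")
  case True
  \<comment> \<open>The supremum over the empty set is 0 in the extended nonnegative reals.\<close>
  then show ?thesis by (intro exI[of _ 1] conjI) (auto intro: exI[of _ 1] simp: bot_ennreal)
next
  case False
  interpret pinning M T \<alpha> l P
    using assms(3-5) by (simp add: pinning_def renewal_def gaussian_environment_def)
  obtain h0 where "0 < free_energy M T P h0" "\<And>h. h \<in> H \<Longrightarrow> h0 \<le> h"
    using exists_supercritical_below[OF assms(6,7) False] by blast
  then show ?thesis unfolding R.nonmeeting_def[symmetric] by (rule nonmeeting_decay)
qed

end
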